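(* Let $M\ge 2$ be an integer, and let $f=f_{\frac{1}{2M},\frac{1}{2M}}\colon[0,1]^3\to[0,1]^3$ be the heterochaos baker map with mostly neutral center. For any $\theta\in(0,1]$ there exists $C>0$ such that for any pair $(\varphi,\psi)$ of functions in $C^\theta([0,1]^3)$ we have \[ \mathrm{Cor}(\varphi,\psi\circ f^n)\le C\,\|\varphi\|_{C^\theta}\|\psi\|_{C^\theta}\, n^{-3/2}\quad\text{for all } n\ge 1 . \] The exponent $-3/2$ is optimal, in that there exist a pair $(\varphi,\psi)$ of functions in $C^\theta([0,1]^3)$ and a constant $C(\varphi,\psi)>0$ such that \[ \mathrm{Cor}(\varphi,\psi\circ f^n)\ge C(\varphi,\psi)\, n^{-3/2}\quad\text{for all } n\ge 1 . \]
   Context: Heterochaos baker maps. Let $M\ge2$ be an integer and $a,b\in(0,\frac1M)$. Coordinates on $[0,1]^3$ are $(x_u,x_c,x_s)$. Define $\tau_a\colon[0,1]\to[0,1]$ by $\tau_a(x_u)=\frac{x_u-(k-1)a}{a}$ on $[(k-1)a,ka)$ for $k\in\{1,\ldots,M\}$, and $\tau_a(x_u)=\frac{x_u-Ma}{1-Ma}$ on $[Ma,1]$. For $k\in\{1,\dots,M\}$ put $\Omega^+_{\alpha_k}=[(k-1)a,ka)\times[0,1]$, and put $\Omega^+_{\beta_k}=[Ma,1]\times[\frac{k-1}{M},\frac kM)$ for $k\le M-1$ and $\Omega^+_{\beta_M}=[Ma,1]\times[\frac{M-1}{M},1]$. Define $f_a\colon[0,1]^2\to[0,1]^2$ by \[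 f_a(x_u,x_c)=\begin{cases}\left(\tau_a(x_u),\frac{x_c}{M}+\frac{k-1}{M}\right)&\text{on }\Omega^+_{\alpha_k},\\ \left(\tau_a(x_u),Mx_c-k+1\right)&\text{on }\Omega^+_{\beta_k}.\end{cases} \] With $\Omega_{\gamma}=\Omega_\gamma^+\times[0,1]$, define $f_{a,b}\colon[0,1]^3\to[0,1]^3$ by \[ f_{a,b}(x_u,x_c,x_s)=\begin{cases}\left(f_a(x_u,x_c),(1-Mb)x_s\right)&\text{on }\Omega_{\alpha_k},\\ \left(f_a(x_u,x_c),bx_s+1+b(k-M-1)\right)&\text{on }\Omega_{\beta_k}.\end{cases} \] For $a=b=\frac1{2M}$ the map preserves the Lebesgue measure $m$ on $[0,1]^3$. For $\varphi,\psi\in L^2([0,1]^3)$, $\mathrm{Cor}(\varphi,\psi)=\left|\int\varphi\psi\,dm-\int\varphi\,dm\int\psi\,dm\right|$. For $\theta\in(0,1]$, $C^\theta([0,1]^d)$ is the space of Hölder continuous functions on $[0,1]^d$ with exponent $\theta$, with norm $\|\varphi\|_{C^\theta}=\|\varphi\|_{L^\infty}+|\varphi|_{C^\theta}$, where $\|\varphi\|_{L^\infty}=\sup_x|\varphi(x)|$ and $|\varphi|_{C^\theta}=\sup_{x\ne y}\frac{|\varphi(x)-\varphi(y)|}{|x-y|^\theta}$ with $|x-y|$ the Euclidean distance. *)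

theory Defs
  imports "HOL-Analysis.Analysis"
begin

section \<open>Heterochaos baker maps\<close>

text \<open>The indices of the pieces: \<open>Symb_alpha k\<close>, \<open>Symb_beta k\<close> with \<open>k \<in> {1..M}\<close>.\<close>

datatype symb = Symb_alpha nat | Symb_beta nat

definition symbols :: "nat \<Rightarrow> symb set" where
  "symbols M = Symb_alpha ` {1..M} \<union> Symb_beta ` {1..M}"

definition tau :: "nat \<Rightarrow> real \<Rightarrow> real \<Rightarrow> real" where
  "tau M a x =
     (if x < real M * a
      then (let k = (THE k. k \<in> {1..M} \<and> x \<in> {(real k - 1) * a ..< real k * a})
            in (x - (real k - 1) * a) / a)
      else (x - real M * a) / (1 - real M * a))"

fun Omega_plus :: "nat \<Rightarrow> real \<Rightarrow> symb \<Rightarrow> (real \<times> real) set" where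
  "Omega_plus M a (Symb_alpha k) = {(real k - 1) * a ..< real k * a} \<times> {0..1}"
| "Omega_plus M a (Symb_beta k) =
     {real M * a .. 1} \<times>
     (if k = M then {(real M - 1) / real M .. 1}
      else {(real k - 1) / real M ..< real k / real M})"

text \<open>The piece containing a point of the unit square; it is unique by the lemma
  \<open>symb_at_eqI\<close> below, and exists by \<open>Omega_plus_cover\<close>. Off the unit square the value is irrelevant.\<close>

definition symb_at :: "nat \<Rightarrow> real \<Rightarrow> real \<times> real \<Rightarrow> symb" where
  "symb_at M a p = (THE g. g \<in> symbols M \<and> p \<in> Omega_plus M a g)"

definition baker2 :: "nat \<Rightarrow> real \<Rightarrow> real \<times> real \<Rightarrow> real \<times> real" where
  "baker2 M a = (\<lambda>(xu, xc).
     (case symb_at M a (xu, xc) of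
        Symb_alpha k \<Rightarrow> (tau M a xu, xc / real M + (real k - 1) / real M)
      | Symb_beta k \<Rightarrow> (tau M a xu, real M * xc - real k + 1)))"

text \<open>The third coordinate of the domain pieces is the whole unit interval, so the piece
  is determined by the first two coordinates.\<close>

definition baker3 :: "nat \<Rightarrow> real \<Rightarrow> real \<Rightarrow> real \<times> real \<times> real \<Rightarrow> real \<times> real \<times> real" where
  "baker3 M a b = (\<lambda>(xu, xc, xs).
     (let (yu, yc) = baker2 M a (xu, xc) in
      case symb_at M a (xu, xc) of
        Symb_alpha k \<Rightarrow> (yu, yc, (1 - real M * b) * xs)
      | Symb_beta k \<Rightarrow> (yu, yc, b * xs + 1 + b * (real k - real M - 1))))"

definition unit_cube :: "(real \<times> real \<times> real) set" where
  "unit_cube = {0..1} \<times> {0..1} \<times> {0..1}"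


section \<open>Correlations and Hoelder spaces\<close>

definition Cor :: "(real \<times> real \<times> real \<Rightarrow> real) \<Rightarrow> (real \<times> real \<times> real \<Rightarrow> real) \<Rightarrow> real" where
  "Cor \<phi> \<psi> =
     \<bar>(LINT x|lebesgue_on unit_cube. \<phi> x * \<psi> x)
      - (LINT x|lebesgue_on unit_cube. \<phi> x) * (LINT x|lebesgue_on unit_cube. \<psi> x)\<bar>"

text \<open>On products of copies of the reals, \<^const>\<open>dist\<close> is the Euclidean distance. A function in
  \<open>holder_space \<theta> S\<close> is constrained on \<open>S\<close> only; the norms likewise see only its restriction
  to \<open>S\<close>. The suprema below are over sets that are bounded and nonempty when \<open>S\<close> is bounded with
  at least two points and the function lies in the space.\<close>

definition holder_space :: "real \<Rightarrow> 'a::metric_space set \<Rightarrow> ('a \<Rightarrow> real) set" where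
  "holder_space \<theta> S =
     {\<phi>. \<exists>L. \<forall>x\<in>S. \<forall>y\<in>S. \<bar>\<phi> x - \<phi> y\<bar> \<le> L * dist x y powr \<theta>}"

definition sup_norm :: "'a set \<Rightarrow> ('a \<Rightarrow> real) \<Rightarrow> real" where
  "sup_norm S \<phi> = (SUP x\<in>S. \<bar>\<phi> x\<bar>)"

definition holder_seminorm :: "real \<Rightarrow> 'a::metric_space set \<Rightarrow> ('a \<Rightarrow> real) \<Rightarrow> real" where
  "holder_seminorm \<theta> S \<phi> =
     (SUP (x, y)\<in>{(x, y). x \<in> S \<and> y \<in> S \<and> x \<noteq> y}. \<bar>\<phi> x - \<phi> y\<bar> / dist x y powr \<theta>)"

definition holder_norm :: "real \<Rightarrow> 'a::metric_space set \<Rightarrow> ('a \<Rightarrow> real) \<Rightarrow> real" where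
  "holder_norm \<theta> S \<phi> = sup_norm S \<phi> + holder_seminorm \<theta> S \<phi>"


section \<open>Well-definedness of the maps\<close>

lemma interval_index_unique:
  fixes x a :: real
  assumes a: "a > 0"
    and j: "(real j - 1) * a \<le> x" "x < real j * a"
    and k: "(real k - 1) * a \<le> x" "x < real k * a"
  shows "j = k"
proof -
  have "(real j - 1) * a < real k * a" "(real k - 1) * a < real j * a"
    using j k by linarith+
  then have "real j - 1 < real k" "real k - 1 < real j"
    using a by simp_all
  then show ?thesis by linarith
qed

lemma interval_index_exists:
  fixes x a :: real
  assumes a: "a > 0" and x: "0 \<le> x" "x < real M * a"
  obtains k where "k \<in> {1..M}" "x \<in> {(real k - 1) * a ..< real k * a}"
proof -
  define k where "k = nat \<lfloor>x / a\<rfloor> + 1"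
  have nn: "0 \<le> \<lfloor>x / a\<rfloor>" using a x by simp
  have k: "real k - 1 = of_int \<lfloor>x / a\<rfloor>" using nn by (simp add: k_def)
  have "real k - 1 \<le> x / a" "x / a < real k" using k by linarith+
  then have bounds: "(real k - 1) * a \<le> x" "x < real k * a"
    using a by (simp_all add: field_simps)
  then have "(real k - 1) * a < real M * a" using x by linarith
  then have "real k - 1 < real M" using a by simp
  then have "k \<in> {1..M}" by (simp add: k_def)
  with bounds show ?thesis using that by simp
qed

lemma tau_eq:
  assumes a: "a > 0" and k: "k \<in> {1..M}" and x: "x \<in> {(real k - 1) * a ..< real k * a}"
  shows "tau M a x = (x - (real k - 1) * a) / a"
proof -
  have "real k * a \<le> real M * a" using a k by (intro mult_right_mono) auto
  then have "x < real M * a" using x by auto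
  moreover have "(THE k. k \<in> {1..M} \<and> x \<in> {(real k - 1) * a ..< real k * a}) = k"
    using k x interval_index_unique[OF a] by (intro the_equality) auto
  ultimately show ?thesis by (simp add: tau_def Let_def)
qed

lemma Omega_plus_beta_bounds:
  assumes "M > 0" "k \<in> {1..M}" "(xu, xc) \<in> Omega_plus M a (Symb_beta k)"
  shows "real M * a \<le> xu" "xu \<le> 1" "real k - 1 \<le> real M * xc"
    "real M * xc \<le> real k" "k < M \<Longrightarrow> real M * xc < real k"
proof -
  have u: "xu \<in> {real M * a .. 1}"
    and c: "xc \<in> (if k = M then {(real M - 1) / real M .. 1}
      else {(real k - 1) / real M ..< real k / real M})"
    using assms(3) by (simp_all only: Omega_plus.simps mem_Sigma_iff)
  show "real M * a \<le> xu" "xu \<le> 1" using u by simp_all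
  have "(real k - 1) / real M \<le> xc" using c by (simp split: if_splits)
  then show "real k - 1 \<le> real M * xc" using assms(1) by (simp add: pos_divide_le_eq mult.commute)
  have "xc \<le> real k / real M" using c assms(1) by (simp split: if_splits)
  then show "real M * xc \<le> real k" using assms(1) by (simp add: pos_le_divide_eq mult.commute)
  assume "k < M"
  then have "xc < real k / real M" using c by simp
  then show "real M * xc < real k" using assms(1) by (simp add: pos_less_divide_eq mult.commute)
qed

lemma symb_at_eqI:
  assumes M: "M > 0" and a: "a > 0" and g: "g \<in> symbols M" "p \<in> Omega_plus M a g"
  shows "symb_at M a p = g"
proof -
  obtain xu xc where p: "p = (xu, xc)" by (cases p)
  have AB: False
    if "j \<in> {1..M}" "p \<in> Omega_plus M a (Symb_alpha j)" "p \<in> Omega_plus M a (Symb_beta k)" for j k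
  proof -
    have "real j * a \<le> real M * a" using a that(1) by (intro mult_right_mono) auto
    then show False using that p by auto
  qed
  have BB: "j = k"
    if j: "j \<in> {1..M}" "p \<in> Omega_plus M a (Symb_beta j)"
      and k: "k \<in> {1..M}" "p \<in> Omega_plus M a (Symb_beta k)" for j k
  proof (rule ccontr)
    assume "j \<noteq> k"
    have jj: "real j - 1 \<le> real M * xc" "j < M \<Longrightarrow> real M * xc < real j"
      using Omega_plus_beta_bounds(3,5)[OF M j(1), of xu xc a] j(2) p by blast+
    have kk: "real k - 1 \<le> real M * xc" "k < M \<Longrightarrow> real M * xc < real k"
      using Omega_plus_beta_bounds(3,5)[OF M k(1), of xu xc a] k(2) p by blast+
    from \<open>j \<noteq> k\<close> consider "j < k" | "k < j" by linarith
    then show False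
    proof cases
      case 1
      then have "real M * xc < real j" "real j \<le> real k - 1" using jj(2) k(1) by auto
      then show False using kk(1) by linarith
    next
      case 2
      then have "real M * xc < real k" "real k \<le> real j - 1" using kk(2) j(1) by auto
      then show False using jj(1) by linarith
    qed
  qed
  have AA: "j = k"
    if "p \<in> Omega_plus M a (Symb_alpha j)" "p \<in> Omega_plus M a (Symb_alpha k)" for j k
    using that p interval_index_unique[OF a] by auto
  have "h = g" if h: "h \<in> symbols M" "p \<in> Omega_plus M a h" for h
  proof (cases h; cases g)
    fix i j assume "h = Symb_alpha i" "g = Symb_alpha j"
    then show ?thesis using AA[of i j] h(2) g(2) by simp
  next
    fix i j assume e: "h = Symb_alpha i" "g = Symb_beta j"
    then have "i \<in> {1..M}" using h(1) by (auto simp: symbols_def)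
    then show ?thesis using AB[of i j] h(2) g(2) e by simp
  next
    fix i j assume e: "h = Symb_beta i" "g = Symb_alpha j"
    then have "j \<in> {1..M}" using g(1) by (auto simp: symbols_def)
    then show ?thesis using AB[of j i] h(2) g(2) e by simp
  next
    fix i j assume e: "h = Symb_beta i" "g = Symb_beta j"
    then have "i \<in> {1..M}" "j \<in> {1..M}" using h(1) g(1) by (auto simp: symbols_def)
    then show ?thesis using BB[of i j] h(2) g(2) e by simp
  qed
  then show ?thesis
    unfolding symb_at_def using g by (intro the_equality) blast+
qed

lemma Omega_plus_cover:
  assumes M: "M > 0" and a: "a > 0" and p: "p \<in> {0..1} \<times> {0..1}"
  obtains g where "g \<in> symbols M" "p \<in> Omega_plus M a g"
proof -
  obtain xu xc where pp: "p = (xu, xc)" by (cases p)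
  have u: "0 \<le> xu" "xu \<le> 1" and c: "0 \<le> xc" "xc \<le> 1" using p pp by auto
  show ?thesis
  proof (cases "xu < real M * a")
    case True
    obtain k where "k \<in> {1..M}" "xu \<in> {(real k - 1) * a ..< real k * a}"
      using interval_index_exists[OF a u(1) True] .
    then show ?thesis
      using that[of "Symb_alpha k"] c pp by (auto simp: symbols_def)
  next
    case False
    show ?thesis
    proof (cases "xc = 1")
      case True
      then show ?thesis
        using that[of "Symb_beta M"] u False pp M by (auto simp: symbols_def)
    next
      case False': False
      have "1 / real M > 0" "xc < real M * (1 / real M)" using M c False' by auto
      from interval_index_exists[OF this(1) c(1) this(2)]
      obtain k where "k \<in> {1..M}" "xc \<in> {(real k - 1) * (1 / real M) ..< real k * (1 / real M)}" .
      then show ?thesis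
        using that[of "Symb_beta k"] u c False pp by (cases "k = M") (auto simp: symbols_def)
    qed
  qed
qed

lemma baker3_alpha:
  assumes "M > 0" "a > 0" "k \<in> {1..M}" "(xu, xc) \<in> Omega_plus M a (Symb_alpha k)"
  shows "baker3 M a b (xu, xc, xs) =
    ((xu - (real k - 1) * a) / a, xc / real M + (real k - 1) / real M, (1 - real M * b) * xs)"
proof -
  have "symb_at M a (xu, xc) = Symb_alpha k"
    using assms(3) by (intro symb_at_eqI assms(1,2,4)) (simp add: symbols_def)
  moreover have "tau M a xu = (xu - (real k - 1) * a) / a"
    using assms(4) by (intro tau_eq assms(2,3)) simp
  ultimately show ?thesis by (simp add: baker3_def baker2_def)
qed

lemma baker3_beta:
  assumes "M > 0" "a > 0" "k \<in> {1..M}" "(xu, xc) \<in> Omega_plus M a (Symb_beta k)"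
  shows "baker3 M a b (xu, xc, xs) =
    ((xu - real M * a) / (1 - real M * a), real M * xc - real k + 1,
     b * xs + 1 + b * (real k - real M - 1))"
proof -
  have "symb_at M a (xu, xc) = Symb_beta k"
    using assms(3) by (intro symb_at_eqI assms(1,2,4)) (simp add: symbols_def)
  moreover have "tau M a xu = (xu - real M * a) / (1 - real M * a)"
    using Omega_plus_beta_bounds(1)[OF assms(1,3,4)] by (simp add: tau_def)
  ultimately show ?thesis by (simp add: baker3_def baker2_def)
qed

end

theory Submission
  imports Defs
begin

text \<open>
Read the base-\<open>M\<close> expansion of \<open>x\<^sub>c\<close> as a stack of digits. For \<open>x\<^sub>u < 1/2\<close> the map pushes a
digit, read off from \<open>x\<^sub>u\<close>, onto the stack; for \<open>x\<^sub>u \<ge> 1/2\<close> it pops the top digit and stores it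
in \<open>x\<^sub>s\<close>. Under Lebesgue measure the choices between push and pop are independent fair coin tosses,
independent of the digits, which are independent and uniform. The depth of a fixed digit in the
stack is therefore a simple random walk; a digit enters the stack at depth 1 and is gone when its
depth reaches 0. Apart from exponentially small terms, the value of \<open>\<phi>\<close> now and the value of
\<open>\<psi>\<close> after \<open>n\<close> steps are dependent only through digits that both of them see. A Hoelder function
sees a digit at depth \<open>i\<close> with weight at most a constant times \<open>r\<^sup>i\<close>, where \<open>r = 2 powr -\<theta>\<close>, so the
correlation is a sum of \<open>r\<^sup>i r\<^sup>j\<close> times the probability that the walk killed at 0 goes from \<open>i\<close> to
\<open>j\<close> in \<open>n\<close> steps. This probability is at most \<open>i j\<close> times the probability of an excursion of
length about \<open>n\<close>, which is of order \<open>n powr (-3/2)\<close>.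

The upper bound makes this precise without random variables. Write \<open>n = m + l\<close> with \<open>m\<close> and \<open>l\<close>
about \<open>n/2\<close>, and transport \<open>\<phi>\<close> forward by \<open>m\<close> steps and \<open>\<psi>\<close> backward by \<open>l\<close> steps. The first
function then hardly depends on \<open>x\<^sub>u\<close> and the second hardly on \<open>x\<^sub>s\<close>
(\<open>bwd_iter_contracts\<close>, \<open>fwd_iter_contracts\<close>), so up to an exponentially small error only the
covariance of two functions of \<open>x\<^sub>c\<close> remains, obtained by integrating out the other coordinates.
Both arise by iterating an averaging operator, \<open>averaged_step\<close>, and the oscillation caused by a change of
the digit at depth \<open>j\<close> evolves under it by the generator of the walk (\<open>step_iter_influence\<close>). A
martingale argument over the digits bounds the covariance by the sum over \<open>j\<close> of the products of the
two oscillations (\<open>covariance_le\<close>). Summation by parts carries the \<open>m\<close> steps of one factor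
over to the other (\<open>influence_shift\<close>), and the resulting solution of the heat equation on the half
line is computed from its spectral representation with eigenfunctions \<open>sin (j x)\<close> and eigenvalue
\<open>cos x\<close> (\<open>influence_eq_killed\<close>); \<open>\<bar>sin (j x)\<bar> \<le> j \<bar>sin x\<bar>\<close> reduces every kernel entry to the
excursion integral, which obeys a Wallis recursion.

For the lower bound take \<open>\<phi> = \<psi> = x\<^sub>c\<close>. The operator that a step of the map induces on functions of
\<open>x\<^sub>c\<close> is symmetric and acts on the sawtooth functions \<open>frac (M\<^sup>i c) - 1/2\<close> as the same random
walk, except that at the boundary it holds with positive weight instead of only being killed
(\<open>center_op_saw_0\<close>). All its entries are nonnegative, so the correlation dominates the excursion
probability when \<open>n\<close> is even, and a single holding step takes care of odd \<open>n\<close>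
(\<open>saw_corr_lower\<close>).
\<close>


section \<open>Uniform measures on the interval and the cube\<close>

definition unif :: "real measure" where
  "unif = density lborel (indicator {0..<1})"

lemma sets_unif [measurable_cong, simp]: "sets unif = sets borel"
  by (simp add: unif_def)

lemma space_unif [simp]: "space unif = UNIV"
  by (simp add: unif_def)

lemma emeasure_unif_UNIV: "emeasure unif UNIV = 1"
  by (simp add: unif_def emeasure_density)

interpretation unif: finite_measure unif
  by standard (simp add: emeasure_unif_UNIV)

lemma measure_unif_UNIV [simp]: "measure unif UNIV = 1"
  by (simp add: measure_def emeasure_unif_UNIV)

interpretation unif2: pair_sigma_finite unif unif ..

definition cube :: "(real \<times> real \<times> real) set" where
  "cube = {0..<1} \<times> {0..<1} \<times> {0..<1}"

definition unif3 :: "(real \<times> real \<times> real) measure" where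
  "unif3 = unif \<Otimes>\<^sub>M (unif \<Otimes>\<^sub>M unif)"

lemma sets_unif3 [measurable_cong, simp]: "sets unif3 = sets borel"
  unfolding unif3_def
  by (metis borel_prod sets_pair_measure_cong sets_unif)

lemma space_unif3 [simp]: "space unif3 = UNIV"
  by (simp add: unif3_def space_pair_measure)

lemma cube_borel [measurable]: "cube \<in> sets borel"
  unfolding cube_def by (intro borel_Times) auto

lemma unif3_eq_density: "unif3 = density lborel (indicator cube)"
proof -
  have sf: "sigma_finite_measure unif" ..
  have 2: "unif \<Otimes>\<^sub>M unif = density lborel (\<lambda>(x,y). indicator {0..<1} x * indicator {0..<1} y)"
    unfolding unif_def
    by (subst pair_measure_density) (use sf in \<open>auto simp: unif_def lborel_prod lborel.sigma_finite_measure_axioms\<close>)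
  have "sigma_finite_measure (unif \<Otimes>\<^sub>M unif)"
    by (rule unif2.sigma_finite_measure_axioms)
  then have "unif3 = density lborel (\<lambda>(x,y). indicator {0..<1} x * (case y of (x,y) \<Rightarrow> indicator {0..<1} x * indicator {0..<1} y))"
    unfolding unif3_def 2
    unfolding unif_def
    by (subst pair_measure_density)
       (auto simp: lborel_prod lborel.sigma_finite_measure_axioms borel_prod[symmetric])
  also have "(\<lambda>(x,y). indicator {0..<1} x * (case y of (x,y) \<Rightarrow> indicator {0..<1} x * indicator {0..<1} y))
     = (indicator cube :: real \<times> real \<times> real \<Rightarrow> ennreal)"
    by (auto simp: cube_def indicator_def fun_eq_iff)
  finally show ?thesis .
qed

lemma emeasure_unif3_UNIV: "emeasure unif3 UNIV = 1"
proof -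
  have "emeasure unif3 (UNIV \<times> UNIV \<times> UNIV) = 1"
    unfolding unif3_def
    using sigma_finite_measure.emeasure_pair_measure_Times[OF unif2.sigma_finite_measure_axioms,
        of UNIV unif "UNIV \<times> UNIV"] unif.emeasure_pair_measure_Times[of UNIV unif UNIV]
      sets.top[of "unif \<Otimes>\<^sub>M unif"]
    by (simp add: emeasure_unif_UNIV space_pair_measure del: sets_pair_measure_cong)
  then show ?thesis by simp
qed

interpretation unif3: finite_measure unif3
  by standard (simp add: emeasure_unif3_UNIV)

lemma measure_unif3_UNIV [simp]: "measure unif3 UNIV = 1"
  by (simp add: measure_def emeasure_unif3_UNIV)

lemma AE_unif: "AE x in unif. x \<in> {0..<1}"
  unfolding unif_def by (subst AE_density) (auto simp: indicator_def split: if_splits)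

lemma AE_unif3: "AE x in unif3. x \<in> cube"
  unfolding unif3_eq_density by (subst AE_density) (auto simp: indicator_def split: if_splits)

definition bounded_borel :: "('a::topological_space \<Rightarrow> real) \<Rightarrow> bool" where
  "bounded_borel F \<longleftrightarrow> F \<in> borel_measurable borel \<and> (\<exists>B. \<forall>x. \<bar>F x\<bar> \<le> B)"

lemma integrable_unif: "bounded_borel F \<Longrightarrow> integrable unif F"
proof -
  assume "bounded_borel F"
  then obtain B where "F \<in> borel_measurable borel" "\<And>x. \<bar>F x\<bar> \<le> B" by (auto simp: bounded_borel_def)
  then show ?thesis by (intro unif.integrable_const_bound[where B=B]) auto
qed

lemma integrable_unif3: "bounded_borel F \<Longrightarrow> integrable unif3 F"
proof -
  assume "bounded_borel F"
  then obtain B where "F \<in> borel_measurable borel" "\<And>x. \<bar>F x\<bar> \<le> B" by (auto simp: bounded_borel_def)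
  then show ?thesis by (intro unif3.integrable_const_bound[where B=B]) auto
qed

lemma integral_unif:
  fixes F :: "real \<Rightarrow> real"
  assumes [measurable]: "F \<in> borel_measurable borel"
  shows "(\<integral>x. F x \<partial>unif) = (\<integral>x. indicator {0..<1} x * F x \<partial>lborel)"
  unfolding unif_def
  using integral_density[of F lborel "indicator {0..<1}"] by (simp add: ennreal_indicator)

lemma integral_unif3:
  fixes F :: "real \<times> real \<times> real \<Rightarrow> real"
  assumes [measurable]: "F \<in> borel_measurable borel"
  shows "(\<integral>x. F x \<partial>unif3) = (\<integral>x. indicator cube x * F x \<partial>lborel)"
  unfolding unif3_eq_density
  using integral_density[of F lborel "indicator cube"] by (simp add: ennreal_indicator)

text \<open>Self-similarity of the uniform distribution: prepending a uniform digit to a uniform number gives a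
uniform number. All integral identities for the map reduce to this one.\<close>

lemma integral_unif_split:
  assumes F: "bounded_borel F" and N: "N > 0"
  shows "(\<integral>x. F x \<partial>unif) = (\<Sum>k<N. \<integral>x. F ((x + real k) / real N) \<partial>unif) / real N"
proof -
  have [measurable]: "F \<in> borel_measurable borel" using F by (simp add: bounded_borel_def)
  have cell: "indicator {0..<1} x = (\<Sum>k<N. indicator {0..<1} (real N * x - real k) :: real)" for x
  proof (cases "x \<in> {0..<1}")
    case True
    define i where "i = nat \<lfloor>real N * x\<rfloor>"
    have i: "real i \<le> real N * x" "real N * x < real i + 1"
      using True by (auto simp: i_def)
    have "real i < real N" using True i(1) N by (smt (verit) atLeastLessThan_iff mult_less_cancel_left2 of_nat_0_less_iff)
    then have "i < N" by simp
    have "(\<Sum>k<N. indicator {0..<1} (real N * x - real k) :: real) = (\<Sum>k<N. if k = i then 1 else 0)"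
      using i by (intro sum.cong) (auto simp: indicator_def)
    then show ?thesis using \<open>i < N\<close> True by simp
  next
    case False
    have "real N * x - real k \<notin> {0..<1}" if "k < N" for k
    proof
      assume A: "real N * x - real k \<in> {0..<1}"
      then have 1: "real N * x \<ge> 0" "real N * x < real k + 1" by auto
      moreover have "real k + 1 \<le> real N" using that by linarith
      ultimately have 2: "real N * x < real N" by linarith
      have 0: "x \<ge> 0" using 1(1) N by (auto simp: zero_le_mult_iff)
      have "x < 1"
      proof (rule ccontr)
        assume "\<not> x < 1"
        then have "real N * 1 \<le> real N * x" by (intro mult_left_mono) auto
        with 2 show False by linarith
      qed
      with 0 False show False by simp
    qed
    then have "indicator {0..<1} (real N * x - real k) = (0 :: real)" if "k < N" for k
      using that by (simp del: atLeastLessThan_iff)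
    then have "(\<Sum>k<N. indicator {0..<1} (real N * x - real k) :: real) = 0"
      by (intro sum.neutral ballI) (simp only: lessThan_iff)
    then show ?thesis using False by (simp add: indicator_def)
  qed
  obtain B where B: "\<And>x. \<bar>F x\<bar> \<le> B" using F by (auto simp: bounded_borel_def)
  have G: "bounded_borel (\<lambda>x. F ((x + real k) / real N))" for k
    using B unfolding bounded_borel_def by (intro conjI) (measurable, auto)
  have int: "integrable lborel (\<lambda>x. indicator {0..<1} x * F ((x + real k) / real N))" for k
  proof -
    have m: "(\<lambda>x. F ((x + real k) / real N)) \<in> borel_measurable lborel" by measurable
    have "integrable unif (\<lambda>x. F ((x + real k) / real N))" by (rule integrable_unif[OF G])
    then show ?thesis unfolding unif_def ennreal_indicator[symmetric]
      by (subst (asm) integrable_density[OF m]) (auto simp: mult.commute)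
  qed
  have eq: "(\<integral>x. indicator {0..<1} (real N * x - real k) * F x \<partial>lborel) =
     (\<integral>x. F ((x + real k) / real N) \<partial>unif) / real N" (is ?A)
   and int2: "integrable lborel (\<lambda>x. indicator {0..<1} (real N * x - real k) * F x)" (is ?B) for k
  proof -
    have "F ((real N * x - real k + real k) / real N) = F x" for x
      using N by simp
    then have *: "(\<lambda>x. indicator {0..<1} (real N * x - real k) * F x) =
       (\<lambda>x. indicator {0..<1} (- real k + real N * x) * F ((- real k + real N * x + real k) / real N))" by simp
    show ?A unfolding *
      using lborel_integral_real_affine[of "real N" "\<lambda>x. indicator {0..<1} x * F ((x + real k) / real N)" "- real k"] N
      by (subst integral_unif) (simp_all)
    show ?B unfolding * using N
      by (intro lborel_integrable_real_affine int) simp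
  qed
  have "(\<integral>x. F x \<partial>unif) = (\<integral>x. (\<Sum>k<N. indicator {0..<1} (real N * x - real k) * F x) \<partial>lborel)"
    unfolding integral_unif[OF \<open>F \<in> borel_measurable borel\<close>] sum_distrib_right[symmetric]
    by (subst cell) (rule refl)
  also have "\<dots> = (\<Sum>k<N. (\<integral>x. indicator {0..<1} (real N * x - real k) * F x \<partial>lborel))"
    by (intro Bochner_Integration.integral_sum int2)
  also have "\<dots> = (\<Sum>k<N. \<integral>x. F ((x + real k) / real N) \<partial>unif) / real N"
    by (simp add: eq sum_divide_distrib)
  finally show ?thesis .
qed

text \<open>The order of integration, with \<open>u\<close> innermost and \<open>c\<close> outermost, is the one in which both the invariance
of the measure and the factorisation of correlations can be read off without exchanging integrals.\<close>

lemma integral_unif3_iterated: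
  assumes F: "bounded_borel F"
  shows "(\<integral>p. F p \<partial>unif3) = (\<integral>c. \<integral>s. \<integral>u. F (u, c, s) \<partial>unif \<partial>unif \<partial>unif)"
proof -
  interpret A: pair_sigma_finite unif "unif \<Otimes>\<^sub>M unif" ..
  have [measurable]: "F \<in> borel_measurable (unif \<Otimes>\<^sub>M (unif \<Otimes>\<^sub>M unif))"
    using F sets_unif3 unfolding bounded_borel_def unif3_def by (simp cong: measurable_cong_sets)
  obtain B where B: "\<And>x. \<bar>F x\<bar> \<le> B" using F by (auto simp: bounded_borel_def)
  have i3: "integrable (unif \<Otimes>\<^sub>M (unif \<Otimes>\<^sub>M unif)) F"
    using integrable_unif3[OF F] by (simp add: unif3_def)
  have "(\<integral>p. F p \<partial>unif3) = (\<integral>y. \<integral>u. F (u, y) \<partial>unif \<partial>(unif \<Otimes>\<^sub>M unif))"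
    unfolding unif3_def using A.integral_snd[of "\<lambda>x y. F (x, y)"] i3 by simp
  also have "\<dots> = (\<integral>c. \<integral>s. \<integral>u. F (u, c, s) \<partial>unif \<partial>unif \<partial>unif)"
    using unif2.integral_fst'[of "\<lambda>y. \<integral>u. F (u, y) \<partial>unif"] A.integrable_snd[of "\<lambda>x y. F (x,y)"] i3
    by simp
  finally show ?thesis .
qed


section \<open>The baker map and its inverse in floor and fractional part\<close>

text \<open>The first digit of \<open>x\<close> in base \<open>M\<close>, for \<open>x\<close> in the unit interval.\<close>

definition digit :: "nat \<Rightarrow> real \<Rightarrow> real" where
  "digit M x = real_of_int \<lfloor>real M * x\<rfloor>"

text \<open>The map for parameters \<open>1 / (2 M)\<close> on the half-open cube, together with its inverse. On the faces where a
coordinate equals 1, which are null sets, \<open>fwd\<close> may differ from the baker map; the half-open cube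
is mapped bijectively to itself. In the second case of \<open>bwd\<close> the digit of \<open>s \<ge> 1/2\<close> in base \<open>2 M\<close> is at least \<open>M\<close>,
and the excess over \<open>M\<close> is the digit that was popped.\<close>

definition fwd :: "nat \<Rightarrow> real \<times> real \<times> real \<Rightarrow> real \<times> real \<times> real" where
  "fwd M = (\<lambda>(u, c, s).
     if u < 1/2 then (frac (2 * real M * u), (c + digit (2 * M) u) / real M, s / 2)
     else (2 * u - 1, frac (real M * c), 1/2 + (s + digit M c) / (2 * real M)))"

definition bwd :: "nat \<Rightarrow> real \<times> real \<times> real \<Rightarrow> real \<times> real \<times> real" where
  "bwd M = (\<lambda>(u, c, s).
     if s < 1/2 then ((u + digit M c) / (2 * real M), frac (real M * c), 2 * s)
     else (1/2 + u / 2, (c + (digit (2 * M) s - real M)) / real M, frac (2 * real M * s)))"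

lemma digit_measurable [measurable]: "digit M \<in> borel_measurable borel"
  unfolding digit_def by measurable

lemma frac_measurable [measurable]: "(frac :: real \<Rightarrow> real) \<in> borel_measurable borel"
  unfolding frac_def by measurable

lemma fwd_measurable [measurable]: "fwd M \<in> borel_measurable borel"
  unfolding fwd_def borel_prod[symmetric] by measurable

lemma bwd_measurable [measurable]: "bwd M \<in> borel_measurable borel"
  unfolding bwd_def borel_prod[symmetric] by measurable

lemma fwd_iter_measurable [measurable]: "(fwd M ^^ n) \<in> borel_measurable borel"
  by (induction n) (simp_all add: measurable_comp[OF _ fwd_measurable])

lemma bwd_iter_measurable [measurable]: "(bwd M ^^ n) \<in> borel_measurable borel"
  by (induction n) (simp_all add: measurable_comp[OF _ bwd_measurable])

lemma digit_range:
  assumes "M > 0" "x \<in> {0..<1}"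
  obtains k where "k < M" "digit M x = real k" "real M * x = real k + frac (real M * x)"
proof -
  define k where "k = nat \<lfloor>real M * x\<rfloor>"
  have "real M * x < real M * 1" using assms by (intro mult_strict_left_mono) auto
  moreover have "0 \<le> \<lfloor>real M * x\<rfloor>" using assms by simp
  ultimately have "k < M" "digit M x = real k" by (auto simp: k_def digit_def nat_less_iff floor_less_iff)
  then show thesis using that by (simp add: frac_def digit_def)
qed

lemma digit_append [simp]:
  assumes "M > 0" "x \<in> {0..<1}"
  shows "digit M ((x + real k) / real M) = real k" "frac (real M * ((x + real k) / real M)) = x"
proof -
  have 1: "real M * ((x + real k) / real M) = x + of_int (int k)" using assms by simp
  have 2: "\<lfloor>x + real_of_int (int k)\<rfloor> = int k" using assms by (simp add: floor_eq_iff)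
  show "digit M ((x + real k) / real M) = real k" unfolding digit_def 1 2 by simp
  show "frac (real M * ((x + real k) / real M)) = x" unfolding frac_def 1 2 by simp
qed

lemma append_cube:
  assumes "M > 0" "x \<in> {0..<1}" "k < M"
  shows "(x + real k) / real M \<in> {0..<1}"
proof -
  have "real k + 1 \<le> real M" using assms by linarith
  then show ?thesis using assms by (auto simp: divide_simps)
qed

lemma fwd_cube:
  assumes "M > 0" "p \<in> cube" shows "fwd M p \<in> cube"
proof -
  obtain u c s where p: "p = (u, c, s)" "u \<in> {0..<1}" "c \<in> {0..<1}" "s \<in> {0..<1}"
    using assms(2) by (auto simp: cube_def)
  show ?thesis
  proof (cases "u < 1/2")
    case True
    then have "2 * u \<in> {0..<1}" using p by auto
    from digit_range[OF assms(1) this] obtain k where k: "k < M" "digit M (2 * u) = real k" .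
    then have "digit (2 * M) u = real k" by (simp add: digit_def mult_ac)
    then show ?thesis using True p k append_cube[OF assms(1) p(3) k(1)]
      by (auto simp: fwd_def cube_def frac_lt_1)
  next
    case False
    from digit_range[OF assms(1) p(3)] obtain k where k: "k < M" "digit M c = real k" .
    have "(1/2 + (s + real k) / (2 * real M)) = ((s + real k) / real M + real 1) / real 2"
      using assms(1) by (simp add: field_simps)
    also have "\<dots> \<in> {0..<1}" by (rule append_cube) (use append_cube[OF assms(1) p(4) k(1)] in auto)
    finally show ?thesis using False p k
      by (auto simp: fwd_def cube_def frac_lt_1)
  qed
qed

lemma bwd_fwd:
  assumes "M > 0" "p \<in> cube" shows "bwd M (fwd M p) = p"
proof -
  obtain u c s where p: "p = (u, c, s)" "u \<in> {0..<1}" "c \<in> {0..<1}" "s \<in> {0..<1}"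
    using assms(2) by (auto simp: cube_def)
  show ?thesis
  proof (cases "u < 1/2")
    case True
    then have "2 * u \<in> {0..<1}" using p by auto
    from digit_range[OF assms(1) this] obtain k where k: "k < M" "digit M (2 * u) = real k"
      "real M * (2 * u) = real k + frac (real M * (2 * u))" .
    then have "digit (2 * M) u = real k" "2 * real M * u = real k + frac (2 * real M * u)"
      by (simp_all add: digit_def mult_ac)
    moreover from this have "(frac (2 * real M * u) + real k) / (2 * real M) = u"
      using assms(1) by (simp add: field_simps)
    ultimately show ?thesis using True p k digit_append[OF assms(1) p(3)] assms(1)
      by (simp add: fwd_def bwd_def)
  next
    case False
    from digit_range[OF assms(1) p(3)] obtain k where k: "k < M" "digit M c = real k"
      "real M * c = real k + frac (real M * c)" .
    define t where "t = 1/2 + (s + real k) / (2 * real M)"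
    have t: "t = (s + real (k + M)) / real (2 * M)" using assms(1) by (simp add: t_def field_simps)
    have "digit (2 * M) t = real (k + M)" "frac (real (2 * M) * t) = s"
      unfolding t using assms(1) p(4) by (intro digit_append; simp)+
    moreover have "t \<ge> 1/2" using p(4) by (simp add: t_def)
    moreover have "1 / 2 + (2 * u - 1) / 2 = u" by (simp add: field_simps)
    moreover have "(frac (real M * c) + real k) / real M = c"
      using k(3) assms(1) by (simp add: field_simps)
    ultimately show ?thesis using False p k assms(1)
      by (simp add: fwd_def bwd_def t_def[symmetric])
  qed
qed

lemma bwd_cube:
  assumes "M > 0" "p \<in> cube" shows "bwd M p \<in> cube"
proof -
  obtain u c s where p: "p = (u, c, s)" "u \<in> {0..<1}" "c \<in> {0..<1}" "s \<in> {0..<1}"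
    using assms(2) by (auto simp: cube_def)
  show ?thesis
  proof (cases "s < 1/2")
    case True
    from digit_range[OF assms(1) p(3)] obtain k where k: "k < M" "digit M c = real k" .
    have "(u + real k) / real (2*M) \<in> {0..<1}" using assms(1) p(2) k(1) by (intro append_cube) auto
    then show ?thesis using True p k by (auto simp: bwd_def cube_def frac_lt_1)
  next
    case False
    then have "2 * s - 1 \<in> {0..<1}" using p by auto
    from digit_range[OF assms(1) this] obtain k where k: "k < M" "digit M (2 * s - 1) = real k" .
    have "2 * real M * s = real M * (2 * s - 1) + of_int (int M)" by (simp add: algebra_simps)
    then have "\<lfloor>2 * real M * s\<rfloor> = \<lfloor>real M * (2 * s - 1)\<rfloor> + int M"
      by (simp only: floor_add_int)
    then have "digit (2 * M) s = digit M (2 * s - 1) + real M"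
      by (simp add: digit_def)
    then show ?thesis using False p k append_cube[OF assms(1) p(3) k(1)]
      by (auto simp: bwd_def cube_def frac_lt_1)
  qed
qed

lemma fwd_iter_cube: "M > 0 \<Longrightarrow> p \<in> cube \<Longrightarrow> (fwd M ^^ n) p \<in> cube"
  by (induction n) (auto simp: fwd_cube)

lemma bwd_iter_cube: "M > 0 \<Longrightarrow> p \<in> cube \<Longrightarrow> (bwd M ^^ n) p \<in> cube"
  by (induction n) (auto simp: bwd_cube)

lemma bwd_fwd_iter:
  assumes "M > 0" "p \<in> cube" shows "(bwd M ^^ n) ((fwd M ^^ n) p) = p"
proof (induction n)
  case (Suc n)
  have "(bwd M ^^ Suc n) ((fwd M ^^ Suc n) p) = (bwd M ^^ n) (bwd M (fwd M ((fwd M ^^ n) p)))"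
    by (simp add: funpow_swap1)
  then show ?case using Suc bwd_fwd[OF assms(1) fwd_iter_cube[OF assms]] by simp
qed simp

lemma baker3_eq_fwd:
  assumes "M > 0" "p \<in> cube"
  shows "baker3 M (1 / (2 * real M)) (1 / (2 * real M)) p = fwd M p"
proof -
  obtain u c s where p: "p = (u, c, s)" "u \<in> {0..<1}" "c \<in> {0..<1}" "s \<in> {0..<1}"
    using assms(2) by (auto simp: cube_def)
  have a: "1 / (2 * real M) > 0" using assms by simp
  show ?thesis
  proof (cases "u < 1/2")
    case True
    then have "2 * u \<in> {0..<1}" using p by auto
    from digit_range[OF assms(1) this] obtain k where k: "k < M" "digit M (2 * u) = real k"
      "real M * (2 * u) = real k + frac (real M * (2 * u))" .
    then have k': "digit (2 * M) u = real k" "2 * real M * u = real k + frac (2 * real M * u)"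
      by (simp_all add: digit_def mult_ac)
    moreover have "frac (2 * real M * u) < 1" "frac (2 * real M * u) \<ge> 0" by (simp_all add: frac_lt_1)
    ultimately have "real k \<le> 2 * real M * u" "2 * real M * u < real k + 1" by linarith+
    then have "(u, c) \<in> Omega_plus M (1 / (2 * real M)) (Symb_alpha (Suc k))"
      using p assms(1) by (auto simp: field_simps)
    from baker3_alpha[OF assms(1) a _ this] k(1)
    have "baker3 M (1 / (2 * real M)) (1 / (2 * real M)) p =
      (2 * real M * u - real k, (c + real k) / real M, s / 2)"
      using p(1) assms(1) by (simp add: field_simps)
    then show ?thesis
      using True p(1) k' by (simp add: fwd_def)
  next
    case False
    from digit_range[OF assms(1) p(3)] obtain k where k: "k < M" "digit M c = real k"
      "real M * c = real k + frac (real M * c)" .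
    moreover have "frac (real M * c) < 1" "frac (real M * c) \<ge> 0" by (simp_all add: frac_lt_1)
    ultimately have "real k \<le> real M * c" "real M * c < real k + 1" by linarith+
    then have "(u, c) \<in> Omega_plus M (1 / (2 * real M)) (Symb_beta (Suc k))"
      using p assms(1) False by (auto simp: field_simps)
    from baker3_beta[OF assms(1) a _ this] k(1)
    have "baker3 M (1 / (2 * real M)) (1 / (2 * real M)) p =
      (2 * u - 1, real M * c - real k, 1 / 2 + (s + real k) / (2 * real M))"
      using p(1) assms(1) by (simp add: field_simps)
    then show ?thesis
      using False p(1) k(2) k(3) by (simp add: fwd_def)
  qed
qed

lemma baker3_iter_eq_fwd:
  assumes "M > 0" "p \<in> cube"
  shows "(baker3 M (1 / (2 * real M)) (1 / (2 * real M)) ^^ n) p = (fwd M ^^ n) p"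
  by (induction n) (auto simp: baker3_eq_fwd fwd_iter_cube assms)


section \<open>Averaging over the expanding and contracting coordinates\<close>

lemma bounded_borel_compose:
  assumes "bounded_borel F" and [measurable]: "g \<in> borel_measurable borel"
  shows "bounded_borel (\<lambda>x. F (g x))"
proof -
  have [measurable]: "F \<in> borel_measurable borel" using assms by (simp add: bounded_borel_def)
  have "(\<lambda>x. F (g x)) \<in> borel_measurable borel" by measurable
  then show ?thesis using assms by (auto simp: bounded_borel_def)
qed

lemma bounded_borel_const [simp]: "bounded_borel (\<lambda>x. c)"
  by (auto simp: bounded_borel_def)

lemma bounded_borel_add: assumes "bounded_borel F" "bounded_borel G" shows "bounded_borel (\<lambda>x. F x + G x)"
proof -
  obtain A B where "\<forall>x. \<bar>F x\<bar> \<le> A" "\<forall>x. \<bar>G x\<bar> \<le> B" using assms by (auto simp: bounded_borel_def)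
  then have "\<forall>x. \<bar>F x + G x\<bar> \<le> A + B" by (meson abs_triangle_ineq add_mono order_trans)
  then show ?thesis using assms by (auto simp: bounded_borel_def)
qed

lemma bounded_borel_mult: assumes "bounded_borel F" "bounded_borel G" shows "bounded_borel (\<lambda>x. F x * G x)"
proof -
  obtain A B where AB: "\<And>x. \<bar>F x\<bar> \<le> A" "\<And>x. \<bar>G x\<bar> \<le> B" using assms by (auto simp: bounded_borel_def)
  have "\<bar>F x * G x\<bar> \<le> A * B" for x
    unfolding abs_mult using AB(1)[of x] AB(2)[of x] by (intro mult_mono) auto
  then show ?thesis using assms by (auto simp: bounded_borel_def)
qed

lemma bounded_borel_sum: "(\<And>i. i \<in> I \<Longrightarrow> bounded_borel (F i)) \<Longrightarrow> bounded_borel (\<lambda>x. \<Sum>i\<in>I. F i x)"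
  by (induction I rule: infinite_finite_induct) (auto intro: bounded_borel_add)

lemma bounded_borel_divide: "bounded_borel F \<Longrightarrow> bounded_borel (\<lambda>x. F x / c)"
  using bounded_borel_mult[OF _ bounded_borel_const, of F "1 / c"] by simp

lemma bounded_borel_diff: "bounded_borel F \<Longrightarrow> bounded_borel G \<Longrightarrow> bounded_borel (\<lambda>x. F x - G x)"
  using bounded_borel_add[of F "\<lambda>x. (-1) * G x"] bounded_borel_mult[OF bounded_borel_const, of G "-1"] by simp

lemma abs_integral_unif_le:
  assumes F: "bounded_borel F" and B: "\<And>x. x \<in> {0..<1} \<Longrightarrow> \<bar>F x\<bar> \<le> B"
  shows "\<bar>\<integral>x. F x \<partial>unif\<bar> \<le> B"
proof -
  have "norm (\<integral>x. F x \<partial>unif) \<le> (\<integral>x. norm (F x) \<partial>unif)"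
    by (rule integral_norm_bound)
  also have "\<dots> \<le> (\<integral>x. B \<partial>unif)"
    using AE_unif integrable_unif[OF F] B
    by (intro integral_mono_AE integrable_norm) (auto elim: AE_mp)
  finally show ?thesis by simp
qed

lemma bounded_borel_integral:
  assumes "bounded_borel (\<lambda>p. f (fst p) (snd p))"
  shows "bounded_borel (\<lambda>y::'a::second_countable_topology. \<integral>x. f x y \<partial>unif)"
proof -
  obtain B where B: "\<And>x y. \<bar>f x y\<bar> \<le> B" using assms by (auto simp: bounded_borel_def)
  have "(\<lambda>p. f (fst p) (snd p)) \<in> borel_measurable (borel \<Otimes>\<^sub>M borel)"
    using assms by (simp add: bounded_borel_def borel_prod)
  from measurable_compose[OF measurable_pair_swap' this]
  have "(\<lambda>(y, x). f x y) \<in> borel_measurable (borel \<Otimes>\<^sub>M borel)"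
    by (simp add: split_beta)
  then have "(\<lambda>(y, x). f x y) \<in> borel_measurable (borel \<Otimes>\<^sub>M unif)"
    by (subst measurable_cong_sets[OF sets_pair_measure_cong[OF refl sets_unif] refl])
  then have "(\<lambda>y. \<integral>x. f x y \<partial>unif) \<in> borel_measurable borel"
    by (rule unif.borel_measurable_lebesgue_integral)
  moreover have "\<bar>\<integral>x. f x y \<partial>unif\<bar> \<le> B" for y
  proof (rule abs_integral_unif_le)
    show "bounded_borel (\<lambda>x. f x y)"
      using bounded_borel_compose[OF assms, of "\<lambda>x. (x, y)"] by simp
  qed (rule B)
  ultimately show ?thesis by (auto simp: bounded_borel_def)
qed

lemma integral_unif_cong:
  assumes "bounded_borel F" "bounded_borel G" and "\<And>x. x \<in> {0..<1} \<Longrightarrow> F x = G x"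
  shows "(\<integral>x. F x \<partial>unif) = (\<integral>x. G x \<partial>unif)"
  using AE_unif assms by (intro integral_cong_AE) (auto simp: bounded_borel_def elim: AE_mp)

lemma integral_unif_halves:
  assumes "bounded_borel F"
  shows "(\<integral>x. F x \<partial>unif) = (\<integral>x. F (x / 2) \<partial>unif) / 2 + (\<integral>x. F (1/2 + x / 2) \<partial>unif) / 2"
proof -
  have "{..<2::nat} = {0, 1}" by auto
  then show ?thesis
    using integral_unif_split[OF assms, of 2] by (simp add: add_divide_distrib add.commute)
qed

text \<open>The operator induced on functions of the centre coordinate \<open>x\<close> and one further coordinate \<open>y\<close>: with
probability one half the top digit of the stack \<open>x\<close> moves into \<open>y\<close>, and with probability one half a
uniform digit is pushed. Backward in time \<open>y\<close> is the expanding coordinate and \<open>(p, q) = (0, 1/2)\<close>;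
forward in time \<open>y\<close> is the contracting coordinate and \<open>(p, q) = (1/2, 0)\<close>. Keeping the offsets as
parameters treats both directions of time at once.\<close>

definition averaged_step :: "nat \<Rightarrow> real \<Rightarrow> real \<Rightarrow> (real \<Rightarrow> real \<Rightarrow> real) \<Rightarrow> real \<Rightarrow> real \<Rightarrow> real" where
  "averaged_step M p q g y x = g (p + (y + digit M x) / (2 * real M)) (frac (real M * x)) / 2
     + (\<Sum>k<M. g (q + y / 2) ((x + real k) / real M)) / (2 * real M)"

lemma integral_fwd:
  assumes F: "bounded_borel F" and M: "M > 0"
  shows "(\<integral>u. F (fwd M (u, c, s)) \<partial>unif) = averaged_step M (1/2) 0 (\<lambda>s c. \<integral>u. F (u, c, s) \<partial>unif) s c"
proof -
  have m: "(\<lambda>u. fwd M (u, c, s)) \<in> borel_measurable borel"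
    by measurable
  have 1: "bounded_borel (\<lambda>u. F (fwd M (u, c, s)))"
    by (rule bounded_borel_compose[OF F m])
  have 2: "bounded_borel (\<lambda>u. F (fwd M (u / 2, c, s)))"
    using bounded_borel_compose[OF 1, of "\<lambda>u. u / 2"] by simp
  have 3: "bounded_borel (\<lambda>u. F (fwd M ((u + real k) / real M / 2, c, s)))" for k
    using bounded_borel_compose[OF 2, of "\<lambda>u. (u + real k) / real M"] by simp
  have 4: "bounded_borel (\<lambda>u. F (fwd M (1/2 + u / 2, c, s)))"
    using bounded_borel_compose[OF 1, of "\<lambda>u. 1/2 + u / 2"] by simp
  have 5: "bounded_borel (\<lambda>u. F (u, c, s))" for c s
    by (rule bounded_borel_compose[OF F]) measurable
  have p: "fwd M ((u + real k) / real M / 2, c, s) = (u, (c + real k) / real M, s / 2)"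
    if u: "u \<in> {0..<1}" and k: "k < M" for u k
  proof -
    have e: "(u + real k) / real M / 2 = (u + real k) / real (2 * M)" by simp
    have "(u + real k) / real M < 1" using append_cube[OF M u k] by simp
    then have "(u + real k) / real (2 * M) < 1/2" unfolding e[symmetric]
      by (rule divide_strict_right_mono) simp
    then show ?thesis unfolding e using digit_append[of "2 * M" u k] M u
      by (simp add: fwd_def)
  qed
  have "(\<integral>u. F (fwd M (u / 2, c, s)) \<partial>unif) =
      (\<Sum>k<M. \<integral>u. F (fwd M ((u + real k) / real M / 2, c, s)) \<partial>unif) / real M"
    by (rule integral_unif_split[OF 2 M])
  also have "\<dots> = (\<Sum>k<M. \<integral>u. F (u, (c + real k) / real M, s / 2) \<partial>unif) / real M"
    by (intro arg_cong2[where f="(/)"] sum.cong refl integral_unif_cong 3 5)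
       (simp only: p lessThan_iff)
  finally have A: "(\<integral>u. F (fwd M (u / 2, c, s)) \<partial>unif) / 2 =
      (\<Sum>k<M. \<integral>u. F (u, (c + real k) / real M, s / 2) \<partial>unif) / (2 * real M)" by simp
  have B: "(\<integral>u. F (fwd M (1/2 + u / 2, c, s)) \<partial>unif) =
     (\<integral>u. F (u, frac (real M * c), 1/2 + (s + digit M c) / (2 * real M)) \<partial>unif)"
    by (intro integral_unif_cong 4 5) (simp add: fwd_def)
  show ?thesis
    using integral_unif_halves[OF 1] A B by (simp add: averaged_step_def)
qed

lemma integral_bwd:
  assumes F: "bounded_borel F" and M: "M > 0"
  shows "(\<integral>s. F (bwd M (u, c, s)) \<partial>unif) = averaged_step M 0 (1/2) (\<lambda>u c. \<integral>s. F (u, c, s) \<partial>unif) u c"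
proof -
  have m: "(\<lambda>s. bwd M (u, c, s)) \<in> borel_measurable borel"
    by measurable
  have 1: "bounded_borel (\<lambda>s. F (bwd M (u, c, s)))"
    by (rule bounded_borel_compose[OF F m])
  have 2: "bounded_borel (\<lambda>s. F (bwd M (u, c, 1/2 + s / 2)))"
    using bounded_borel_compose[OF 1, of "\<lambda>u. 1/2 + u / 2"] by simp
  have 3: "bounded_borel (\<lambda>s. F (bwd M (u, c, 1/2 + (s + real k) / real M / 2)))" for k
    using bounded_borel_compose[OF 2, of "\<lambda>u. (u + real k) / real M"] by simp
  have 4: "bounded_borel (\<lambda>s. F (bwd M (u, c, s / 2)))"
    using bounded_borel_compose[OF 1, of "\<lambda>u. u / 2"] by simp
  have 5: "bounded_borel (\<lambda>s. F (u, c, s))" for u c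
    by (rule bounded_borel_compose[OF F]) measurable
  have p: "bwd M (u, c, 1/2 + (s + real k) / real M / 2) = (1/2 + u / 2, (c + real k) / real M, s)"
    if s: "s \<in> {0..<1}" for s k
  proof -
    have e: "1/2 + (s + real k) / real M / 2 = (s + real (k + M)) / real (2 * M)"
      using M by (simp add: field_simps)
    have "(s + real k) / real M \<ge> 0" using s by simp
    then have "\<not> (s + real (k + M)) / real (2 * M) < 1/2" unfolding e[symmetric] not_less le_add_same_cancel1
      by (rule divide_nonneg_nonneg) simp
    then show ?thesis unfolding e using digit_append[of "2 * M" s "k + M"] M s
      by (simp add: bwd_def)
  qed
  have "(\<integral>s. F (bwd M (u, c, 1/2 + s / 2)) \<partial>unif) =
      (\<Sum>k<M. \<integral>s. F (bwd M (u, c, 1/2 + (s + real k) / real M / 2)) \<partial>unif) / real M"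
    by (rule integral_unif_split[OF 2 M])
  also have "\<dots> = (\<Sum>k<M. \<integral>s. F (1/2 + u / 2, (c + real k) / real M, s) \<partial>unif) / real M"
    by (intro arg_cong2[where f="(/)"] sum.cong refl integral_unif_cong 3 5)
       (simp only: p lessThan_iff)
  finally have A: "(\<integral>s. F (bwd M (u, c, 1/2 + s / 2)) \<partial>unif) / 2 =
      (\<Sum>k<M. \<integral>s. F (1/2 + u / 2, (c + real k) / real M, s) \<partial>unif) / (2 * real M)" by simp
  have B: "(\<integral>s. F (bwd M (u, c, s / 2)) \<partial>unif) =
     (\<integral>s. F ((u + digit M c) / (2 * real M), frac (real M * c), s) \<partial>unif)"
    by (intro integral_unif_cong 4 5) (simp add: bwd_def)
  show ?thesis
    using integral_unif_halves[OF 1] A B by (simp add: averaged_step_def)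
qed

text \<open>Substituting a prefixed digit for \<open>c\<close> undoes the pop, and summing over the pushed digits undoes the push;
what remains are the two halves of the \<open>s\<close>-interval.\<close>

lemma integral_step:
  assumes R: "bounded_borel (\<lambda>p. R (fst p) (snd p))" and M: "M > 0"
  shows "(\<integral>c. \<integral>s. averaged_step M (1/2) 0 R s c \<partial>unif \<partial>unif) = (\<integral>c. \<integral>s. R s c \<partial>unif \<partial>unif)"
proof -
  define Q where "Q c = (\<integral>s. R (s / 2) c \<partial>unif)" for c
  define T where "T c = (\<integral>s. R (1/2 + (s + digit M c) / (2 * real M)) (frac (real M * c)) \<partial>unif)" for c
  have "(\<lambda>p::real \<times> real. (fst p / 2, snd p)) \<in> borel_measurable borel"
    unfolding borel_prod[symmetric] by measurable
  then have Q: "bounded_borel Q" unfolding Q_def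
    by (intro bounded_borel_integral) (use bounded_borel_compose[OF R, of "\<lambda>p. (fst p / 2, snd p)"] in simp)
  have m: "(\<lambda>p. (1/2 + (fst p + digit M (snd p)) / (2 * real M), frac (real M * snd p)))
      \<in> borel_measurable borel"
    unfolding borel_prod[symmetric] by measurable
  have T: "bounded_borel T" unfolding T_def
    by (intro bounded_borel_integral) (use bounded_borel_compose[OF R m] in simp)
  have R1: "bounded_borel (\<lambda>s. R (g s) c)" if "g \<in> borel_measurable borel" for g c
    using bounded_borel_compose[OF R, of "\<lambda>s. (g s, c)"] that by simp
  have R2: "bounded_borel (\<lambda>c. \<integral>s. R (g s) c \<partial>unif)" if [measurable]: "g \<in> borel_measurable borel" for g
  proof -
    have "(\<lambda>p::real \<times> real. (g (fst p), snd p)) \<in> borel_measurable borel"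
      unfolding borel_prod[symmetric] by measurable
    then show ?thesis
    by (intro bounded_borel_integral) (use bounded_borel_compose[OF R, of "\<lambda>p. (g (fst p), snd p)"] in simp)
  qed
  have Qk: "bounded_borel (\<lambda>c. Q ((c + real k) / real M))" for k
    by (rule bounded_borel_compose[OF Q]) measurable
  have "(\<integral>s. averaged_step M (1/2) 0 R s c \<partial>unif) = T c / 2 + (\<Sum>k<M. Q ((c + real k) / real M)) / (2 * real M)" for c
  proof -
    have "integrable unif (\<lambda>s. R (1/2 + (s + digit M c) / (2 * real M)) (frac (real M * c)))"
      by (intro integrable_unif R1) measurable
    moreover have "integrable unif (\<lambda>s. R (s / 2) ((c + real k) / real M))" for k
      by (intro integrable_unif R1) measurable
    ultimately show ?thesis
      unfolding averaged_step_def T_def Q_def by simp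
  qed
  then have "(\<integral>c. \<integral>s. averaged_step M (1/2) 0 R s c \<partial>unif \<partial>unif) =
    (\<integral>c. T c / 2 + (\<Sum>k<M. Q ((c + real k) / real M)) / (2 * real M) \<partial>unif)" by simp
  also have "\<dots> = (\<integral>c. T c \<partial>unif) / 2 + (\<Sum>k<M. \<integral>c. Q ((c + real k) / real M) \<partial>unif) / (2 * real M)"
    using integrable_unif[OF T] integrable_unif[OF Qk] by simp
  also have "(\<Sum>k<M. \<integral>c. Q ((c + real k) / real M) \<partial>unif) / (2 * real M) = (\<integral>c. Q c \<partial>unif) / 2"
    using integral_unif_split[OF Q M] by simp
  also have "(\<integral>c. T c \<partial>unif) = (\<Sum>k<M. \<integral>c. T ((c + real k) / real M) \<partial>unif) / real M"
    by (rule integral_unif_split[OF T M])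
  also have "\<dots> = (\<Sum>k<M. \<integral>c. (\<integral>s. R (1/2 + (s + real k) / real M / 2) c \<partial>unif) \<partial>unif) / real M"
  proof (intro arg_cong2[where f="(/)"] sum.cong refl integral_unif_cong)
    fix k c assume "c \<in> {0..<1::real}"
    then show "T ((c + real k) / real M) = (\<integral>s. R (1/2 + (s + real k) / real M / 2) c \<partial>unif)"
      unfolding T_def using M by (simp only: digit_append) (simp add: mult.commute)
  next
    show "bounded_borel (\<lambda>c. T ((c + real k) / real M))" for k by (rule bounded_borel_compose[OF T]) measurable
    show "bounded_borel (\<lambda>c. \<integral>s. R (1/2 + (s + real k) / real M / 2) c \<partial>unif)" for k
      by (rule R2) measurable
  qed
  also have "\<dots> = (\<integral>c. (\<Sum>k<M. \<integral>s. R (1/2 + (s + real k) / real M / 2) c \<partial>unif) / real M \<partial>unif)"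
    using integrable_unif[OF R2, of "\<lambda>s. 1/2 + (s + real k) / real M / 2" for k] by simp
  also have "\<dots> = (\<integral>c. \<integral>s. R (1/2 + s / 2) c \<partial>unif \<partial>unif)"
    using integral_unif_split[OF R1 M, of "\<lambda>s. 1/2 + s / 2"] by simp
  also have "\<dots> / 2 + (\<integral>c. Q c \<partial>unif) / 2 =
     (\<integral>c. (\<integral>s. R (1/2 + s / 2) c \<partial>unif) / 2 + (\<integral>s. R (s / 2) c \<partial>unif) / 2 \<partial>unif)"
    using integrable_unif[OF R2, of "\<lambda>s. 1/2 + s / 2"] integrable_unif[OF R2, of "\<lambda>s. s / 2"]
    by (simp add: Q_def)
  also have "\<dots> = (\<integral>c. \<integral>s. R s c \<partial>unif \<partial>unif)"
    using integral_unif_halves[OF R1, of "\<lambda>s. s"] by (simp add: add.commute)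
  finally show ?thesis .
qed

lemma integral_fwd_invariant:
  assumes F: "bounded_borel F" and M: "M > 0"
  shows "(\<integral>p. F (fwd M p) \<partial>unif3) = (\<integral>p. F p \<partial>unif3)"
proof -
  have "(\<lambda>p::real \<times> real \<times> real. (fst p, snd (snd p), fst (snd p))) \<in> borel_measurable borel"
    unfolding borel_prod[symmetric] by measurable
  from bounded_borel_compose[OF F this]
  have "bounded_borel (\<lambda>y. \<integral>u. F (u, snd y, fst y) \<partial>unif)"
    by (intro bounded_borel_integral) simp
  then have "(\<integral>c. \<integral>s. averaged_step M (1/2) 0 (\<lambda>s c. \<integral>u. F (u, c, s) \<partial>unif) s c \<partial>unif \<partial>unif) =
      (\<integral>c. \<integral>s. \<integral>u. F (u, c, s) \<partial>unif \<partial>unif \<partial>unif)"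
    by (intro integral_step M) simp
  then show ?thesis
    using F bounded_borel_compose[OF F fwd_measurable]
    by (simp add: integral_unif3_iterated integral_fwd[OF F M])
qed

lemma integral_fwd_iter_invariant:
  assumes F: "bounded_borel F" and M: "M > 0"
  shows "(\<integral>p. F ((fwd M ^^ n) p) \<partial>unif3) = (\<integral>p. F p \<partial>unif3)"
proof (induction n)
  case (Suc n)
  have "(\<integral>p. F ((fwd M ^^ Suc n) p) \<partial>unif3) = (\<integral>p. F ((fwd M ^^ n) (fwd M p)) \<partial>unif3)"
    by (simp add: funpow_swap1)
  also have "\<dots> = (\<integral>p. F ((fwd M ^^ n) p) \<partial>unif3)"
    by (rule integral_fwd_invariant[OF bounded_borel_compose[OF F fwd_iter_measurable] M])
  finally show ?case using Suc by simp
qed simp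


section \<open>Influence of single digits and covariance\<close>

text \<open>The relation on stacks that have the same top digit and whose remainders are related. Iterating it
describes stacks that agree down to a given depth: \<open>same_cell\<close> allows arbitrary remainders, whereas
in \<open>differ\<close> exactly one digit, at depth \<open>j + 1\<close>, may differ.\<close>

definition prepend :: "nat \<Rightarrow> (real \<Rightarrow> real \<Rightarrow> bool) \<Rightarrow> real \<Rightarrow> real \<Rightarrow> bool" where
  "prepend M R x y \<longleftrightarrow>
     (\<exists>k<M. \<exists>x' y'. R x' y' \<and> x = (x' + real k) / real M \<and> y = (y' + real k) / real M)"

definition same_cell :: "nat \<Rightarrow> nat \<Rightarrow> real \<Rightarrow> real \<Rightarrow> bool" where
  "same_cell M N = (prepend M ^^ N) (\<lambda>x y. x \<in> {0..<1} \<and> y \<in> {0..<1})"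

definition differ :: "nat \<Rightarrow> nat \<Rightarrow> real \<Rightarrow> real \<Rightarrow> bool" where
  "differ M j = (prepend M ^^ j)
     (\<lambda>x y. \<exists>z\<in>{0..<1}. \<exists>k<M. \<exists>k'<M. x = (z + real k) / real M \<and> y = (z + real k') / real M)"

lemma same_cell_Suc: "same_cell M (Suc N) = prepend M (same_cell M N)"
  and differ_Suc: "differ M (Suc N) = prepend M (differ M N)"
  by (simp_all add: same_cell_def differ_def)

lemma prepend_mono: "R \<le> S \<Longrightarrow> prepend M R \<le> prepend M S"
  unfolding prepend_def le_fun_def le_bool_def by blast

lemma same_cell_unit: "M > 0 \<Longrightarrow> same_cell M N x y \<Longrightarrow> x \<in> {0..<1} \<and> y \<in> {0..<1}"
proof (induction N arbitrary: x y)
  case 0 then show ?case by (simp add: same_cell_def)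
next
  case (Suc N)
  then obtain k x' y' where "k < M" "same_cell M N x' y'" "x = (x' + real k) / real M" "y = (y' + real k) / real M"
    by (auto simp: same_cell_Suc prepend_def)
  then show ?case using Suc append_cube by blast
qed

lemma differ_same_cell: "M > 0 \<Longrightarrow> differ M j \<le> same_cell M j"
proof (induction j)
  case 0
  then show ?case using append_cube[OF 0] by (auto simp: differ_def same_cell_def le_fun_def)
next
  case (Suc j)
  then show ?case by (simp add: differ_Suc same_cell_Suc prepend_mono)
qed

lemma same_cell_dist: "M > 0 \<Longrightarrow> same_cell M N x y \<Longrightarrow> \<bar>x - y\<bar> \<le> (1 / real M) ^ N"
proof (induction N arbitrary: x y)
  case 0 then show ?case by (auto simp: same_cell_def)
next
  case (Suc N)
  then obtain k x' y' where k: "k < M" "same_cell M N x' y'" "x = (x' + real k) / real M" "y = (y' + real k) / real M"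
    by (auto simp: same_cell_Suc prepend_def)
  have "x - y = (x' - y') / real M" using k by (simp add: diff_divide_distrib[symmetric])
  then have "\<bar>x - y\<bar> = \<bar>x' - y'\<bar> / real M" by simp
  also have "\<dots> \<le> (1 / real M) ^ N / real M" using Suc k by (intro divide_right_mono) auto
  finally show ?case by simp
qed

definition osc_le :: "(real \<Rightarrow> real \<Rightarrow> real) \<Rightarrow> (real \<Rightarrow> real \<Rightarrow> bool) \<Rightarrow> real \<Rightarrow> bool" where
  "osc_le g R a \<longleftrightarrow> (\<forall>y\<in>{0..<1}. \<forall>x x'. R x x' \<longrightarrow> \<bar>g y x - g y x'\<bar> \<le> a)"

definition hoelder_le :: "real \<Rightarrow> (real \<Rightarrow> real \<Rightarrow> real) \<Rightarrow> real \<Rightarrow> bool" where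
  "hoelder_le \<theta> g W \<longleftrightarrow>
     (\<forall>x\<in>{0..<1}. \<forall>y\<in>{0..<1}. \<forall>y'\<in>{0..<1}. \<bar>g y x - g y' x\<bar> \<le> W * \<bar>y - y'\<bar> powr \<theta>)"

lemma push_coord:
  assumes "M > 0" "k < M" "y \<in> {0..<1}" "p \<in> {0, 1/2}"
  shows "p + (y + real k) / (2 * real M) \<in> {0..<1}"
proof -
  define t where "t = (y + real k) / real M"
  have t: "(y + real k) / (2 * real M) = t / 2" by (simp add: t_def)
  have "t \<in> {0..<1}" using append_cube[OF assms(1,3,2)] by (simp only: t_def)
  then show ?thesis unfolding t using assms(4) by auto
qed

lemma half_sum_diff:
  fixes A :: real
  shows "\<bar>A - A'\<bar> \<le> a \<Longrightarrow> \<bar>B - B'\<bar> \<le> b / 2 \<Longrightarrow> \<bar>A / 2 + B - (A' / 2 + B')\<bar> \<le> (a + b) / 2"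
  unfolding abs_le_iff by (simp add: field_simps)

lemma step_diff:
  assumes M: "M > 0"
    and a: "\<bar>g (p + (y + digit M x) / (2 * real M)) (frac (real M * x))
             - g (p + (y' + digit M x') / (2 * real M)) (frac (real M * x'))\<bar> \<le> a"
    and b: "\<And>k. k < M \<Longrightarrow> \<bar>g (q + y / 2) ((x + real k) / real M) - g (q + y' / 2) ((x' + real k) / real M)\<bar> \<le> b"
  shows "\<bar>averaged_step M p q g y x - averaged_step M p q g y' x'\<bar> \<le> (a + b) / 2"
proof -
  have "\<bar>(\<Sum>k<M. g (q + y / 2) ((x + real k) / real M)) - (\<Sum>k<M. g (q + y' / 2) ((x' + real k) / real M))\<bar>
     \<le> (\<Sum>k<M. \<bar>g (q + y / 2) ((x + real k) / real M) - g (q + y' / 2) ((x' + real k) / real M)\<bar>)"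
    unfolding sum_subtractf[symmetric] by (rule sum_abs)
  also have "\<dots> \<le> (\<Sum>k<M. b)" using b by (intro sum_mono) auto
  finally have "\<bar>(\<Sum>k<M. g (q + y / 2) ((x + real k) / real M)) - (\<Sum>k<M. g (q + y' / 2) ((x' + real k) / real M))\<bar> / (2 * real M)
     \<le> (real M * b) / (2 * real M)" by (intro divide_right_mono) auto
  then have "\<bar>(\<Sum>k<M. g (q + y / 2) ((x + real k) / real M)) / (2 * real M)
     - (\<Sum>k<M. g (q + y' / 2) ((x' + real k) / real M)) / (2 * real M)\<bar> \<le> b / 2"
    using M by (simp add: diff_divide_distrib[symmetric] abs_divide)
  then show ?thesis unfolding averaged_step_def by (rule half_sum_diff[OF a])
qed

text \<open>A pop raises a digit by one place and a push lowers it by one place.\<close>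

lemma osc_le_step_prepend:
  assumes M: "M > 0" and p: "p \<in> {0, 1/2}" "q \<in> {0, 1/2}"
    and R: "\<And>x y. R x y \<Longrightarrow> x \<in> {0..<1} \<and> y \<in> {0..<1}"
    and a: "osc_le g R a" and b: "osc_le g (prepend M (prepend M R)) b"
  shows "osc_le (averaged_step M p q g) (prepend M R) ((a + b) / 2)"
  unfolding osc_le_def
proof safe
  fix y x x' :: real assume y: "y \<in> {0..<1}" and xx: "prepend M R x x'"
  obtain k z z' where k: "k < M" "R z z'" "x = (z + real k) / real M" "x' = (z' + real k) / real M"
    using xx by (auto simp: prepend_def)
  have z: "z \<in> {0..<1}" "z' \<in> {0..<1}" using R k by auto
  show "\<bar>averaged_step M p q g y x - averaged_step M p q g y x'\<bar> \<le> (a + b) / 2"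
  proof (rule step_diff[OF M])
    show "\<bar>g (p + (y + digit M x) / (2 * real M)) (frac (real M * x))
             - g (p + (y + digit M x') / (2 * real M)) (frac (real M * x'))\<bar> \<le> a"
      unfolding k(3,4) digit_append[OF M z(1)] digit_append[OF M z(2)]
      using a k(2) push_coord[OF M k(1) y p(1)] unfolding osc_le_def by blast
    fix i assume "i < M"
    then have "prepend M (prepend M R) ((x + real i) / real M) ((x' + real i) / real M)"
      using xx unfolding prepend_def[of M "prepend M R"] by blast
    moreover have "q + y / 2 \<in> {0..<1}" using y p(2) by auto
    ultimately show "\<bar>g (q + y / 2) ((x + real i) / real M) - g (q + y / 2) ((x' + real i) / real M)\<bar> \<le> b"
      using b unfolding osc_le_def by blast
  qed
qed

text \<open>The top digit is the boundary case: when it is popped it becomes visible in \<open>y\<close>, where its influence is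
controlled by the Hoelder constant.\<close>

lemma osc_le_step_differ_0:
  assumes M: "M > 0" and p: "p \<in> {0, 1/2}" "q \<in> {0, 1/2}" and "\<theta> > 0" and "W \<ge> 0"
    and a: "hoelder_le \<theta> g W" and b: "osc_le g (differ M 1) b"
  shows "osc_le (averaged_step M p q g) (differ M 0) ((W + b) / 2)"
  unfolding osc_le_def
proof safe
  fix y x x' :: real assume y: "y \<in> {0..<1}" and xx: "differ M 0 x x'"
  obtain z k k' where k: "k < M" "k' < M" "z \<in> {0..<1}" "x = (z + real k) / real M" "x' = (z + real k') / real M"
    using xx by (auto simp: differ_def)
  show "\<bar>averaged_step M p q g y x - averaged_step M p q g y x'\<bar> \<le> (W + b) / 2"
  proof (rule step_diff[OF M])
    define v where "v = p + (y + real k) / (2 * real M)"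
    define v' where "v' = p + (y + real k') / (2 * real M)"
    have v: "v \<in> {0..<1}" "v' \<in> {0..<1}" unfolding v_def v'_def using push_coord[OF M _ y p(1)] k by auto
    then have "\<bar>g v z - g v' z\<bar> \<le> W * \<bar>v - v'\<bar> powr \<theta>" using a k(3) unfolding hoelder_le_def by blast
    also have "\<dots> \<le> W * 1" using v assms by (intro mult_left_mono powr_le1) auto
    finally show "\<bar>g (p + (y + digit M x) / (2 * real M)) (frac (real M * x))
             - g (p + (y + digit M x') / (2 * real M)) (frac (real M * x'))\<bar> \<le> W"
      unfolding k(4,5) digit_append[OF M k(3)] v_def v'_def by simp
    fix i assume "i < M"
    then have "differ M 1 ((x + real i) / real M) ((x' + real i) / real M)"
      using xx unfolding One_nat_def differ_Suc prepend_def by blast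
    moreover have "q + y / 2 \<in> {0..<1}" using y p(2) by auto
    ultimately show "\<bar>g (q + y / 2) ((x + real i) / real M) - g (q + y / 2) ((x' + real i) / real M)\<bar> \<le> b"
      using b unfolding osc_le_def by blast
  qed
qed

lemma hoelder_le_step:
  assumes M: "M > 0" and p: "p \<in> {0, 1/2}" "q \<in> {0, 1/2}" and "\<theta> > 0" and "W \<ge> 0"
    and a: "hoelder_le \<theta> g W"
  shows "hoelder_le \<theta> (averaged_step M p q g) ((1/2) powr \<theta> * W)"
  unfolding hoelder_le_def
proof safe
  fix x y y' :: real assume y: "y \<in> {0..<1}" "y' \<in> {0..<1}" and x: "x \<in> {0..<1}"
  define B where "B = (1/2) powr \<theta> * W * \<bar>y - y'\<bar> powr \<theta>"
  have h: "\<bar>g v z - g v' z\<bar> \<le> B"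
    if "v \<in> {0..<1}" "v' \<in> {0..<1}" "z \<in> {0..<1}" "\<bar>v - v'\<bar> \<le> 1/2 * \<bar>y - y'\<bar>" for v v' z
  proof -
    have "\<bar>g v z - g v' z\<bar> \<le> W * \<bar>v - v'\<bar> powr \<theta>" using a that unfolding hoelder_le_def by blast
    also have "\<dots> \<le> W * (1/2 * \<bar>y - y'\<bar>) powr \<theta>"
      using that assms by (intro mult_left_mono powr_mono2) auto
    also have "\<dots> = B" by (subst powr_mult) (auto simp: B_def)
    finally show ?thesis .
  qed
  obtain k where k: "k < M" "digit M x = real k" using digit_range[OF M x] by metis
  have "\<bar>averaged_step M p q g y x - averaged_step M p q g y' x\<bar> \<le> (B + B) / 2"
  proof (rule step_diff[OF M])
    have "\<bar>y - y'\<bar> / (2 * real M) \<le> \<bar>y - y'\<bar> / (2 * 1)" using M by (intro divide_left_mono) auto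
    then have "\<bar>(p + (y + real k) / (2 * real M)) - (p + (y' + real k) / (2 * real M))\<bar> \<le> 1/2 * \<bar>y - y'\<bar>"
      by (simp add: diff_divide_distrib[symmetric] abs_divide)
    then show "\<bar>g (p + (y + digit M x) / (2 * real M)) (frac (real M * x))
             - g (p + (y' + digit M x) / (2 * real M)) (frac (real M * x))\<bar> \<le> B"
      unfolding k(2) using push_coord[OF M k(1) y(1) p(1)] push_coord[OF M k(1) y(2) p(1)]
      by (intro h) (auto simp: frac_lt_1)
  next
    fix i assume "i < M"
    then have "(x + real i) / real M \<in> {0..<1}" using append_cube[OF M x] by blast
    moreover have "q + y / 2 - (q + y' / 2) = 1/2 * (y - y')" by simp
    then have "\<bar>q + y / 2 - (q + y' / 2)\<bar> \<le> 1/2 * \<bar>y - y'\<bar>"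
      by (simp only: abs_mult)
    ultimately show "\<bar>g (q + y / 2) ((x + real i) / real M) - g (q + y' / 2) ((x + real i) / real M)\<bar> \<le> B"
      using y p(2) by (intro h) auto
  qed
  then show "\<bar>averaged_step M p q g y x - averaged_step M p q g y' x\<bar> \<le> (1/2) powr \<theta> * W * \<bar>y - y'\<bar> powr \<theta>"
    by (simp add: B_def mult_ac)
qed

text \<open>The solution of the discrete heat equation on the half line with initial values \<open>r\<^sup>j\<close> and boundary
values \<open>r\<^sup>m\<close>. Depth 0 stands for a digit that has left the stack; its influence decays because the
coordinate storing it is contracted at every later step.\<close>

fun influence :: "real \<Rightarrow> nat \<Rightarrow> nat \<Rightarrow> real" where
  "influence r 0 j = r ^ j"
| "influence r (Suc m) 0 = r ^ Suc m"
| "influence r (Suc m) (Suc j) = (influence r m j + influence r m (Suc (Suc j))) / 2"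

lemma influence_0 [simp]: "influence r m 0 = r ^ m"
  by (cases m) auto

lemma step_iter_influence:
  assumes M: "M > 0" and p: "p \<in> {0, 1/2}" "q \<in> {0, 1/2}" and "\<theta> > 0" and "W \<ge> 0"
    and r: "r = (1/2) powr \<theta>"
    and h: "hoelder_le \<theta> g W" and o: "\<And>j. osc_le g (differ M j) (W * r ^ Suc j)"
  shows "hoelder_le \<theta> ((averaged_step M p q ^^ m) g) (W * r ^ m)"
    and "osc_le ((averaged_step M p q ^^ m) g) (differ M j) (W * influence r m (Suc j))"
proof -
  show 1: "hoelder_le \<theta> ((averaged_step M p q ^^ m) g) (W * r ^ m)" for m
  proof (induction m)
    case (Suc m)
    have "W * r ^ m \<ge> 0" using assms by simp
    from hoelder_le_step[OF M p \<open>\<theta> > 0\<close> this Suc] show ?case by (simp add: r mult_ac)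
  qed (simp add: h)
  show "osc_le ((averaged_step M p q ^^ m) g) (differ M j) (W * influence r m (Suc j))"
  proof (induction m arbitrary: j)
    case 0 then show ?case using o by simp
  next
    case (Suc m)
    show ?case
    proof (cases j)
      case 0
      have "W * r ^ m \<ge> 0" using assms by simp
      from osc_le_step_differ_0[OF M p \<open>\<theta> > 0\<close> this 1 Suc] show ?thesis
        using 0 by (simp add: algebra_simps)
    next
      case (Suc i)
      have "differ M i x y \<Longrightarrow> x \<in> {0..<1} \<and> y \<in> {0..<1}" for x y
        using differ_same_cell[OF M, of i] same_cell_unit[OF M]
        unfolding le_fun_def le_bool_def by blast
      from osc_le_step_prepend[OF M p this Suc.IH[of i] Suc.IH[of "Suc (Suc i)", unfolded differ_Suc]]
      show ?thesis
        using Suc by (simp add: algebra_simps differ_Suc)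
    qed
  qed
qed

text \<open>Only qualitative use is made of this bound: for fixed \<open>m\<close> the oscillation on cells of level \<open>N\<close> tends
to zero as \<open>N\<close> grows. The factor \<open>(r + 1/r) / 2\<close> is the eigenvalue of the walk on \<open>N \<mapsto> r\<^sup>N\<close>, and
\<open>N \<ge> m\<close> keeps the boundary out of reach.\<close>

lemma step_iter_same_cell:
  assumes M: "M > 0" and p: "p \<in> {0, 1/2}" "q \<in> {0, 1/2}" and r: "r > 0"
    and o: "\<And>N. osc_le g (same_cell M N) (W * r ^ N)"
  shows "N \<ge> m \<Longrightarrow> osc_le ((averaged_step M p q ^^ m) g) (same_cell M N) (W * ((r + 1 / r) / 2) ^ m * r ^ N)"
proof (induction m arbitrary: N)
  case 0 then show ?case using o by simp
next
  case (Suc m)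
  then obtain n where n: "N = Suc n" "n \<ge> m" by (cases N) auto
  then have n2: "Suc (Suc n) \<ge> m" by simp
  have eq: "(W * ((r + 1 / r) / 2) ^ m * r ^ n + W * ((r + 1 / r) / 2) ^ m * r ^ Suc (Suc n)) / 2 =
    W * ((r + 1 / r) / 2) ^ Suc m * r ^ N"
    using r n by (simp add: field_simps)
  have unit: "same_cell M n x y \<Longrightarrow> x \<in> {0..<1} \<and> y \<in> {0..<1}" for x y
    using same_cell_unit[OF M] by blast
  show ?case
    using osc_le_step_prepend[OF M p unit Suc.IH[OF n(2)] Suc.IH[OF n2, unfolded same_cell_Suc]]
    unfolding eq by (simp add: n(1) same_cell_Suc)
qed

lemma discrete_covariance:
  fixes g h :: "nat \<Rightarrow> real"
  assumes M: "M > 0"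
    and g: "\<And>i j. i < M \<Longrightarrow> j < M \<Longrightarrow> \<bar>g i - g j\<bar> \<le> a"
    and h: "\<And>i j. i < M \<Longrightarrow> j < M \<Longrightarrow> \<bar>h i - h j\<bar> \<le> b"
  shows "\<bar>(\<Sum>k<M. g k * h k) / real M - ((\<Sum>k<M. g k) / real M) * ((\<Sum>k<M. h k) / real M)\<bar> \<le> a * b"
proof -
  have dev: "\<bar>f i - (\<Sum>k<M. f k) / real M\<bar> \<le> c"
    if "\<And>i j. i < M \<Longrightarrow> j < M \<Longrightarrow> \<bar>f i - f j\<bar> \<le> c" "i < M" for f :: "nat \<Rightarrow> real" and c i
  proof -
    have "f i - (\<Sum>k<M. f k) / real M = (\<Sum>k<M. f i - f k) / real M"
      using M by (simp add: sum_subtractf field_simps)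
    also have "\<bar>\<dots>\<bar> \<le> (\<Sum>k<M. c) / real M"
      unfolding abs_divide abs_of_nat
      using that by (intro divide_right_mono order_trans[OF sum_abs] sum_mono) auto
    finally show ?thesis using M by simp
  qed
  define A where "A = (\<Sum>k<M. g k) / real M"
  define B where "B = (\<Sum>k<M. h k) / real M"
  have sums: "(\<Sum>k<M. g k) = real M * A" "(\<Sum>k<M. h k) = real M * B" using M by (simp_all add: A_def B_def)
  have "(\<Sum>k<M. (g k - A) * (h k - B)) = (\<Sum>k<M. g k * h k) - B * (\<Sum>k<M. g k) - A * (\<Sum>k<M. h k) + real M * (A * B)"
    by (simp add: algebra_simps sum_subtractf sum.distrib sum_distrib_left)
  then have "(\<Sum>k<M. g k * h k) / real M - A * B = (\<Sum>k<M. (g k - A) * (h k - B)) / real M"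
    unfolding sums using M by (simp add: field_simps)
  also have "\<bar>\<dots>\<bar> \<le> (\<Sum>k<M. a * b) / real M"
    unfolding abs_divide abs_of_nat using dev[of g a, OF g] dev[of h b, OF h]
    by (intro divide_right_mono order_trans[OF sum_abs] sum_mono)
       (auto simp: abs_mult A_def B_def intro!: mult_mono order_trans[OF abs_ge_zero])
  finally show ?thesis using M by (simp add: A_def B_def)
qed

text \<open>The digits of a uniform number are independent, so the covariance is a sum over the digits of
covariances of martingale differences, each bounded by the product of the two oscillations. In the
induction the first digit is split off: the covariance is the mean of the conditional covariances
plus the covariance of the conditional means. Digits beyond level \<open>N\<close> enter only through the
oscillation \<open>e\<close> on cells.\<close>

lemma covariance_le:
  assumes M: "M > 0" and "bounded_borel G" "bounded_borel H"
    and "\<And>j x y. differ M j x y \<Longrightarrow> \<bar>G x - G y\<bar> \<le> a j"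
    and "\<And>j x y. differ M j x y \<Longrightarrow> \<bar>H x - H y\<bar> \<le> b j"
    and "\<And>x y. same_cell M N x y \<Longrightarrow> \<bar>G x - G y\<bar> \<le> e"
    and "\<And>x. x \<in> {0..<1} \<Longrightarrow> \<bar>H x\<bar> \<le> B"
  shows "\<bar>(\<integral>x. G x * H x \<partial>unif) - (\<integral>x. G x \<partial>unif) * (\<integral>x. H x \<partial>unif)\<bar> \<le> (\<Sum>j<N. a j * b j) + e * B"
  using assms(2-)
proof (induction N arbitrary: G H a b)
  case 0
  define A where "A = (\<integral>x. G x \<partial>unif)"
  have dev: "\<bar>G x - A\<bar> \<le> e" if "x \<in> {0..<1}" for x
  proof -
    have "G x - A = (\<integral>y. G x - G y \<partial>unif)"
      unfolding A_def using integrable_unif[OF 0(1)] by simp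
    also have "\<bar>\<dots>\<bar> \<le> e" using 0(5) that
      by (intro abs_integral_unif_le bounded_borel_diff bounded_borel_const 0(1)) (auto simp: same_cell_def)
    finally show ?thesis .
  qed
  have "(\<integral>x. G x * H x \<partial>unif) - A * (\<integral>x. H x \<partial>unif) = (\<integral>x. (G x - A) * H x \<partial>unif)"
    using integrable_unif[OF bounded_borel_mult[OF 0(1,2)]] integrable_unif[OF 0(2)] by (simp add: left_diff_distrib)
  also have "\<bar>\<dots>\<bar> \<le> e * B"
    using dev 0(6) by (intro abs_integral_unif_le bounded_borel_mult bounded_borel_diff bounded_borel_const 0(1,2))
       (auto simp: abs_mult intro!: mult_mono order_trans[OF abs_ge_zero])
  finally show ?case by (simp add: A_def)
next
  case (Suc N)
  define Gk where "Gk k x = G ((x + real k) / real M)" for k x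
  define Hk where "Hk k x = H ((x + real k) / real M)" for k x
  have bG: "bounded_borel (Gk k)" and bH: "bounded_borel (Hk k)" for k
    unfolding Gk_def Hk_def by (intro bounded_borel_compose[OF Suc.prems(1)] bounded_borel_compose[OF Suc.prems(2)]; measurable)+
  have cov: "\<bar>(\<integral>x. Gk k x * Hk k x \<partial>unif) - (\<integral>x. Gk k x \<partial>unif) * (\<integral>x. Hk k x \<partial>unif)\<bar>
      \<le> (\<Sum>j<N. a (Suc j) * b (Suc j)) + e * B" if k: "k < M" for k
  proof (rule Suc.IH[OF bG bH])
    show "\<bar>Gk k x - Gk k y\<bar> \<le> a (Suc j)" if "differ M j x y" for j x y
      unfolding Gk_def using k that by (intro Suc.prems(3)) (auto simp: differ_Suc prepend_def)
    show "\<bar>Hk k x - Hk k y\<bar> \<le> b (Suc j)" if "differ M j x y" for j x y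
      unfolding Hk_def using k that by (intro Suc.prems(4)) (auto simp: differ_Suc prepend_def)
    show "\<bar>Gk k x - Gk k y\<bar> \<le> e" if "same_cell M N x y" for x y
      unfolding Gk_def using k that by (intro Suc.prems(5)) (auto simp: same_cell_Suc prepend_def)
    show "\<bar>Hk k x\<bar> \<le> B" if "x \<in> {0..<1}" for x
      unfolding Hk_def using append_cube[OF M that k] by (intro Suc.prems(6)) auto
  qed
  have d0: "differ M 0 ((x + real i) / real M) ((x + real j) / real M)"
    if "i < M" "j < M" "x \<in> {0..<1}" for i j x
    unfolding differ_def funpow.simps id_apply using that by blast
  define g where "g k = (\<integral>x. Gk k x \<partial>unif)" for k
  define h where "h k = (\<integral>x. Hk k x \<partial>unif)" for k
  have g: "\<bar>g i - g j\<bar> \<le> a 0" if "i < M" "j < M" for i j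
  proof -
    have "g i - g j = (\<integral>x. Gk i x - Gk j x \<partial>unif)" using integrable_unif[OF bG] by (simp add: g_def)
    also have "\<bar>\<dots>\<bar> \<le> a 0"
      using that by (intro abs_integral_unif_le bounded_borel_diff bG) (auto simp: Gk_def intro!: Suc.prems(3) d0)
    finally show ?thesis .
  qed
  have h: "\<bar>h i - h j\<bar> \<le> b 0" if "i < M" "j < M" for i j
  proof -
    have "h i - h j = (\<integral>x. Hk i x - Hk j x \<partial>unif)" using integrable_unif[OF bH] by (simp add: h_def)
    also have "\<bar>\<dots>\<bar> \<le> b 0"
      using that by (intro abs_integral_unif_le bounded_borel_diff bH) (auto simp: Hk_def intro!: Suc.prems(4) d0)
    finally show ?thesis .
  qed
  have "\<bar>(\<Sum>k<M. (\<integral>x. Gk k x * Hk k x \<partial>unif) - g k * h k) / real M\<bar>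
      \<le> (\<Sum>k<M. (\<Sum>j<N. a (Suc j) * b (Suc j)) + e * B) / real M"
    unfolding abs_divide abs_of_nat using cov
    by (intro divide_right_mono order_trans[OF sum_abs] sum_mono) (auto simp: g_def h_def)
  then have 1: "\<bar>(\<Sum>k<M. (\<integral>x. Gk k x * Hk k x \<partial>unif)) / real M - (\<Sum>k<M. g k * h k) / real M\<bar>
      \<le> (\<Sum>j<N. a (Suc j) * b (Suc j)) + e * B"
    using M by (simp add: sum_subtractf diff_divide_distrib)
  have 2: "(\<integral>x. G x * H x \<partial>unif) = (\<Sum>k<M. (\<integral>x. Gk k x * Hk k x \<partial>unif)) / real M"
    using integral_unif_split[OF bounded_borel_mult[OF Suc.prems(1,2)] M] by (simp add: Gk_def Hk_def)
  have 3: "(\<integral>x. G x \<partial>unif) = (\<Sum>k<M. g k) / real M" "(\<integral>x. H x \<partial>unif) = (\<Sum>k<M. h k) / real M"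
    using integral_unif_split[OF Suc.prems(1) M] integral_unif_split[OF Suc.prems(2) M]
    by (simp_all add: Gk_def Hk_def g_def h_def)
  have "(\<Sum>j<Suc N. a j * b j) = a 0 * b 0 + (\<Sum>j<N. a (Suc j) * b (Suc j))"
    by (rule sum.lessThan_Suc_shift)
  moreover have "\<bar>(\<Sum>k<M. g k * h k) / real M - ((\<Sum>k<M. g k) / real M) * ((\<Sum>k<M. h k) / real M)\<bar> \<le> a 0 * b 0"
    by (rule discrete_covariance[OF M]) (fact g, fact h)
  ultimately show ?case using 1 unfolding 2 3 by linarith
qed


section \<open>The random walk killed at zero\<close>

text \<open>By \<open>killed_Suc\<close> and \<open>killed_0\<close> this is the probability that the simple random walk started at \<open>i\<close> is at \<open>j\<close>
after \<open>n\<close> steps without having visited 0, written in the eigenbasis \<open>sin (j x)\<close> of the walk.\<close>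

definition killed :: "nat \<Rightarrow> nat \<Rightarrow> nat \<Rightarrow> real" where
  "killed n i j = 2 / pi * integral {0..pi} (\<lambda>x. cos x ^ n * sin (real i * x) * sin (real j * x))"

text \<open>For even \<open>n\<close> this is the entry \<open>killed n 1 1\<close>; the absolute value makes it a bound for all kernel
entries also at odd times, when that entry vanishes.\<close>

definition excursion :: "nat \<Rightarrow> real" where
  "excursion n = 2 / pi * integral {0..pi} (\<lambda>x. \<bar>cos x\<bar> ^ n * (sin x)\<^sup>2)"

lemma killed_integrable: "(\<lambda>x. cos x ^ n * sin (real i * x) * sin (real j * x)) integrable_on {0..pi}"
  by (intro integrable_continuous_interval continuous_intros)

lemma excursion_integrable: "(\<lambda>x. \<bar>cos x\<bar> ^ n * (sin x)\<^sup>2) integrable_on {0..pi}"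
  by (intro integrable_continuous_interval continuous_intros)

lemma killed_0_right [simp]: "killed n i 0 = 0"
  by (simp add: killed_def)

lemma killed_Suc: "killed (Suc n) i (Suc j) = (killed n i j + killed n i (Suc (Suc j))) / 2"
proof -
  have "cos x ^ Suc n * sin (real i * x) * sin (real (Suc j) * x) =
     (1/2) * (cos x ^ n * sin (real i * x) * sin (real j * x) +
            cos x ^ n * sin (real i * x) * sin (real (Suc (Suc j)) * x))" for x
  proof -
    have "real j * x = real (Suc j) * x - x" "real (Suc (Suc j)) * x = real (Suc j) * x + x"
      by (simp_all add: algebra_simps)
    then have "sin (real j * x) + sin (real (Suc (Suc j)) * x) = 2 * (sin (real (Suc j) * x) * cos x)"
      by (simp only: sin_add sin_diff)
    then show ?thesis by (simp only: power_Suc distrib_left[symmetric] mult_ac)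
  qed
  then show ?thesis
    unfolding killed_def
    by (simp only: integral_mult_right integral_add[OF killed_integrable killed_integrable]) (simp add: algebra_simps)
qed

lemma killed_0:
  assumes "i > 0" "j > 0"
  shows "killed 0 i j = (if i = j then 1 else 0)"
proof -
  have cosint: "((\<lambda>x. cos (real_of_int k * x)) has_integral (if k = 0 then pi else 0)) {0..pi}" for k
  proof (cases "k = 0")
    case True
    then show ?thesis using has_integral_const_real[of "1::real" 0 pi] by simp
  next
    case False
    have "((\<lambda>x. cos (real_of_int k * x)) has_integral
        (sin (real_of_int k * pi) / k - sin (real_of_int k * 0) / k)) {0..pi}"
      using False
      by (intro fundamental_theorem_of_calculus)
         (auto intro!: derivative_eq_intros simp: has_real_derivative_iff_has_vector_derivative[symmetric])
    moreover have "sin (real_of_int k * pi) = 0"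
      by (simp add: sin_zero_iff_int2)
    ultimately show ?thesis using False by simp
  qed
  have "((\<lambda>x. (cos (real_of_int (int i - int j) * x) - cos (real_of_int (int i + int j) * x)) / 2) has_integral
     ((if int i - int j = 0 then pi else 0) - (if int i + int j = 0 then pi else 0)) / 2) {0..pi}"
    by (intro has_integral_divide has_integral_diff cosint)
  moreover have "(cos (real_of_int (int i - int j) * x) - cos (real_of_int (int i + int j) * x)) / 2
     = sin (real i * x) * sin (real j * x)" for x
    by (simp add: left_diff_distrib distrib_right cos_diff cos_add)
  ultimately have "integral {0..pi} (\<lambda>x. sin (real i * x) * sin (real j * x)) = (if i = j then pi else 0) / 2"
    using assms by (intro integral_unique) (simp split: if_splits)
  then show ?thesis by (cases "i = j") (simp_all add: killed_def)
qed

lemma abs_sin_mult_le: "\<bar>sin (real i * x)\<bar> \<le> real i * \<bar>sin x\<bar>"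
proof (induction i)
  case (Suc i)
  have "real (Suc i) * x = real i * x + x" by (simp add: algebra_simps)
  then have "\<bar>sin (real (Suc i) * x)\<bar> = \<bar>sin (real i * x) * cos x + cos (real i * x) * sin x\<bar>"
    by (simp only: sin_add)
  also have "\<dots> \<le> \<bar>sin (real i * x)\<bar> * 1 + 1 * \<bar>sin x\<bar>"
    by (rule order_trans[OF abs_triangle_ineq]) (auto simp only: abs_mult intro!: add_mono mult_mono abs_cos_le_one)
  also have "\<dots> \<le> real (Suc i) * \<bar>sin x\<bar>" using Suc by (simp add: algebra_simps)
  finally show ?case .
qed simp

lemma abs_killed_le: "\<bar>killed n i j\<bar> \<le> real i * real j * excursion n"
proof -
  have "norm (integral {0..pi} (\<lambda>x. cos x ^ n * sin (real i * x) * sin (real j * x)))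
    \<le> integral {0..pi} (\<lambda>x. real i * real j * (\<bar>cos x\<bar> ^ n * (sin x)\<^sup>2))"
  proof (rule Henstock_Kurzweil_Integration.integral_norm_bound_integral[OF killed_integrable])
    show "(\<lambda>x. real i * real j * (\<bar>cos x\<bar> ^ n * (sin x)\<^sup>2)) integrable_on {0..pi}"
      by (intro integrable_continuous_interval continuous_intros)
    fix x :: real
    have "\<bar>cos x ^ n * sin (real i * x) * sin (real j * x)\<bar> = \<bar>cos x\<bar> ^ n * (\<bar>sin (real i * x)\<bar> * \<bar>sin (real j * x)\<bar>)"
      by (simp add: abs_mult power_abs)
    also have "\<dots> \<le> \<bar>cos x\<bar> ^ n * ((real i * \<bar>sin x\<bar>) * (real j * \<bar>sin x\<bar>))"
      by (intro mult_left_mono mult_mono abs_sin_mult_le) auto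
    also have "\<dots> = real i * real j * (\<bar>cos x\<bar> ^ n * (sin x)\<^sup>2)"
      by (simp add: power2_eq_square[of "sin x"] algebra_simps)
    finally show "norm (cos x ^ n * sin (real i * x) * sin (real j * x)) \<le> real i * real j * (\<bar>cos x\<bar> ^ n * (sin x)\<^sup>2)"
      by simp
  qed
  then show ?thesis
    unfolding killed_def excursion_def abs_mult by (simp add: divide_right_mono field_simps)
qed

lemma killed_eq_excursion: "even n \<Longrightarrow> killed n 1 1 = excursion n"
  by (simp add: killed_def excursion_def power_even_abs power2_eq_square mult.assoc)

lemma excursion_decreasing: "excursion (Suc n) \<le> excursion n"
proof -
  have "integral {0..pi} (\<lambda>x. \<bar>cos x\<bar> ^ Suc n * (sin x)\<^sup>2) \<le> integral {0..pi} (\<lambda>x. \<bar>cos x\<bar> ^ n * (sin x)\<^sup>2)"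
    by (intro integral_le excursion_integrable mult_right_mono power_decreasing) auto
  then show ?thesis unfolding excursion_def by (intro mult_left_mono) auto
qed

lemma excursion_nonneg: "excursion n \<ge> 0"
  unfolding excursion_def by (intro mult_nonneg_nonneg integral_nonneg excursion_integrable) auto

lemma excursion_0: "excursion 0 = 1"
  using killed_eq_excursion[of 0] killed_0[of 1 1] by simp

text \<open>Integration of the derivative of \<open>cos x ^ (n + 1) * sin x ^ 3\<close>.\<close>

lemma excursion_even_rec: "real (2 * m + 4) * excursion (2 * Suc m) = real (2 * m + 1) * excursion (2 * m)"
proof -
  define n where "n = 2 * m"
  have "even n" by (simp add: n_def)
  have e: "excursion k = 2 / pi * integral {0..pi} (\<lambda>x. cos x ^ k * (sin x)\<^sup>2)" if "even k" for k
    using that by (simp add: excursion_def power_even_abs)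
  have int: "(\<lambda>x. cos x ^ k * (sin x)\<^sup>2) integrable_on {0..pi}" for k
    by (intro integrable_continuous_interval continuous_intros)
  have "((\<lambda>x. real (n + 4) * (cos x ^ (n + 2) * (sin x)\<^sup>2) - real (n + 1) * (cos x ^ n * (sin x)\<^sup>2)) has_integral
      (cos pi ^ (n + 1) * sin pi ^ 3 - cos 0 ^ (n + 1) * sin 0 ^ 3)) {0..pi}"
  proof (rule fundamental_theorem_of_calculus)
    fix x :: real
    have d1: "((\<lambda>x. cos x ^ Suc n) has_real_derivative - (real (n + 1) * cos x ^ n * sin x)) (at x within {0..pi})"
      using DERIV_power_Suc[OF has_field_derivative_at_within[OF DERIV_cos], of n x "{0..pi}"]
      by (simp add: algebra_simps)
    have d2: "((\<lambda>x. sin x ^ 3) has_real_derivative 3 * sin x ^ 2 * cos x) (at x within {0..pi})"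
      by (auto intro!: derivative_eq_intros simp: algebra_simps)
    have "((\<lambda>x. cos x ^ (n + 1) * sin x ^ 3) has_real_derivative
        - (real (n + 1) * cos x ^ n * sin x) * sin x ^ 3 + cos x ^ (n + 1) * (3 * sin x ^ 2 * cos x)) (at x within {0..pi})"
      using DERIV_mult[OF d1 d2] by (simp only: Suc_eq_plus1 mult.commute)
    moreover have "- (real (n + 1) * cos x ^ n * sin x) * sin x ^ 3 + cos x ^ (n + 1) * (3 * sin x ^ 2 * cos x)
       = real (n + 4) * (cos x ^ (n + 2) * (sin x)\<^sup>2) - real (n + 1) * (cos x ^ n * (sin x)\<^sup>2)"
    proof -
      have A: "sin x * sin x ^ 3 = (sin x)\<^sup>2 * (1 - (cos x)\<^sup>2)"
      proof -
        have "sin x * sin x ^ 3 = (sin x)\<^sup>2 * (sin x)\<^sup>2"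
          by (simp add: power2_eq_square power3_eq_cube)
        also have "\<dots> = (sin x)\<^sup>2 * (1 - (cos x)\<^sup>2)" by (simp only: sin_squared_eq)
        finally show ?thesis .
      qed
      have B: "- (real (n + 1) * cos x ^ n * sin x) * sin x ^ 3 = - (real (n + 1) * cos x ^ n) * (sin x * sin x ^ 3)"
        by simp
      show ?thesis unfolding B A by (simp add: algebra_simps power2_eq_square)
    qed
    ultimately show "((\<lambda>x. cos x ^ (n + 1) * sin x ^ 3) has_vector_derivative
      real (n + 4) * (cos x ^ (n + 2) * (sin x)\<^sup>2) - real (n + 1) * (cos x ^ n * (sin x)\<^sup>2)) (at x within {0..pi})"
      by (simp add: has_real_derivative_iff_has_vector_derivative[symmetric])
  qed simp
  then have "integral {0..pi} (\<lambda>x. real (n + 4) * (cos x ^ (n + 2) * (sin x)\<^sup>2) - real (n + 1) * (cos x ^ n * (sin x)\<^sup>2)) = 0"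
    by (intro integral_unique) simp
  moreover have "integral {0..pi} (\<lambda>x. real (n + 4) * (cos x ^ (n + 2) * (sin x)\<^sup>2) - real (n + 1) * (cos x ^ n * (sin x)\<^sup>2))
     = real (n + 4) * integral {0..pi} (\<lambda>x. cos x ^ (n + 2) * (sin x)\<^sup>2) - real (n + 1) * integral {0..pi} (\<lambda>x. cos x ^ n * (sin x)\<^sup>2)"
    by (subst Henstock_Kurzweil_Integration.integral_diff)
       (auto intro!: integrable_continuous_interval continuous_intros simp: integral_mult_right)
  ultimately have "real (n + 4) * integral {0..pi} (\<lambda>x. cos x ^ (n + 2) * (sin x)\<^sup>2)
      = real (n + 1) * integral {0..pi} (\<lambda>x. cos x ^ n * (sin x)\<^sup>2)" by simp
  then have "real (n + 4) * excursion (n + 2) = real (n + 1) * excursion n"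
    using \<open>even n\<close> by (simp add: e mult.left_commute)
  then show ?thesis by (simp add: n_def)
qed

lemma excursion_even_Suc:
  "(excursion (2 * Suc m))\<^sup>2 = (excursion (2 * m))\<^sup>2 * ((2 * real m + 1)\<^sup>2 / (2 * real m + 4)\<^sup>2)"
proof -
  have "excursion (2 * Suc m) = excursion (2 * m) * ((2 * real m + 1) / (2 * real m + 4))"
    using excursion_even_rec[of m] by (simp add: field_simps)
  then show ?thesis by (simp only: power_mult_distrib power_divide)
qed

text \<open>Squaring turns the exponent \<open>3/2\<close> into an integer, so that the recursion becomes a polynomial
inequality: the square times \<open>(m + 1)\<^sup>3\<close> decreases, the square times \<open>m\<^sup>3\<close> increases.\<close>

lemma excursion_even_upper: "(excursion (2 * m))\<^sup>2 * (real m + 1) ^ 3 \<le> 1"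
proof (induction m)
  case 0 then show ?case by (simp add: excursion_0)
next
  case (Suc m)
  have "(2 * real m + 1)\<^sup>2 * (real m + 2) ^ 3 \<le> (2 * real m + 4)\<^sup>2 * (real m + 1) ^ 3"
    by (simp add: power2_eq_square power3_eq_cube algebra_simps)
  then have "(2 * real m + 1)\<^sup>2 / (2 * real m + 4)\<^sup>2 * (real m + 2) ^ 3 \<le> (real m + 1) ^ 3"
    by (simp add: pos_divide_le_eq zero_less_power mult.commute add_pos_nonneg)
  then have "(excursion (2 * m))\<^sup>2 * ((2 * real m + 1)\<^sup>2 / (2 * real m + 4)\<^sup>2 * (real m + 2) ^ 3) \<le>
     (excursion (2 * m))\<^sup>2 * (real m + 1) ^ 3" by (intro mult_left_mono) auto
  also have "\<dots> \<le> 1" by (rule Suc.IH)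
  finally have "(excursion (2 * Suc m))\<^sup>2 * (real m + 2) ^ 3 \<le> 1"
    unfolding excursion_even_Suc mult.assoc .
  moreover have "real m + 2 = real (Suc m) + 1" by simp
  ultimately show ?case by (simp only:)
qed

lemma excursion_even_lower: "m \<ge> 1 \<Longrightarrow> (excursion (2 * m))\<^sup>2 * real m ^ 3 \<ge> 1 / 16"
proof (induction m rule: nat_induct_at_least)
  case base
  have e: "excursion (2 * 1) = 1 / 4" using excursion_even_rec[of 0] by (simp add: excursion_0)
  show ?case unfolding e by (simp add: power2_eq_square)
next
  case (Suc m)
  have "real m ^ 3 * (2 * real m + 4)\<^sup>2 \<le> (2 * real m + 1)\<^sup>2 * (real m + 1) ^ 3"
    by (simp add: power2_eq_square power3_eq_cube algebra_simps)
  then have "real m ^ 3 \<le> (2 * real m + 1)\<^sup>2 / (2 * real m + 4)\<^sup>2 * (real m + 1) ^ 3"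
    by (simp add: pos_le_divide_eq zero_less_power add_pos_nonneg)
  then have "(excursion (2 * m))\<^sup>2 * real m ^ 3 \<le>
      (excursion (2 * m))\<^sup>2 * ((2 * real m + 1)\<^sup>2 / (2 * real m + 4)\<^sup>2 * (real m + 1) ^ 3)"
    by (intro mult_left_mono) auto
  with Suc.IH have "1 / 16 \<le> (excursion (2 * m))\<^sup>2 * ((2 * real m + 1)\<^sup>2 / (2 * real m + 4)\<^sup>2 * (real m + 1) ^ 3)"
    by (rule order_trans)
  then have "1 / 16 \<le> (excursion (2 * Suc m))\<^sup>2 * (real m + 1) ^ 3"
    unfolding excursion_even_Suc mult.assoc .
  moreover have "real m + 1 = real (Suc m)" by simp
  ultimately show ?case by (simp only:)
qed

lemma powr_three_halves_sq:
  fixes x :: real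
  assumes x: "x > 0" shows "(x powr (- 3 / 2))\<^sup>2 = 1 / x ^ 3"
proof -
  have "(x powr (- 3 / 2))\<^sup>2 = x powr (- 3)" using x by (simp add: powr_power)
  also have "\<dots> = 1 / x ^ 3" using x by (simp add: powr_minus_divide powr_numeral)
  finally show ?thesis .
qed

lemma powr_half_le:
  fixes x y :: real
  assumes "x > 0" "y \<ge> x / 2" shows "y powr (- 3 / 2) \<le> 3 * x powr (- 3 / 2)"
proof -
  have "y powr (- 3 / 2) \<le> (x / 2) powr (- 3 / 2)"
    using assms by (intro powr_mono2') auto
  also have "\<dots> = 2 powr (3 / 2) * x powr (- 3 / 2)"
    using assms by (simp add: powr_divide powr_minus_divide)
  also have "2 powr (3 / 2) \<le> (3::real)"
  proof (rule power2_le_imp_le)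
    have "(2 powr (3 / 2) :: real)\<^sup>2 = 2 powr 3" by (simp add: powr_power)
    also have "\<dots> = 8" by (simp add: powr_numeral)
    finally show "(2 powr (3 / 2) :: real)\<^sup>2 \<le> 3\<^sup>2" by simp
  qed simp
  then have "2 powr (3 / 2) * x powr (- 3 / 2) \<le> 3 * x powr (- 3 / 2)" by (intro mult_right_mono) auto
  finally show ?thesis .
qed

lemma excursion_le: "excursion n \<le> 3 * (real n + 1) powr (- 3 / 2)"
proof -
  define m where "m = n div 2"
  have "excursion n \<le> excursion (2 * m)"
  proof (cases "even n")
    case False
    then have "n = Suc (2 * m)" by (simp add: m_def)
    then show ?thesis using excursion_decreasing by metis
  qed (simp add: m_def)
  also have "\<dots> \<le> (real m + 1) powr (- 3 / 2)"
  proof (rule power2_le_imp_le)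
    show "(excursion (2 * m))\<^sup>2 \<le> ((real m + 1) powr (- 3 / 2))\<^sup>2"
      using excursion_even_upper[of m] by (subst powr_three_halves_sq) (auto simp: pos_le_divide_eq add_pos_nonneg)
  qed simp
  also have "\<dots> \<le> 3 * (real n + 1) powr (- 3 / 2)"
  proof (rule powr_half_le)
    have "n \<le> 2 * m + 1" by (simp add: m_def)
    then have "real n \<le> real (2 * m + 1)" by (simp only: of_nat_le_iff)
    then show "(real n + 1) / 2 \<le> real m + 1" by simp
  qed simp
  finally show ?thesis .
qed

lemma excursion_ge:
  assumes "even n" "n \<ge> 2" shows "excursion n \<ge> 1 / 4 * real n powr (- 3 / 2)"
proof -
  obtain m where m: "n = 2 * m" "m \<ge> 1" using assms by auto
  have "1 / 4 * real m powr (- 3 / 2) \<le> excursion (2 * m)"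
  proof (rule power2_le_imp_le[OF _ excursion_nonneg])
    have "(1 / 4 * real m powr (- 3 / 2))\<^sup>2 = 1 / 16 / real m ^ 3"
      unfolding power_mult_distrib using m by (subst powr_three_halves_sq) (auto simp: power2_eq_square)
    then show "(1 / 4 * real m powr (- 3 / 2))\<^sup>2 \<le> (excursion (2 * m))\<^sup>2"
      using excursion_even_lower[OF m(2)] m by (simp add: pos_divide_le_eq)
  qed
  moreover have "real n powr (- 3 / 2) \<le> real m powr (- 3 / 2)"
    using m by (intro powr_mono2') auto
  ultimately show ?thesis using m by simp
qed

lemma influence_nonneg: "r \<ge> 0 \<Longrightarrow> influence r m j \<ge> 0"
  by (induction r m j rule: influence.induct) auto

text \<open>Duhamel's formula: the initial values contribute the first sum, and the boundary value \<open>r\<^sup>t\<close>, which enters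
site 1 with weight one half at time \<open>t + 1\<close>, contributes the second. Truncation at \<open>N\<close> is harmless
since \<open>n\<close> steps from \<open>j\<close> only reach \<open>j + n\<close>.\<close>

lemma influence_eq_killed:
  "j \<ge> 1 \<Longrightarrow> j + n \<le> N \<Longrightarrow>
   influence r n j = (\<Sum>i=1..N. r ^ i * killed n i j) + (\<Sum>t<n. r ^ t * killed (n - 1 - t) 1 j) / 2"
proof (induction n arbitrary: j)
  case 0
  have "(\<Sum>i=1..N. r ^ i * killed 0 i j) = (\<Sum>i=1..N. if i = j then r ^ j else 0)"
    using 0 by (intro sum.cong) (auto simp: killed_0)
  then show ?case using 0 by simp
next
  case (Suc n)
  define F where "F j = (\<Sum>i=1..N. r ^ i * killed n i j) + (\<Sum>t<n. r ^ t * killed (n - 1 - t) 1 j) / 2" for j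
  obtain k where k: "j = Suc k" using Suc.prems by (cases j) auto
  have "(\<Sum>t<n. r ^ t * killed (n - t) 1 j) = (\<Sum>t<n. r ^ t * killed (n - 1 - t) 1 k + r ^ t * killed (n - 1 - t) 1 (Suc (Suc k))) / 2"
    unfolding sum_divide_distrib
  proof (intro sum.cong refl)
    fix t assume "t \<in> {..<n}"
    then have "n - t = Suc (n - 1 - t)" by auto
    then show "r ^ t * killed (n - t) 1 j = (r ^ t * killed (n - 1 - t) 1 k + r ^ t * killed (n - 1 - t) 1 (Suc (Suc k))) / 2"
      unfolding k by (simp only: killed_Suc) (simp add: algebra_simps)
  qed
  moreover have "(\<Sum>i=1..N. r ^ i * killed (Suc n) i j) = (\<Sum>i=1..N. r ^ i * killed n i k + r ^ i * killed n i (Suc (Suc k))) / 2"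
    unfolding sum_divide_distrib k by (intro sum.cong refl) (simp add: killed_Suc algebra_simps)
  ultimately have rhs: "(\<Sum>i=1..N. r ^ i * killed (Suc n) i j) + (\<Sum>t<Suc n. r ^ t * killed (Suc n - 1 - t) 1 j) / 2
      = (F k + F (Suc (Suc k))) / 2 + r ^ n * killed 0 1 j / 2"
    by (simp add: F_def sum.distrib field_simps)
  have IH: "influence r n i = F i" if "i \<ge> 1" "i + n \<le> N" for i
    using Suc.IH[OF that] by (simp only: F_def)
  have top: "influence r n (Suc (Suc k)) = F (Suc (Suc k))" using Suc.prems k by (intro IH) auto
  show ?case
  proof (cases "k = 0")
    case True
    have "F 0 = 0" by (simp add: F_def)
    then show ?thesis unfolding rhs using True k top killed_0[of 1 1] by simp
  next
    case False
    then have "influence r n k = F k" using Suc.prems k by (intro IH) auto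
    then show ?thesis unfolding rhs using False k top killed_0[of 1 j] by simp
  qed
qed

lemma summable_square_geometric:
  fixes r :: real assumes "0 \<le> r" "r < 1"
  shows "summable (\<lambda>t. r ^ t * (real t + 2)\<^sup>2)"
proof -
  have geo: "summable (\<lambda>n. 1 * x ^ n)" if "norm x < 1" for x :: real
    using that by simp
  have "summable (\<lambda>n. diffs (\<lambda>_. 1) n * x ^ n)" if "norm x < 1" for x :: real
    by (rule termdiff_converges[OF that geo])
  then have "summable (\<lambda>n. diffs (diffs (\<lambda>_. 1)) n * r ^ n)"
    by (rule termdiff_converges[rotated]) (use assms in auto)
  then have "summable (\<lambda>n. 2 * (diffs (diffs (\<lambda>_. 1)) n * r ^ n))"
    by (rule summable_mult)
  then show ?thesis
  proof (rule summable_comparison_test'[where N=0])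
    fix n :: nat
    have "(real n + 2)\<^sup>2 \<le> 2 * ((real n + 1) * (real n + 2))"
      by (simp add: power2_eq_square algebra_simps)
    then have "r ^ n * (real n + 2)\<^sup>2 \<le> r ^ n * (2 * ((real n + 1) * (real n + 2)))"
      using assms by (intro mult_left_mono) auto
    then show "norm (r ^ n * (real n + 2)\<^sup>2) \<le> 2 * (diffs (diffs (\<lambda>_. 1)) n * r ^ n)"
      using assms by (simp add: diffs_def abs_mult algebra_simps)
  qed
qed

lemma influence_le:
  assumes r: "0 \<le> r" "r < 1"
  obtains C where "C > 0" "\<And>n j. j \<ge> 1 \<Longrightarrow> influence r n j \<le> C * real j * (real n + 1) powr (- 3 / 2)"
proof -
  define K where "K = (\<Sum>t. r ^ t * (real t + 2)\<^sup>2)"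
  have K: "(\<Sum>t\<in>A. r ^ t * (real t + 2)\<^sup>2) \<le> K" if "finite A" for A
    unfolding K_def using that r by (intro sum_le_suminf summable_square_geometric) auto
  have "K \<ge> 0" using K[of "{}"] by simp
  have main: "influence r n j \<le> (3 * K + 3 * K / 2) * real j * (real n + 1) powr (- 3 / 2)" if j: "j \<ge> 1" for n j
  proof -
    define d where "d = (real n + 1) powr (- 3 / 2)"
    have "(\<Sum>i=1..j+n. r ^ i * killed n i j) \<le> (\<Sum>i=1..j+n. (r ^ i * (real i + 2)\<^sup>2) * (real j * (3 * d)))"
    proof (rule sum_mono)
      fix i
      have "killed n i j \<le> real i * real j * excursion n" using abs_killed_le[of n i j] by simp
      also have "\<dots> \<le> (real i + 2)\<^sup>2 * (real j * (3 * d))"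
      proof -
        have "real i * real j * excursion n \<le> real i * real j * (3 * d)"
          using excursion_le[of n] by (intro mult_left_mono) (auto simp: d_def)
        also have "\<dots> = real i * (real j * (3 * d))" by simp
        also have "\<dots> \<le> (real i + 2)\<^sup>2 * (real j * (3 * d))"
          by (intro mult_right_mono) (auto simp: power2_eq_square algebra_simps d_def)
        finally show ?thesis .
      qed
      finally show "r ^ i * killed n i j \<le> (r ^ i * (real i + 2)\<^sup>2) * (real j * (3 * d))"
        using r by (simp add: mult.assoc mult_left_mono)
    qed
    also have "\<dots> \<le> K * (real j * (3 * d))"
      unfolding sum_distrib_right[symmetric] by (intro mult_right_mono K) (auto simp: d_def)
    finally have 1: "(\<Sum>i=1..j+n. r ^ i * killed n i j) \<le> K * (real j * (3 * d))" .
    have "(\<Sum>t<n. r ^ t * killed (n - 1 - t) 1 j) \<le> (\<Sum>t<n. (r ^ t * (real t + 2)\<^sup>2) * (real j * (3 * d)))"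
    proof (rule sum_mono)
      fix t assume "t \<in> {..<n}"
      then have t: "t < n" by simp
      have s: "real (n - 1 - t) + 1 = real n - real t" using t by (simp add: of_nat_diff)
      \<comment> \<open>Moving a source from time 0 to time \<open>t\<close> costs at most the factor \<open>(t + 2) powr (3/2)\<close>, absorbed by \<open>r\<^sup>t\<close>.\<close>
      have "0 \<le> (real n - real t - 1) * (real t + 1)" using t by (intro mult_nonneg_nonneg) auto
      then have "real n + 1 \<le> (real n - real t) * (real t + 2)" by (simp add: algebra_simps)
      then have "((real n - real t) * (real t + 2)) powr (- 3 / 2) \<le> d"
        unfolding d_def by (intro powr_mono2') auto
      then have "(real n - real t) powr (- 3 / 2) * (real t + 2) powr (- 3 / 2) \<le> d"
        using t by (subst (asm) powr_mult) auto
      then have "(real n - real t) powr (- 3 / 2) * (real t + 2) powr (- 3 / 2) * (real t + 2) powr (3/2) \<le> d * (real t + 2) powr (3/2)"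
        by (intro mult_right_mono) auto
      then have "(real n - real t) powr (- 3 / 2) \<le> d * (real t + 2) powr (3/2)"
        by (simp add: mult.assoc powr_add[symmetric])
      also have "\<dots> \<le> d * (real t + 2) powr 2"
        by (intro mult_left_mono powr_mono) (auto simp: d_def)
      finally have s2: "(real n - real t) powr (- 3 / 2) \<le> d * (real t + 2)\<^sup>2" by (simp add: powr_numeral)
      have "killed (n - 1 - t) 1 j \<le> real j * excursion (n - 1 - t)"
        using abs_killed_le[of "n - 1 - t" 1 j] by simp
      also have "\<dots> \<le> real j * (3 * (real n - real t) powr (- 3 / 2))"
        using excursion_le[of "n - 1 - t"] unfolding s by (intro mult_left_mono) auto
      also have "\<dots> \<le> real j * (3 * (d * (real t + 2)\<^sup>2))"
        by (intro mult_left_mono s2) auto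
      finally have "r ^ t * killed (n - 1 - t) 1 j \<le> r ^ t * (real j * (3 * (d * (real t + 2)\<^sup>2)))"
        using r by (intro mult_left_mono) auto
      then show "r ^ t * killed (n - 1 - t) 1 j \<le> (r ^ t * (real t + 2)\<^sup>2) * (real j * (3 * d))"
        by (simp add: mult_ac)
    qed
    also have "\<dots> \<le> K * (real j * (3 * d))"
      unfolding sum_distrib_right[symmetric] by (intro mult_right_mono K) (auto simp: d_def)
    finally have 2: "(\<Sum>t<n. r ^ t * killed (n - 1 - t) 1 j) \<le> K * (real j * (3 * d))" .
    show ?thesis
      using 1 2 influence_eq_killed[OF j order_refl, of r n] by (simp add: d_def algebra_simps)
  qed
  show thesis
  proof (rule that)
    show "3 * K + 3 * K / 2 + 1 > 0" using \<open>K \<ge> 0\<close> by simp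
    fix n j :: nat assume "j \<ge> 1"
    from main[OF this, of n] show "influence r n j \<le> (3 * K + 3 * K / 2 + 1) * real j * (real n + 1) powr (- 3 / 2)"
      by (rule order_trans) (intro mult_right_mono, auto)
  qed
qed

text \<open>Summation by parts for the symmetric walk; the boundary at 0 is the only source of loss, because all
values are nonnegative and the summation range may grow.\<close>

lemma influence_shift:
  assumes "r \<ge> 0"
  shows "(\<Sum>j<N. influence r (Suc m) (Suc j) * influence r l (Suc j))
    \<le> (\<Sum>j<Suc N. influence r m (Suc j) * influence r (Suc l) (Suc j)) + r ^ m * influence r l 1 / 2"
proof -
  let ?V = "influence r"
  have V: "?V m j \<ge> 0" for m j using assms by (rule influence_nonneg)
  have A: "(\<Sum>j<N. ?V m j * ?V l (Suc j)) \<le> r ^ m * ?V l 1 + (\<Sum>j<Suc N. ?V m (Suc j) * ?V l (Suc (Suc j)))"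
  proof -
    have "(\<Sum>j<N. ?V m j * ?V l (Suc j)) \<le> (\<Sum>j<Suc (Suc N). ?V m j * ?V l (Suc j))"
      using V by (intro sum_mono2) auto
    then show ?thesis by (simp add: sum.lessThan_Suc_shift del: sum.lessThan_Suc)
  qed
  have B: "(\<Sum>j<N. ?V m (Suc (Suc j)) * ?V l (Suc j)) \<le> (\<Sum>j<Suc N. ?V m (Suc j) * ?V l j)"
    using V[of m "Suc 0"] V[of l 0]
    by (subst sum.lessThan_Suc_shift) (simp add: mult_nonneg_nonneg del: influence_0)
  have "(\<Sum>j<N. ?V (Suc m) (Suc j) * ?V l (Suc j)) =
     ((\<Sum>j<N. ?V m j * ?V l (Suc j)) + (\<Sum>j<N. ?V m (Suc (Suc j)) * ?V l (Suc j))) / 2"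
    by (simp add: sum.distrib[symmetric] sum_divide_distrib algebra_simps add_divide_distrib)
  also have "\<dots> \<le> (r ^ m * ?V l 1 + (\<Sum>j<Suc N. ?V m (Suc j) * ?V l (Suc (Suc j))) + (\<Sum>j<Suc N. ?V m (Suc j) * ?V l j)) / 2"
    using A B by (intro divide_right_mono) auto
  also have "\<dots> = (\<Sum>j<Suc N. ?V m (Suc j) * ?V (Suc l) (Suc j)) + r ^ m * ?V l 1 / 2"
    by (simp add: sum.distrib[symmetric] sum_divide_distrib algebra_simps add_divide_distrib del: sum.lessThan_Suc)
  finally show ?thesis .
qed

text \<open>All steps are moved to the second factor, where the first is left with its initial values \<open>r\<^sup>j\<close>. The
boundary terms have second arguments at least \<open>l\<close>, which is why \<open>m \<le> l\<close> is needed: then \<open>l\<close> is comparable to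
\<open>m + l\<close>.\<close>

lemma influence_pairing_le:
  assumes r: "0 < r" "r < 1"
  obtains C where "C > 0"
    "\<And>N m l. m \<le> l \<Longrightarrow> (\<Sum>j<N. influence r m (Suc j) * influence r l (Suc j))
       \<le> C * (real (m + l) + 1) powr (- 3 / 2)"
proof -
  obtain C where C: "C > 0" "\<And>n j. j \<ge> 1 \<Longrightarrow> influence r n j \<le> C * real j * (real n + 1) powr (- 3 / 2)"
    using influence_le[of r] r by auto
  have unroll: "(\<Sum>j<N. influence r m (Suc j) * influence r l (Suc j)) \<le>
     (\<Sum>j<N+m. influence r 0 (Suc j) * influence r (m + l) (Suc j)) + (\<Sum>t<m. r ^ t) * (C * (real l + 1) powr (- 3 / 2)) / 2"
    for N m l
  proof (induction m arbitrary: N l)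
    case 0 then show ?case by simp
  next
    case (Suc m)
    define X where "X = C * (real l + 1) powr (- 3 / 2)"
    have "(real (Suc l) + 1) powr (- 3 / 2) \<le> (real l + 1) powr (- 3 / 2)"
      by (intro powr_mono2') auto
    then have "C * (real (Suc l) + 1) powr (- 3 / 2) \<le> X"
      using C unfolding X_def by (intro mult_left_mono) auto
    then have h1: "(\<Sum>t<m. r ^ t) * (C * (real (Suc l) + 1) powr (- 3 / 2)) / 2 \<le> (\<Sum>t<m. r ^ t) * X / 2"
      using r by (intro divide_right_mono mult_left_mono sum_nonneg) auto
    have h2: "r ^ m * influence r l 1 / 2 \<le> r ^ m * X / 2"
      using C(2)[of 1 l] r by (intro divide_right_mono mult_left_mono) (auto simp: X_def)
    have h3: "(\<Sum>t<Suc m. r ^ t) * X / 2 = (\<Sum>t<m. r ^ t) * X / 2 + r ^ m * X / 2"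
      by (simp add: algebra_simps add_divide_distrib)
    have h4: "(\<Sum>j<Suc N. influence r m (Suc j) * influence r (Suc l) (Suc j)) \<le>
     (\<Sum>j<N + Suc m. influence r 0 (Suc j) * influence r (Suc m + l) (Suc j)) +
       (\<Sum>t<m. r ^ t) * (C * (real (Suc l) + 1) powr (- 3 / 2)) / 2"
      using Suc.IH[of "Suc l" "Suc N"] by (simp only: add_Suc add_Suc_right)
    show ?case
      using influence_shift[OF less_imp_le[OF r(1)], where N=N and m=m and l=l] h1 h2 h4 unfolding h3 X_def[symmetric] by linarith
  qed
  define K where "K = (\<Sum>t. r ^ t * (real t + 2)\<^sup>2)"
  have K: "(\<Sum>t\<in>A. r ^ t * (real t + 2)\<^sup>2) \<le> K" if "finite A" for A
    unfolding K_def using that r by (intro sum_le_suminf summable_square_geometric) auto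
  have "K \<ge> 0" using K[of "{}"] by simp
  show thesis
  proof (rule that)
    show "K * C + K * (C * 3) > 0" using K[of "{0}"] C by (intro add_pos_pos mult_pos_pos) auto
    fix N m l :: nat assume ml: "m \<le> l"
    define d where "d = (real (m + l) + 1) powr (- 3 / 2)"
    have "(\<Sum>j<N+m. influence r 0 (Suc j) * influence r (m + l) (Suc j)) \<le> (\<Sum>j<N+m. (r ^ j * (real j + 2)\<^sup>2) * (C * d))"
    proof (rule sum_mono)
      fix j
      have "influence r 0 (Suc j) * influence r (m + l) (Suc j) \<le> r ^ j * ((real j + 2)\<^sup>2 * (C * d))"
      proof (rule mult_mono)
        show "influence r 0 (Suc j) \<le> r ^ j" using r by (simp add: mult_left_le_one_le)
        have "influence r (m + l) (Suc j) \<le> real (Suc j) * (C * d)" using C(2)[of "Suc j" "m + l"] by (simp add: d_def mult_ac)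
        also have "\<dots> \<le> (real j + 2)\<^sup>2 * (C * d)"
          using C by (intro mult_right_mono) (auto simp: power2_eq_square algebra_simps d_def)
        finally show "influence r (m + l) (Suc j) \<le> (real j + 2)\<^sup>2 * (C * d)" .
      qed (use r influence_nonneg in auto)
      then show "influence r 0 (Suc j) * influence r (m + l) (Suc j) \<le> (r ^ j * (real j + 2)\<^sup>2) * (C * d)"
        by (simp add: mult.assoc)
    qed
    also have "\<dots> \<le> K * (C * d)"
      unfolding sum_distrib_right[symmetric] using C by (intro mult_right_mono K) (auto simp: d_def)
    finally have 1: "(\<Sum>j<N+m. influence r 0 (Suc j) * influence r (m + l) (Suc j)) \<le> K * (C * d)" .
    have "(\<Sum>t<m. r ^ t) \<le> (\<Sum>t<m. r ^ t * (real t + 2)\<^sup>2)"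
    proof (rule sum_mono)
      fix t
      have "1 \<le> (real t + 2)\<^sup>2" by (simp add: power2_eq_square algebra_simps)
      then show "r ^ t \<le> r ^ t * (real t + 2)\<^sup>2" using r by (simp add: mult_le_cancel_left1)
    qed
    also have "\<dots> \<le> K" by (rule K) simp
    finally have "(\<Sum>t<m. r ^ t) * (C * (real l + 1) powr (- 3 / 2)) \<le> K * (C * (3 * d))"
      unfolding d_def using C ml \<open>K \<ge> 0\<close> by (intro mult_mono powr_half_le) auto
    then have 2: "(\<Sum>t<m. r ^ t) * (C * (real l + 1) powr (- 3 / 2)) / 2 \<le> K * (C * (3 * d))"
      using C r by (smt (verit) field_sum_of_halves mult_nonneg_nonneg powr_ge_zero sum_nonneg zero_le_power)
    show "(\<Sum>j<N. influence r m (Suc j) * influence r l (Suc j)) \<le> (K * C + K * (C * 3)) * (real (m + l) + 1) powr (- 3 / 2)"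
      using unroll[where N=N and m=m and l=l] 1 2 unfolding d_def[symmetric] by (simp add: algebra_simps)
  qed
qed


section \<open>Hoelder functions on the cube\<close>

lemma cube_subset: "cube \<subseteq> unit_cube"
  by (auto simp: cube_def unit_cube_def)

lemma unit_cube_eq_cbox: "unit_cube = cbox (0, 0, 0) (1, 1, 1)"
  by (auto simp: unit_cube_def cbox_Pair_eq)

lemma unit_cube_borel [measurable]: "unit_cube \<in> sets borel"
  by (simp add: unit_cube_eq_cbox)

lemma AE_unit_cube_iff_cube: "AE p in lborel. p \<in> unit_cube \<longleftrightarrow> p \<in> cube"
proof -
  have "box (0, 0, 0) (1, 1, 1) \<subseteq> cube"
    by (auto simp: cube_def mem_box Basis_prod_def)
  then have "unit_cube - cube \<subseteq> cbox (0, 0, 0) (1, 1, 1) - box (0, 0, 0) (1, 1, 1)"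
    unfolding unit_cube_eq_cbox by blast
  then have "negligible (unit_cube - cube)"
    using negligible_frontier_interval negligible_subset by blast
  then have "unit_cube - cube \<in> null_sets lborel"
    by (simp add: negligible_iff_null_sets null_sets_completion_iff)
  then have "AE p in lborel. p \<notin> unit_cube - cube" by (rule AE_not_in)
  then show ?thesis using cube_subset by (auto elim!: AE_mp)
qed

lemma integral_unit_cube:
  assumes h': "bounded_borel h'" and eq: "\<And>p. p \<in> cube \<Longrightarrow> h p = h' p"
  shows "(LINT p|lebesgue_on unit_cube. h p) = (\<integral>p. h' p \<partial>unif3)"
proof -
  have [measurable]: "h' \<in> borel_measurable borel" using h' by (simp add: bounded_borel_def)
  have b: "(\<lambda>p. indicator cube p * h' p) \<in> borel_measurable lborel" by measurable
  have ae: "AE p in lebesgue. indicator cube p * h' p = indicator unit_cube p * h p"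
    using AE_completion[OF AE_unit_cube_iff_cube] by (rule AE_mp) (auto simp: indicator_def eq)
  have m: "(\<lambda>p. indicator cube p * h' p) \<in> borel_measurable lebesgue"
    using b by (rule measurable_completion)
  have "(LINT p|lebesgue_on unit_cube. h p) = (LINT p|lebesgue. indicator unit_cube p * h p)"
    by (subst integral_restrict_space) auto
  also have "\<dots> = (LINT p|lebesgue. indicator cube p * h' p)"
    using ae by (intro integral_cong_AE m borel_measurable_AE[OF m]) (auto elim: AE_mp)
  also have "\<dots> = (LINT p|lborel. indicator cube p * h' p)"
    by (rule integral_completion[OF b])
  also have "\<dots> = (\<integral>p. h' p \<partial>unif3)" by (rule integral_unif3[symmetric]) measurable
  finally show ?thesis .
qed

text \<open>Observables are constrained on the cube only; cutting them off yields functions that are Borel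
measurable and bounded everywhere.\<close>

definition on_cube :: "(real \<times> real \<times> real \<Rightarrow> real) \<Rightarrow> real \<times> real \<times> real \<Rightarrow> real" where
  "on_cube \<phi> p = indicator cube p * \<phi> p"

lemma holder_space_continuous:
  assumes "\<theta> > 0" "\<phi> \<in> holder_space \<theta> S" shows "continuous_on S \<phi>"
proof -
  obtain L where L: "\<forall>x\<in>S. \<forall>y\<in>S. \<bar>\<phi> x - \<phi> y\<bar> \<le> L * dist x y powr \<theta>"
    using assms(2) by (auto simp: holder_space_def)
  show ?thesis
    unfolding continuous_on_def
  proof
    fix x assume x: "x \<in> S"
    have "((\<lambda>y. L * dist y x powr \<theta>) \<longlongrightarrow> L * dist x x powr \<theta>) (at x within S)"
      by (intro tendsto_intros tendsto_powr') (use assms in auto)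
    then have lim: "((\<lambda>y. L * dist y x powr \<theta>) \<longlongrightarrow> 0) (at x within S)" using assms by simp
    have "((\<lambda>y. \<phi> y - \<phi> x) \<longlongrightarrow> 0) (at x within S)"
      by (rule Lim_null_comparison[OF _ lim]) (use L x in \<open>auto simp: eventually_at_filter\<close>)
    then show "(\<phi> \<longlongrightarrow> \<phi> x) (at x within S)" by (simp add: LIM_zero_iff)
  qed
qed

lemma holder_norm_bounds:
  assumes "\<theta> > 0" "\<phi> \<in> holder_space \<theta> unit_cube"
  shows "x \<in> unit_cube \<Longrightarrow> \<bar>\<phi> x\<bar> \<le> holder_norm \<theta> unit_cube \<phi>"
    and "x \<in> unit_cube \<Longrightarrow> y \<in> unit_cube \<Longrightarrow> \<bar>\<phi> x - \<phi> y\<bar> \<le> holder_norm \<theta> unit_cube \<phi> * dist x y powr \<theta>"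
proof -
  obtain L where L: "\<forall>x\<in>unit_cube. \<forall>y\<in>unit_cube. \<bar>\<phi> x - \<phi> y\<bar> \<le> L * dist x y powr \<theta>"
    using assms(2) by (auto simp: holder_space_def)
  have "compact ((\<lambda>x. \<bar>\<phi> x\<bar>) ` unit_cube)"
    using holder_space_continuous[OF assms]
    by (intro compact_continuous_image continuous_intros) (auto simp: unit_cube_eq_cbox)
  then have bdd1: "bdd_above ((\<lambda>x. \<bar>\<phi> x\<bar>) ` unit_cube)"
    by (intro bounded_imp_bdd_above compact_imp_bounded)
  have sup: "\<bar>\<phi> x\<bar> \<le> sup_norm unit_cube \<phi>" if "x \<in> unit_cube" for x
    unfolding sup_norm_def using bdd1 that by (rule cSUP_upper2) simp
  define Q where "Q = {(x, y). x \<in> unit_cube \<and> y \<in> unit_cube \<and> x \<noteq> y}"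
  define q where "q = (\<lambda>(x, y). \<bar>\<phi> x - \<phi> y\<bar> / dist x y powr \<theta>)"
  have "q z \<le> L" if z: "z \<in> Q" for z
  proof -
    obtain x y where xy: "z = (x, y)" "x \<in> unit_cube" "y \<in> unit_cube" "x \<noteq> y"
      using z unfolding Q_def by blast
    then have "0 < dist x y powr \<theta>" by simp
    then show ?thesis using L xy(2,3) by (simp add: xy(1) q_def pos_divide_le_eq)
  qed
  then have bdd2: "bdd_above (q ` Q)" by (intro bdd_aboveI2)
  have semi: "q z \<le> holder_seminorm \<theta> unit_cube \<phi>" if "z \<in> Q" for z
    unfolding holder_seminorm_def Q_def[symmetric] q_def[symmetric] using bdd2 that by (rule cSUP_upper[rotated])
  have corner: "(0, 0, 0) \<in> unit_cube" "((0, 0, 0), (1, 1, 1)) \<in> Q"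
    by (auto simp: unit_cube_def Q_def)
  have nn: "sup_norm unit_cube \<phi> \<ge> 0" using sup[OF corner(1)] by linarith
  have "q ((0, 0, 0), (1, 1, 1)) \<ge> 0" by (simp add: q_def)
  then have nn2: "holder_seminorm \<theta> unit_cube \<phi> \<ge> 0" using semi[OF corner(2)] by linarith
  show "\<bar>\<phi> x\<bar> \<le> holder_norm \<theta> unit_cube \<phi>" if "x \<in> unit_cube"
    using sup[OF that] nn2 by (simp add: holder_norm_def)
  show "\<bar>\<phi> x - \<phi> y\<bar> \<le> holder_norm \<theta> unit_cube \<phi> * dist x y powr \<theta>" if "x \<in> unit_cube" "y \<in> unit_cube"
  proof (cases "x = y")
    case False
    then have "q (x, y) \<le> holder_seminorm \<theta> unit_cube \<phi>" using that by (intro semi) (auto simp: Q_def)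
    then have "q (x, y) \<le> holder_norm \<theta> unit_cube \<phi>" using nn by (simp add: holder_norm_def)
    then show ?thesis using False by (simp add: q_def pos_divide_le_eq)
  qed simp
qed

lemma bounded_borel_on_cube:
  assumes "\<theta> > 0" "\<phi> \<in> holder_space \<theta> unit_cube" shows "bounded_borel (on_cube \<phi>)"
proof -
  have "(\<lambda>p. indicator unit_cube p *\<^sub>R \<phi> p) \<in> borel_measurable borel"
    using holder_space_continuous[OF assms] by (intro borel_measurable_continuous_on_indicator) auto
  then have "(\<lambda>p. indicator cube p * (indicator unit_cube p *\<^sub>R \<phi> p)) \<in> borel_measurable borel"
    by measurable
  moreover have "(\<lambda>p. indicator cube p * (indicator unit_cube p *\<^sub>R \<phi> p)) = on_cube \<phi>"
    using cube_subset by (auto simp: on_cube_def indicator_def fun_eq_iff)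
  moreover have "\<bar>on_cube \<phi> p\<bar> \<le> \<bar>holder_norm \<theta> unit_cube \<phi>\<bar>" for p
    using holder_norm_bounds(1)[OF assms, of p] cube_subset by (auto simp: on_cube_def indicator_def)
  ultimately show ?thesis by (auto simp: bounded_borel_def)
qed

lemma Cor_baker3_eq:
  assumes M: "M > 0" and "\<theta> > 0" "\<phi> \<in> holder_space \<theta> unit_cube" "\<psi> \<in> holder_space \<theta> unit_cube"
  shows "Cor \<phi> (\<psi> \<circ> (baker3 M (1 / (2 * real M)) (1 / (2 * real M)) ^^ n)) =
    \<bar>(\<integral>p. on_cube \<phi> p * on_cube \<psi> ((fwd M ^^ n) p) \<partial>unif3)
      - (\<integral>p. on_cube \<phi> p \<partial>unif3) * (\<integral>p. on_cube \<psi> p \<partial>unif3)\<bar>"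
proof -
  have b: "bounded_borel (on_cube \<phi>)" "bounded_borel (on_cube \<psi>)" using assms by (auto intro: bounded_borel_on_cube)
  have b2: "bounded_borel (\<lambda>p. on_cube \<psi> ((fwd M ^^ n) p))" by (rule bounded_borel_compose[OF b(2)]) measurable
  have eq: "(\<psi> \<circ> (baker3 M (1 / (2 * real M)) (1 / (2 * real M)) ^^ n)) p = on_cube \<psi> ((fwd M ^^ n) p)"
    if "p \<in> cube" for p
    using that fwd_iter_cube[OF M that] by (simp add: baker3_iter_eq_fwd[OF M] on_cube_def)
  have 1: "(LINT p|lebesgue_on unit_cube. \<phi> p * (\<psi> \<circ> (baker3 M (1 / (2 * real M)) (1 / (2 * real M)) ^^ n)) p)
      = (\<integral>p. on_cube \<phi> p * on_cube \<psi> ((fwd M ^^ n) p) \<partial>unif3)"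
    by (rule integral_unit_cube[OF bounded_borel_mult[OF b(1) b2]]) (simp only: eq, simp add: on_cube_def)
  have 2: "(LINT p|lebesgue_on unit_cube. \<phi> p) = (\<integral>p. on_cube \<phi> p \<partial>unif3)"
    by (rule integral_unit_cube[OF b(1)]) (simp add: on_cube_def)
  have 3: "(LINT p|lebesgue_on unit_cube. (\<psi> \<circ> (baker3 M (1 / (2 * real M)) (1 / (2 * real M)) ^^ n)) p)
      = (\<integral>p. on_cube \<psi> p \<partial>unif3)"
    using integral_unit_cube[OF b2 eq] integral_fwd_iter_invariant[OF b(2) M] by simp
  show ?thesis unfolding Cor_def 1 2 3 ..
qed


section \<open>Decay of correlations\<close>

lemma bwd_iter_contracts:
  assumes M: "M > 0"
  shows "\<exists>v v' c' s'. (bwd M ^^ m) (u, c, s) = (v, c', s') \<and> (bwd M ^^ m) (u', c, s) = (v', c', s')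
           \<and> \<bar>v - v'\<bar> \<le> (1/2) ^ m * \<bar>u - u'\<bar>"
proof (induction m)
  case (Suc m)
  then obtain v v' c' s' where IH: "(bwd M ^^ m) (u, c, s) = (v, c', s')" "(bwd M ^^ m) (u', c, s) = (v', c', s')"
    "\<bar>v - v'\<bar> \<le> (1/2) ^ m * \<bar>u - u'\<bar>" by blast
  have eq: "(v + digit M c') / (2 * real M) - (v' + digit M c') / (2 * real M) = (v - v') / (2 * real M)"
    by (simp add: diff_divide_distrib[symmetric])
  have "\<bar>v - v'\<bar> / (2 * real M) \<le> \<bar>v - v'\<bar> / (2 * 1)" using M by (intro divide_left_mono) auto
  then have 1: "\<bar>(v + digit M c') / (2 * real M) - (v' + digit M c') / (2 * real M)\<bar> \<le> (1/2) ^ Suc m * \<bar>u - u'\<bar>"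
    unfolding eq using IH(3) by (simp add: abs_divide)
  have "1 / 2 + v / 2 - (1 / 2 + v' / 2) = (v - v') / 2" by (simp add: diff_divide_distrib)
  then have 2: "\<bar>1 / 2 + v / 2 - (1 / 2 + v' / 2)\<bar> \<le> (1/2) ^ Suc m * \<bar>u - u'\<bar>"
    using IH(3) by (simp only: abs_divide) simp
  show ?case
  proof (cases "s' < 1/2")
    case True
    show ?thesis
      using 1 True unfolding funpow.simps o_apply IH(1,2) by (simp add: bwd_def)
  next
    case False
    show ?thesis
      using 2 False unfolding funpow.simps o_apply IH(1,2) by (simp add: bwd_def)
  qed
qed simp

lemma fwd_iter_contracts:
  assumes M: "M > 0"
  shows "\<exists>v c' t t'. (fwd M ^^ m) (u, c, s) = (v, c', t) \<and> (fwd M ^^ m) (u, c, s') = (v, c', t')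
           \<and> \<bar>t - t'\<bar> \<le> (1/2) ^ m * \<bar>s - s'\<bar>"
proof (induction m)
  case (Suc m)
  then obtain v c' t t' where IH: "(fwd M ^^ m) (u, c, s) = (v, c', t)" "(fwd M ^^ m) (u, c, s') = (v, c', t')"
    "\<bar>t - t'\<bar> \<le> (1/2) ^ m * \<bar>s - s'\<bar>" by blast
  have eq: "1/2 + (t + digit M c') / (2 * real M) - (1/2 + (t' + digit M c') / (2 * real M)) = (t - t') / (2 * real M)"
    by (simp add: diff_divide_distrib[symmetric])
  have "\<bar>t - t'\<bar> / (2 * real M) \<le> \<bar>t - t'\<bar> / (2 * 1)" using M by (intro divide_left_mono) auto
  then have 1: "\<bar>1/2 + (t + digit M c') / (2 * real M) - (1/2 + (t' + digit M c') / (2 * real M))\<bar> \<le> (1/2) ^ Suc m * \<bar>s - s'\<bar>"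
    unfolding eq using IH(3) by (simp add: abs_divide)
  have "t / 2 - t' / 2 = (t - t') / 2" by (simp add: diff_divide_distrib)
  then have 2: "\<bar>t / 2 - t' / 2\<bar> \<le> (1/2) ^ Suc m * \<bar>s - s'\<bar>"
    using IH(3) by (simp only: abs_divide) simp
  show ?case
  proof (cases "v < 1/2")
    case True
    then have "fwd M (v, c', x) = (frac (2 * real M * v), (c' + digit (2 * M) v) / real M, x / 2)" for x
      by (simp add: fwd_def)
    then show ?thesis
      using 2 unfolding funpow.simps o_apply IH(1,2) by blast
  next
    case False
    show ?thesis
      using 1 False unfolding funpow.simps o_apply IH(1,2) by (simp add: fwd_def)
  qed
qed simp

definition cube_holder :: "real \<Rightarrow> real \<Rightarrow> (real \<times> real \<times> real \<Rightarrow> real) \<Rightarrow> bool" where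
  "cube_holder \<theta> A F \<longleftrightarrow> bounded_borel F \<and> (\<forall>p\<in>cube. \<bar>F p\<bar> \<le> A) \<and>
     (\<forall>p\<in>cube. \<forall>q\<in>cube. \<bar>F p - F q\<bar> \<le> A * dist p q powr \<theta>)"

lemma cube_holder_nonneg:
  assumes "cube_holder \<theta> A F" shows "A \<ge> 0"
proof -
  have "(0, 0, 0) \<in> cube" by (simp add: cube_def)
  then have "\<bar>F (0, 0, 0)\<bar> \<le> A" using assms unfolding cube_holder_def by blast
  then show ?thesis by linarith
qed

lemma powr_half_power: "((1/2) ^ m :: real) powr \<theta> = ((1/2) powr \<theta>) ^ m"
proof -
  have "((1/2) ^ m :: real) powr \<theta> = ((1/2) powr real m) powr \<theta>"
    by (simp only: powr_realpow[of "1/2" m, simplified])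
  also have "\<dots> = ((1/2) powr \<theta>) powr real m"
    by (simp only: powr_powr mult.commute)
  also have "\<dots> = ((1/2) powr \<theta>) ^ m"
    by (rule powr_realpow) simp
  finally show ?thesis .
qed

lemma dist_triple [simp]:
  "dist (u, c, s) (u', c, s) = \<bar>u - u'\<bar>" "dist (u, c, s) (u, c', s) = \<bar>c - c'\<bar>" "dist (u, c, s) (u, c, s') = \<bar>s - s'\<bar>"
  for u u' c c' s s' :: real
  by (simp_all add: dist_Pair_Pair dist_real_def)

lemma hoelder_section:
  assumes F: "cube_holder \<theta> A F" and "0 < \<theta>"
  shows "hoelder_le \<theta> (\<lambda>u c. \<integral>s. F (u, c, s) \<partial>unif) A"
    and "hoelder_le \<theta> (\<lambda>s c. \<integral>u. F (u, c, s) \<partial>unif) A"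
    and "R = (\<lambda>u c. \<integral>s. F (u, c, s) \<partial>unif) \<or> R = (\<lambda>s c. \<integral>u. F (u, c, s) \<partial>unif) \<Longrightarrow>
        y \<in> {0..<1} \<Longrightarrow> c \<in> {0..<1} \<Longrightarrow> c' \<in> {0..<1} \<Longrightarrow> \<bar>R y c - R y c'\<bar> \<le> A * \<bar>c - c'\<bar> powr \<theta>"
proof -
  have bF: "bounded_borel F" using F by (simp add: cube_holder_def)
  have H: "\<bar>F p - F q\<bar> \<le> A * dist p q powr \<theta>" if "p \<in> cube" "q \<in> cube" for p q
    using F that by (auto simp: cube_holder_def)
  have bs: "bounded_borel (\<lambda>s. F (u, c, s))" for u c by (rule bounded_borel_compose[OF bF]) measurable
  have bu: "bounded_borel (\<lambda>u. F (u, c, s))" for c s by (rule bounded_borel_compose[OF bF]) measurable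
  have S: "\<bar>(\<integral>s. F (u, c, s) \<partial>unif) - (\<integral>s. F (u', c', s) \<partial>unif)\<bar> \<le> B"
    if "\<And>s. s \<in> {0..<1} \<Longrightarrow> \<bar>F (u, c, s) - F (u', c', s)\<bar> \<le> B" for u u' c c' B
  proof -
    have "(\<integral>s. F (u, c, s) \<partial>unif) - (\<integral>s. F (u', c', s) \<partial>unif) = (\<integral>s. F (u, c, s) - F (u', c', s) \<partial>unif)"
      using integrable_unif[OF bs] by simp
    also have "\<bar>\<dots>\<bar> \<le> B" by (intro abs_integral_unif_le bounded_borel_diff bs that)
    finally show ?thesis .
  qed
  have T: "\<bar>(\<integral>u. F (u, c, s) \<partial>unif) - (\<integral>u. F (u, c', s') \<partial>unif)\<bar> \<le> B"
    if "\<And>u. u \<in> {0..<1} \<Longrightarrow> \<bar>F (u, c, s) - F (u, c', s')\<bar> \<le> B" for s s' c c' B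
  proof -
    have "(\<integral>u. F (u, c, s) \<partial>unif) - (\<integral>u. F (u, c', s') \<partial>unif) = (\<integral>u. F (u, c, s) - F (u, c', s') \<partial>unif)"
      using integrable_unif[OF bu] by simp
    also have "\<bar>\<dots>\<bar> \<le> B" by (intro abs_integral_unif_le bounded_borel_diff bu that)
    finally show ?thesis .
  qed
  show "hoelder_le \<theta> (\<lambda>u c. \<integral>s. F (u, c, s) \<partial>unif) A"
    unfolding hoelder_le_def
  proof safe
    fix c u u' :: real assume "c \<in> {0..<1}" "u \<in> {0..<1}" "u' \<in> {0..<1}"
    then show "\<bar>(\<integral>s. F (u, c, s) \<partial>unif) - (\<integral>s. F (u', c, s) \<partial>unif)\<bar> \<le> A * \<bar>u - u'\<bar> powr \<theta>"
      using H[of "(u, c, s)" "(u', c, s)" for s] by (intro S) (auto simp: cube_def)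
  qed
  show "hoelder_le \<theta> (\<lambda>s c. \<integral>u. F (u, c, s) \<partial>unif) A"
    unfolding hoelder_le_def
  proof safe
    fix c s s' :: real assume "c \<in> {0..<1}" "s \<in> {0..<1}" "s' \<in> {0..<1}"
    then show "\<bar>(\<integral>u. F (u, c, s) \<partial>unif) - (\<integral>u. F (u, c, s') \<partial>unif)\<bar> \<le> A * \<bar>s - s'\<bar> powr \<theta>"
      using H[of "(u, c, s)" "(u, c, s')" for u] by (intro T) (auto simp: cube_def)
  qed
  assume R: "R = (\<lambda>u c. \<integral>s. F (u, c, s) \<partial>unif) \<or> R = (\<lambda>s c. \<integral>u. F (u, c, s) \<partial>unif)"
    and y: "y \<in> {0..<1}" "c \<in> {0..<1}" "c' \<in> {0..<1}"
  from R show "\<bar>R y c - R y c'\<bar> \<le> A * \<bar>c - c'\<bar> powr \<theta>"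
  proof
    assume R: "R = (\<lambda>u c. \<integral>s. F (u, c, s) \<partial>unif)"
    show ?thesis unfolding R
      using H[of "(y, c, s)" "(y, c', s)" for s] y by (intro S) (auto simp: cube_def)
  next
    assume R: "R = (\<lambda>s c. \<integral>u. F (u, c, s) \<partial>unif)"
    show ?thesis unfolding R
      using H[of "(u, c, y)" "(u, c', y)" for u] y by (intro T) (auto simp: cube_def)
  qed
qed

text \<open>A digit at depth \<open>j + 1\<close> changes \<open>x\<^sub>c\<close> by at most \<open>(1 / M) ^ j\<close>; the factor 2 pays for the shift of the exponent
from \<open>j\<close> to \<open>j + 1\<close>, as \<open>r \<ge> 1/2\<close>.\<close>

lemma section_osc:
  assumes F: "cube_holder \<theta> A F" and \<theta>: "0 < \<theta>" "\<theta> \<le> 1" and M: "M \<ge> 2" and r: "r = (1/2) powr \<theta>"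
    and R: "R = (\<lambda>u c. \<integral>s. F (u, c, s) \<partial>unif) \<or> R = (\<lambda>s c. \<integral>u. F (u, c, s) \<partial>unif)"
  shows "hoelder_le \<theta> R (2 * A)" "osc_le R (same_cell M N) (2 * A * r ^ N)" "osc_le R (differ M j) (2 * A * r ^ Suc j)"
proof -
  have A: "A \<ge> 0" by (rule cube_holder_nonneg[OF F])
  have M0: "M > 0" using M by simp
  have "hoelder_le \<theta> R A" using R hoelder_section(1,2)[OF F \<theta>(1)] by auto
  moreover have "A * \<bar>y - y'\<bar> powr \<theta> \<le> 2 * A * \<bar>y - y'\<bar> powr \<theta>" for y y'
    using A by (intro mult_right_mono) auto
  ultimately show "hoelder_le \<theta> R (2 * A)" unfolding hoelder_le_def
    by (meson order_trans)
  have osc: "\<bar>R y c - R y c'\<bar> \<le> A * r ^ N" if "same_cell M N c c'" "y \<in> {0..<1}" for y c c' N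
  proof -
    have "\<bar>R y c - R y c'\<bar> \<le> A * \<bar>c - c'\<bar> powr \<theta>"
      using hoelder_section(3)[OF F \<theta>(1) R that(2)] same_cell_unit[OF M0 that(1)] by blast
    also have "\<bar>c - c'\<bar> \<le> (1/2) ^ N"
    proof -
      have "\<bar>c - c'\<bar> \<le> (1 / real M) ^ N" by (rule same_cell_dist[OF M0 that(1)])
      also have "\<dots> \<le> (1/2) ^ N" using M by (intro power_mono divide_left_mono) auto
      finally show ?thesis .
    qed
    then have "A * \<bar>c - c'\<bar> powr \<theta> \<le> A * ((1/2) ^ N) powr \<theta>"
      using A \<theta> by (intro mult_left_mono powr_mono2) auto
    also have "\<dots> = A * r ^ N" by (simp only: powr_half_power r)
    finally show ?thesis .
  qed
  have r0: "r \<ge> 0" by (simp add: r)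
  then have AN: "A * r ^ N \<le> 2 * A * r ^ N" for N using A by (intro mult_right_mono) auto
  show "osc_le R (same_cell M N) (2 * A * r ^ N)"
    unfolding osc_le_def using osc AN order_trans by blast
  have "(1/2) powr 1 \<le> ((1/2) powr \<theta> :: real)" using \<theta> by (intro powr_mono') auto
  then have "1 \<le> 2 * r" by (simp add: r)
  then have "(A * r ^ j) * 1 \<le> (A * r ^ j) * (2 * r)" using A r0 by (intro mult_left_mono) auto
  then have Aj: "A * r ^ j \<le> 2 * A * r ^ Suc j" by (simp add: mult_ac)
  have "differ M j c c' \<Longrightarrow> same_cell M j c c'" for c c'
    using differ_same_cell[OF M0, of j] unfolding le_fun_def le_bool_def by blast
  then show "osc_le R (differ M j) (2 * A * r ^ Suc j)"
    unfolding osc_le_def using osc Aj order_trans by blast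
qed

lemma integral_bwd_iter:
  assumes F: "bounded_borel F" and M: "M > 0"
  shows "(\<lambda>u c. \<integral>s. F ((bwd M ^^ m) (u, c, s)) \<partial>unif) =
    (averaged_step M 0 (1/2) ^^ m) (\<lambda>u c. \<integral>s. F (u, c, s) \<partial>unif)"
proof (induction m)
  case (Suc m)
  have "(\<lambda>u c. \<integral>s. F ((bwd M ^^ Suc m) (u, c, s)) \<partial>unif) =
        (\<lambda>u c. \<integral>s. F ((bwd M ^^ m) (bwd M (u, c, s))) \<partial>unif)"
    by (simp add: funpow_swap1)
  also have "\<dots> = averaged_step M 0 (1/2) (\<lambda>u c. \<integral>s. F ((bwd M ^^ m) (u, c, s)) \<partial>unif)"
    by (intro ext integral_bwd[OF bounded_borel_compose[OF F bwd_iter_measurable] M])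
  finally show ?case using Suc by simp
qed simp

lemma integral_fwd_iter:
  assumes F: "bounded_borel F" and M: "M > 0"
  shows "(\<lambda>s c. \<integral>u. F ((fwd M ^^ m) (u, c, s)) \<partial>unif) =
    (averaged_step M (1/2) 0 ^^ m) (\<lambda>s c. \<integral>u. F (u, c, s) \<partial>unif)"
proof (induction m)
  case (Suc m)
  have "(\<lambda>s c. \<integral>u. F ((fwd M ^^ Suc m) (u, c, s)) \<partial>unif) =
        (\<lambda>s c. \<integral>u. F ((fwd M ^^ m) (fwd M (u, c, s))) \<partial>unif)"
    by (simp add: funpow_swap1)
  also have "\<dots> = averaged_step M (1/2) 0 (\<lambda>s c. \<integral>u. F ((fwd M ^^ m) (u, c, s)) \<partial>unif)"
    by (intro ext integral_fwd[OF bounded_borel_compose[OF F fwd_iter_measurable] M])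
  finally show ?case using Suc by simp
qed simp

lemma integral_unif3_cong:
  assumes "bounded_borel F" "bounded_borel G" and "\<And>p. p \<in> cube \<Longrightarrow> F p = G p"
  shows "(\<integral>p. F p \<partial>unif3) = (\<integral>p. G p \<partial>unif3)"
  using AE_unif3 assms by (intro integral_cong_AE) (auto simp: bounded_borel_def elim: AE_mp)

lemma abs_integral_unif3_le:
  assumes F: "bounded_borel F" and B: "\<And>p. p \<in> cube \<Longrightarrow> \<bar>F p\<bar> \<le> B"
  shows "\<bar>\<integral>p. F p \<partial>unif3\<bar> \<le> B"
proof -
  have "norm (\<integral>p. F p \<partial>unif3) \<le> (\<integral>p. norm (F p) \<partial>unif3)"
    by (rule integral_norm_bound)
  also have "\<dots> \<le> (\<integral>p. B \<partial>unif3)"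
    using AE_unif3 integrable_unif3[OF F] B
    by (intro integral_mono_AE integrable_norm) (auto elim: AE_mp)
  finally show ?thesis by simp
qed

lemma abs_product_diff_le:
  fixes x y :: real
  assumes "\<bar>x - x0\<bar> \<le> a" "\<bar>y\<bar> \<le> B" "\<bar>x0\<bar> \<le> A" "\<bar>y - y0\<bar> \<le> b"
  shows "\<bar>x * y - x0 * y0\<bar> \<le> a * B + A * b"
proof -
  have "x * y - x0 * y0 = (x - x0) * y + x0 * (y - y0)" by (simp add: algebra_simps)
  also have "\<bar>\<dots>\<bar> \<le> \<bar>x - x0\<bar> * \<bar>y\<bar> + \<bar>x0\<bar> * \<bar>y - y0\<bar>"
    by (rule order_trans[OF abs_triangle_ineq]) (simp add: abs_mult)
  also have "\<dots> \<le> a * B + A * b"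
    using assms by (intro add_mono mult_mono) auto
  finally show ?thesis .
qed

text \<open>Functions at the intermediate time \<open>m\<close>: \<open>F\<close> transported forward may be evaluated at \<open>u = 0\<close> and \<open>G\<close>
transported backward at \<open>s = 0\<close>, with exponentially small errors. The product of the two then depends on
\<open>s\<close> only through the first factor and on \<open>u\<close> only through the second, so its integral over \<open>u\<close> and \<open>s\<close>
factorises for each \<open>c\<close>.\<close>

lemma correlation_le:
  assumes M: "M \<ge> 2" and \<theta>: "0 < \<theta>" "\<theta> \<le> 1" and r: "r = (1/2) powr \<theta>"
    and F: "cube_holder \<theta> A F" and G: "cube_holder \<theta> B G"
    and S: "\<And>N. (\<Sum>j<N. influence r m (Suc j) * influence r l (Suc j)) \<le> S"
  shows "\<bar>(\<integral>p. F p * G ((fwd M ^^ (m + l)) p) \<partial>unif3) - (\<integral>p. F p \<partial>unif3) * (\<integral>p. G p \<partial>unif3)\<bar>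
    \<le> A * B * (2 * (r ^ m + r ^ l) + 4 * S)"
proof -
  have M0: "M > 0" using M by simp
  have A: "A \<ge> 0" and B: "B \<ge> 0" using cube_holder_nonneg F G by auto
  have "(1/2) powr \<theta> < (1::real) powr \<theta>" using \<theta> by (intro powr_less_mono2) auto
  then have r0: "0 < r" "r < 1" by (simp_all add: r)
  have bF: "bounded_borel F" and bG: "bounded_borel G" using F G by (auto simp: cube_holder_def)
  define X where "X p = F ((bwd M ^^ m) p)" for p
  define Y where "Y p = G ((fwd M ^^ l) p)" for p
  have bX: "bounded_borel X" unfolding X_def by (rule bounded_borel_compose[OF bF]) measurable
  have bY: "bounded_borel Y" unfolding Y_def by (rule bounded_borel_compose[OF bG]) measurable
  have absX: "\<bar>X p\<bar> \<le> A" and absY: "\<bar>Y p\<bar> \<le> B" if "p \<in> cube" for p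
    using F G bwd_iter_cube[OF M0 that] fwd_iter_cube[OF M0 that] by (auto simp: X_def Y_def cube_holder_def)
  have XF: "X ((fwd M ^^ m) p) = F p" if "p \<in> cube" for p
    by (simp add: X_def bwd_fwd_iter[OF M0 that])
  have YG: "G ((fwd M ^^ (m + l)) p) = Y ((fwd M ^^ m) p)" for p
    unfolding Y_def add.commute[of m l] funpow_add o_apply ..
  have bXF: "bounded_borel (\<lambda>p. X ((fwd M ^^ m) p))" by (rule bounded_borel_compose[OF bX]) measurable
  have intX: "(\<integral>p. X p \<partial>unif3) = (\<integral>p. F p \<partial>unif3)"
    using integral_fwd_iter_invariant[OF bX M0, of m] integral_unif3_cong[OF bXF bF XF] by simp
  have intY: "(\<integral>p. Y p \<partial>unif3) = (\<integral>p. G p \<partial>unif3)"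
    unfolding Y_def by (rule integral_fwd_iter_invariant[OF bG M0])
  have bGn: "bounded_borel (\<lambda>p. G ((fwd M ^^ (m + l)) p))" by (rule bounded_borel_compose[OF bG]) measurable
  have "(\<integral>p. F p * G ((fwd M ^^ (m + l)) p) \<partial>unif3) = (\<integral>p. X ((fwd M ^^ m) p) * Y ((fwd M ^^ m) p) \<partial>unif3)"
    by (intro integral_unif3_cong bounded_borel_mult bF bGn bXF bounded_borel_compose[OF bY fwd_iter_measurable])
       (simp_all only: XF YG)
  also have "\<dots> = (\<integral>p. X p * Y p \<partial>unif3)"
    by (rule integral_fwd_iter_invariant[OF bounded_borel_mult[OF bX bY] M0])
  finally have split: "(\<integral>p. F p * G ((fwd M ^^ (m + l)) p) \<partial>unif3) = (\<integral>p. X p * Y p \<partial>unif3)" .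
  define X0 where "X0 p = X (0, snd p)" for p :: "real \<times> real \<times> real"
  define Y0 where "Y0 p = Y (fst p, fst (snd p), 0)" for p :: "real \<times> real \<times> real"
  have bX0: "bounded_borel X0" unfolding X0_def
    by (rule bounded_borel_compose[OF bX]) (unfold borel_prod[symmetric], measurable)
  have bY0: "bounded_borel Y0" unfolding Y0_def
    by (rule bounded_borel_compose[OF bY]) (unfold borel_prod[symmetric], measurable)
  have dX: "\<bar>X p - X0 p\<bar> \<le> A * r ^ m" if p: "p \<in> cube" for p
  proof -
    obtain u c s where q: "p = (u, c, s)" by (cases p)
    then have q0: "(0, c, s) \<in> cube" "\<bar>u - 0\<bar> \<le> 1" using p by (auto simp: cube_def)
    obtain v v' c' s' where v: "(bwd M ^^ m) (u, c, s) = (v, c', s')" "(bwd M ^^ m) (0, c, s) = (v', c', s')"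
      "\<bar>v - v'\<bar> \<le> (1/2) ^ m * \<bar>u - 0\<bar>" using bwd_iter_contracts[OF M0] by blast
    have "(1/2) ^ m * \<bar>u - 0\<bar> \<le> (1/2) ^ m * 1" by (intro mult_left_mono q0(2)) simp
    then have v2: "\<bar>v - v'\<bar> \<le> (1/2) ^ m"
      using v(3) by linarith
    have "\<bar>X p - X0 p\<bar> \<le> A * dist (v, c', s') (v', c', s') powr \<theta>"
      using F bwd_iter_cube[OF M0 p, of m] bwd_iter_cube[OF M0 q0(1), of m]
      unfolding X_def X0_def q v(1) snd_conv v(2) cube_holder_def by blast
    also have "\<dots> \<le> A * ((1/2) ^ m) powr \<theta>"
      using v2 A \<theta> by (intro mult_left_mono powr_mono2) auto
    finally show ?thesis by (simp only: powr_half_power r)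
  qed
  have dY: "\<bar>Y p - Y0 p\<bar> \<le> B * r ^ l" if p: "p \<in> cube" for p
  proof -
    obtain u c s where q: "p = (u, c, s)" by (cases p)
    then have q0: "(u, c, 0) \<in> cube" "\<bar>s - 0\<bar> \<le> 1" using p by (auto simp: cube_def)
    obtain v c' t t' where v: "(fwd M ^^ l) (u, c, s) = (v, c', t)" "(fwd M ^^ l) (u, c, 0) = (v, c', t')"
      "\<bar>t - t'\<bar> \<le> (1/2) ^ l * \<bar>s - 0\<bar>" using fwd_iter_contracts[OF M0] by blast
    have "(1/2) ^ l * \<bar>s - 0\<bar> \<le> (1/2) ^ l * 1" by (intro mult_left_mono q0(2)) simp
    then have v2: "\<bar>t - t'\<bar> \<le> (1/2) ^ l"
      using v(3) by linarith
    have "\<bar>Y p - Y0 p\<bar> \<le> B * dist (v, c', t) (v, c', t') powr \<theta>"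
      using G fwd_iter_cube[OF M0 p, of l] fwd_iter_cube[OF M0 q0(1), of l]
      unfolding Y_def Y0_def q v(1) fst_conv snd_conv v(2) cube_holder_def by blast
    also have "\<dots> \<le> B * ((1/2) ^ l) powr \<theta>"
      using v2 B \<theta> by (intro mult_left_mono powr_mono2) auto
    finally show ?thesis by (simp only: powr_half_power r)
  qed
  have absX0: "\<bar>X0 p\<bar> \<le> A" if "p \<in> cube" for p
    using that absX[of "(0, snd p)"] by (auto simp: X0_def cube_def)
  define gm where "gm = (\<lambda>u c. \<integral>s. X (u, c, s) \<partial>unif)"
  define hl where "hl = (\<lambda>s c. \<integral>u. Y (u, c, s) \<partial>unif)"
  have gm: "gm = (averaged_step M 0 (1/2) ^^ m) (\<lambda>u c. \<integral>s. F (u, c, s) \<partial>unif)"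
    unfolding gm_def X_def by (rule integral_bwd_iter[OF bF M0])
  have hl: "hl = (averaged_step M (1/2) 0 ^^ l) (\<lambda>s c. \<integral>u. G (u, c, s) \<partial>unif)"
    unfolding hl_def Y_def by (rule integral_fwd_iter[OF bG M0])
  have half: "(0::real) \<in> {0, 1/2}" "(1/2::real) \<in> {0, 1/2}" by auto
  have A2: "2 * A \<ge> 0" and B2: "2 * B \<ge> 0" using A B by auto
  note oF = section_osc[OF F \<theta> M r disjI1[OF refl]]
  note oG = section_osc[OF G \<theta> M r disjI2[OF refl]]
  have og: "osc_le gm (differ M j) (2 * A * influence r m (Suc j))" for j
    unfolding gm using step_iter_influence(2)[OF M0 half \<theta>(1) A2 r oF(1,3)] .
  have oh: "osc_le hl (differ M j) (2 * B * influence r l (Suc j))" for j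
    unfolding hl using step_iter_influence(2)[OF M0 half(2,1) \<theta>(1) B2 r oG(1,3)] .
  define lam where "lam = ((r + 1 / r) / 2) ^ m"
  have oc: "osc_le gm (same_cell M N) (2 * A * lam * r ^ N)" if "N \<ge> m" for N
    unfolding gm lam_def using step_iter_same_cell[OF M0 half r0(1) oF(2) that] .
  have b1: "bounded_borel (gm 0)" unfolding gm_def
    by (rule bounded_borel_integral, rule bounded_borel_compose[OF bX]) (unfold borel_prod[symmetric], measurable)
  have b2: "bounded_borel (hl 0)" unfolding hl_def
    by (rule bounded_borel_integral, rule bounded_borel_compose[OF bY]) (unfold borel_prod[symmetric], measurable)
  have abshl: "\<bar>hl 0 c\<bar> \<le> B" if "c \<in> {0..<1}" for c
    unfolding hl_def using that
    by (intro abs_integral_unif_le bounded_borel_compose[OF bY] absY) (auto simp: cube_def)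
  have X0Y0: "(\<integral>p. X0 p * Y0 p \<partial>unif3) = (\<integral>c. gm 0 c * hl 0 c \<partial>unif)"
    unfolding integral_unif3_iterated[OF bounded_borel_mult[OF bX0 bY0]] by (simp add: X0_def Y0_def gm_def hl_def)
  have iX0: "(\<integral>p. X0 p \<partial>unif3) = (\<integral>c. gm 0 c \<partial>unif)"
    unfolding integral_unif3_iterated[OF bX0] by (simp add: X0_def gm_def)
  have iY0: "(\<integral>p. Y0 p \<partial>unif3) = (\<integral>c. hl 0 c \<partial>unif)"
    unfolding integral_unif3_iterated[OF bY0] by (simp add: Y0_def hl_def)
  have cov: "\<bar>(\<integral>p. X0 p * Y0 p \<partial>unif3) - (\<integral>p. X0 p \<partial>unif3) * (\<integral>p. Y0 p \<partial>unif3)\<bar>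
      \<le> 4 * (A * B * S) + (2 * A * lam * B) * r ^ N" if N: "N \<ge> m" for N
  proof -
    have "\<bar>(\<integral>c. gm 0 c * hl 0 c \<partial>unif) - (\<integral>c. gm 0 c \<partial>unif) * (\<integral>c. hl 0 c \<partial>unif)\<bar>
      \<le> (\<Sum>j<N. (2 * A * influence r m (Suc j)) * (2 * B * influence r l (Suc j))) + (2 * A * lam * r ^ N) * B"
      using og oh oc[OF N] abshl unfolding osc_le_def
      by (intro covariance_le[OF M0 b1 b2]) auto
    also have "(\<Sum>j<N. (2 * A * influence r m (Suc j)) * (2 * B * influence r l (Suc j))) =
        4 * (A * B * (\<Sum>j<N. influence r m (Suc j) * influence r l (Suc j)))"
      by (simp add: sum_distrib_left mult_ac)
    also have "\<dots> \<le> 4 * (A * B * S)" using S A B by (intro mult_left_mono) auto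
    finally show ?thesis unfolding X0Y0 iX0 iY0 by (simp add: mult_ac)
  qed
  have "(\<lambda>N. 4 * (A * B * S) + (2 * A * lam * B) * r ^ N) \<longlonglongrightarrow> 4 * (A * B * S) + (2 * A * lam * B) * 0"
    using r0 by (intro tendsto_intros LIMSEQ_power_zero) auto
  then have cov2: "\<bar>(\<integral>p. X0 p * Y0 p \<partial>unif3) - (\<integral>p. X0 p \<partial>unif3) * (\<integral>p. Y0 p \<partial>unif3)\<bar> \<le> 4 * (A * B * S)"
    using cov by (intro LIMSEQ_le_const[where X="\<lambda>N. 4 * (A * B * S) + (2 * A * lam * B) * r ^ N"]) auto
  have "(\<integral>p. X p * Y p \<partial>unif3) - (\<integral>p. X0 p * Y0 p \<partial>unif3) = (\<integral>p. X p * Y p - X0 p * Y0 p \<partial>unif3)"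
    using integrable_unif3[OF bounded_borel_mult[OF bX bY]] integrable_unif3[OF bounded_borel_mult[OF bX0 bY0]] by simp
  also have "\<bar>\<dots>\<bar> \<le> (A * r ^ m) * B + A * (B * r ^ l)"
    by (intro abs_integral_unif3_le bounded_borel_diff bounded_borel_mult bX bY bX0 bY0 abs_product_diff_le dX dY absX0 absY)
  finally have d1: "\<bar>(\<integral>p. X p * Y p \<partial>unif3) - (\<integral>p. X0 p * Y0 p \<partial>unif3)\<bar> \<le> (A * r ^ m) * B + A * (B * r ^ l)" .
  have e1: "\<bar>(\<integral>p. X p \<partial>unif3) - (\<integral>p. X0 p \<partial>unif3)\<bar> \<le> A * r ^ m"
  proof -
    have "(\<integral>p. X p \<partial>unif3) - (\<integral>p. X0 p \<partial>unif3) = (\<integral>p. X p - X0 p \<partial>unif3)"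
      using integrable_unif3[OF bX] integrable_unif3[OF bX0] by simp
    then show ?thesis using abs_integral_unif3_le[OF bounded_borel_diff[OF bX bX0] dX] by simp
  qed
  have e2: "\<bar>(\<integral>p. Y p \<partial>unif3) - (\<integral>p. Y0 p \<partial>unif3)\<bar> \<le> B * r ^ l"
  proof -
    have "(\<integral>p. Y p \<partial>unif3) - (\<integral>p. Y0 p \<partial>unif3) = (\<integral>p. Y p - Y0 p \<partial>unif3)"
      using integrable_unif3[OF bY] integrable_unif3[OF bY0] by simp
    then show ?thesis using abs_integral_unif3_le[OF bounded_borel_diff[OF bY bY0] dY] by simp
  qed
  have d2: "\<bar>(\<integral>p. X p \<partial>unif3) * (\<integral>p. Y p \<partial>unif3) - (\<integral>p. X0 p \<partial>unif3) * (\<integral>p. Y0 p \<partial>unif3)\<bar>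
      \<le> (A * r ^ m) * B + A * (B * r ^ l)"
    by (intro abs_product_diff_le e1 e2 abs_integral_unif3_le bY bX0 absX0 absY)
  have "A * B * (2 * (r ^ m + r ^ l) + 4 * S) = ((A * r ^ m) * B + A * (B * r ^ l)) + 4 * (A * B * S) + ((A * r ^ m) * B + A * (B * r ^ l))"
    by (simp add: algebra_simps)
  then show ?thesis
    unfolding split intX[symmetric] intY[symmetric] using d1 d2 cov2 by linarith
qed

lemma correlation_decay:
  assumes M: "M \<ge> 2" and \<theta>: "0 < \<theta>" "\<theta> \<le> 1"
  obtains C where "C > 0"
    "\<And>A B F G n. n \<ge> 1 \<Longrightarrow> cube_holder \<theta> A F \<Longrightarrow> cube_holder \<theta> B G \<Longrightarrow>
      \<bar>(\<integral>p. F p * G ((fwd M ^^ n) p) \<partial>unif3) - (\<integral>p. F p \<partial>unif3) * (\<integral>p. G p \<partial>unif3)\<bar>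
        \<le> C * A * B * real n powr (- 3 / 2)"
proof -
  define r where "r = (1/2 :: real) powr \<theta>"
  have "(1/2) powr \<theta> < (1::real) powr \<theta>" using \<theta> by (intro powr_less_mono2) auto
  then have r: "0 < r" "r < 1" by (simp_all add: r_def)
  obtain C where C: "C > 0" "\<And>N m l. m \<le> l \<Longrightarrow> (\<Sum>j<N. influence r m (Suc j) * influence r l (Suc j))
       \<le> C * (real (m + l) + 1) powr (- 3 / 2)"
    using influence_pairing_le[OF r] by blast
  define K where "K = (\<Sum>t. r ^ t * (real t + 2)\<^sup>2)"
  have K: "r ^ t * (real t + 2)\<^sup>2 \<le> K" for t
    using sum_le_suminf[OF summable_square_geometric, of r "{t}"] r by (simp add: K_def)
  have K0: "K > 0" using K[of 0] by simp
  show thesis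
  proof (rule that)
    show "12 * K + 4 * C > 0" using K0 C by simp
    fix A B F G and n :: nat
    assume n: "n \<ge> 1" and F: "cube_holder \<theta> A F" and G: "cube_holder \<theta> B G"
    define m where "m = n div 2"
    define l where "l = n - m"
    define d where "d = real n powr (- 3 / 2)"
    have ml: "m \<le> l" "m + l = n" by (auto simp: m_def l_def)
    have d1: "(real n + 1) powr (- 3 / 2) \<le> d" unfolding d_def using n by (intro powr_mono2') auto
    have rl: "r ^ l \<le> r ^ m" using r ml by (intro power_decreasing) auto
    have rm: "r ^ m \<le> 3 * K * d"
    proof -
      have "n \<le> 2 * m + 1" by (simp add: m_def)
      then have "real n \<le> real (2 * m + 1)" by (simp only: of_nat_le_iff)
      then have n2: "real n / 2 \<le> real m + 2" by simp
      have "r ^ m \<le> K * (real m + 2) powr (- 2)"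
        using K[of m] by (simp add: powr_minus_divide powr_numeral pos_le_divide_eq)
      also have "\<dots> \<le> K * (real m + 2) powr (- 3 / 2)"
        using K0 by (intro mult_left_mono powr_mono) auto
      also have "\<dots> \<le> K * (3 * d)"
        unfolding d_def using K0 n n2 by (intro mult_left_mono powr_half_le) auto
      finally show ?thesis by simp
    qed
    have AB: "A * B \<ge> 0" using cube_holder_nonneg F G by auto
    have "\<bar>(\<integral>p. F p * G ((fwd M ^^ (m + l)) p) \<partial>unif3) - (\<integral>p. F p \<partial>unif3) * (\<integral>p. G p \<partial>unif3)\<bar>
      \<le> A * B * (2 * (r ^ m + r ^ l) + 4 * (C * (real (m + l) + 1) powr (- 3 / 2)))"
      by (rule correlation_le[OF M \<theta> r_def F G C(2)[OF ml(1)]])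
    also have "\<dots> \<le> A * B * ((12 * K + 4 * C) * d)"
    proof (rule mult_left_mono[OF _ AB])
      have "C * (real n + 1) powr (- 3 / 2) \<le> C * d" using C d1 by (intro mult_left_mono) auto
      then show "2 * (r ^ m + r ^ l) + 4 * (C * (real (m + l) + 1) powr (- 3 / 2)) \<le> (12 * K + 4 * C) * d"
        using rl rm unfolding ml(2) by (simp add: algebra_simps)
    qed
    finally show "\<bar>(\<integral>p. F p * G ((fwd M ^^ n) p) \<partial>unif3) - (\<integral>p. F p \<partial>unif3) * (\<integral>p. G p \<partial>unif3)\<bar>
        \<le> (12 * K + 4 * C) * A * B * real n powr (- 3 / 2)"
      unfolding ml(2) d_def[symmetric] by (simp add: mult_ac)
  qed
qed

lemma cube_holder_on_cube:
  assumes "\<theta> > 0" "\<phi> \<in> holder_space \<theta> unit_cube"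
  shows "cube_holder \<theta> (holder_norm \<theta> unit_cube \<phi>) (on_cube \<phi>)"
proof -
  have "on_cube \<phi> p = \<phi> p" "p \<in> unit_cube" if "p \<in> cube" for p
    using that cube_subset by (auto simp: on_cube_def)
  then show ?thesis
    unfolding cube_holder_def using bounded_borel_on_cube[OF assms] holder_norm_bounds[OF assms]
    by (intro conjI ballI) (simp_all only:)
qed


section \<open>The centre coordinate and the lower bound\<close>

text \<open>For \<open>M > 0\<close>, the centred value of the stack after its top \<open>i\<close> digits have been removed.\<close>

definition saw :: "nat \<Rightarrow> nat \<Rightarrow> real \<Rightarrow> real" where
  "saw M i c = frac (real M ^ i * c) - 1/2"

lemma frac_unit: "0 \<le> x \<Longrightarrow> x < 1 \<Longrightarrow> frac x = x"
  by (simp add: frac_eq)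

lemma bounded_borel_frac: "bounded_borel (frac :: real \<Rightarrow> real)"
  unfolding bounded_borel_def
  by (intro conjI frac_measurable exI[of _ 1]) (auto simp: less_imp_le[OF frac_lt_1])

lemma bounded_borel_saw: "bounded_borel (saw M i)"
proof -
  have "bounded_borel (\<lambda>c. frac (real M ^ i * c))" by (rule bounded_borel_compose[OF bounded_borel_frac]) measurable
  then show ?thesis unfolding saw_def by (intro bounded_borel_diff bounded_borel_const)
qed

lemma saw_frac: "saw M i (frac (real M * c)) = saw M (Suc i) c"
proof -
  have "real M ^ i * frac (real M * c) = real M ^ Suc i * c + real_of_int (- (int M ^ i * \<lfloor>real M * c\<rfloor>))"
    by (simp add: frac_def algebra_simps)
  then show ?thesis unfolding saw_def by (simp only: frac_add_of_int_right)
qed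

lemma saw_append:
  assumes "M > 0" shows "saw M (Suc i) ((c + real k) / real M) = saw M i c"
proof -
  have "real M ^ Suc i * ((c + real k) / real M) = real M ^ i * c + real_of_int (int M ^ i * int k)"
    using assms by (simp add: field_simps)
  then show ?thesis unfolding saw_def by (simp only: frac_add_of_int_right)
qed

lemma saw_0_append:
  assumes "M > 0" "c \<in> {0..<1}" "k < M" shows "saw M 0 ((c + real k) / real M) = (c + real k) / real M - 1/2"
  using append_cube[OF assms] by (simp add: saw_def frac_unit)

text \<open>Halving the interval gives a linear equation for the moment, since the two halves are affine copies of
the whole.\<close>

lemma integral_frac: "(\<integral>c. frac c \<partial>unif) = 1/2"
proof -
  have h: "bounded_borel (\<lambda>c. frac (c / 2))" "bounded_borel (\<lambda>c. frac (1/2 + c / 2))"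
    by (rule bounded_borel_compose[OF bounded_borel_frac]; measurable)+
  have "(\<integral>c. frac (c / 2) \<partial>unif) = (\<integral>c. frac c / 2 \<partial>unif)"
    by (intro integral_unif_cong h bounded_borel_divide bounded_borel_frac) (simp add: frac_unit)
  moreover have "(\<integral>c. frac (1/2 + c / 2) \<partial>unif) = (\<integral>c. 1/2 + frac c / 2 \<partial>unif)"
    by (intro integral_unif_cong h bounded_borel_divide bounded_borel_add bounded_borel_const bounded_borel_frac) (simp add: frac_unit)
  moreover have "(\<integral>c. frac c / 2 \<partial>unif) = (\<integral>c. frac c \<partial>unif) / 2" by simp
  moreover have "(\<integral>c. 1/2 + frac c / 2 \<partial>unif) = 1/2 + (\<integral>c. frac c \<partial>unif) / 2"
    using integrable_unif[OF bounded_borel_frac] by simp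
  ultimately show ?thesis
    using integral_unif_halves[OF bounded_borel_frac] by linarith
qed

lemma integral_frac_sq: "(\<integral>c. frac c * frac c \<partial>unif) = 1/3"
proof -
  have b: "bounded_borel (\<lambda>c::real. frac c * frac c)" by (intro bounded_borel_mult bounded_borel_frac)
  have h: "bounded_borel (\<lambda>c. frac (c / 2) * frac (c / 2))" "bounded_borel (\<lambda>c. frac (1/2 + c / 2) * frac (1/2 + c / 2))"
    by (intro bounded_borel_mult bounded_borel_compose[OF bounded_borel_frac]; measurable)+
  have "(\<integral>c. frac (c / 2) * frac (c / 2) \<partial>unif) = (\<integral>c. frac c * frac c / 4 \<partial>unif)"
    by (intro integral_unif_cong h bounded_borel_divide b) (simp add: frac_unit)
  moreover have "(\<integral>c. frac (1/2 + c / 2) * frac (1/2 + c / 2) \<partial>unif) = (\<integral>c. (frac c * frac c / 4 + frac c / 2) + 1/4 \<partial>unif)"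
    by (intro integral_unif_cong h bounded_borel_divide bounded_borel_add bounded_borel_const bounded_borel_frac b) (simp add: frac_unit algebra_simps add_divide_distrib)
  moreover have "(\<integral>c. frac c * frac c / 4 \<partial>unif) = (\<integral>c. frac c * frac c \<partial>unif) / 4" by simp
  moreover have "(\<integral>c. (frac c * frac c / 4 + frac c / 2) + 1/4 \<partial>unif) = (\<integral>c. frac c * frac c \<partial>unif) / 4 + (\<integral>c. frac c \<partial>unif) / 2 + 1/4"
    using integrable_unif[OF bounded_borel_frac] integrable_unif[OF b] by simp
  ultimately show ?thesis
    using integral_unif_halves[OF b] integral_frac by linarith
qed

lemma integral_saw: assumes "M > 0" shows "(\<integral>c. saw M i c \<partial>unif) = 0"
proof (induction i)
  case 0
  show ?case using integral_frac integrable_unif[OF bounded_borel_frac] by (simp add: saw_def)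
next
  case (Suc i)
  show ?case using integral_unif_split[OF bounded_borel_saw assms, of M "Suc i"] Suc by (simp add: saw_append[OF assms])
qed

text \<open>The averaging operator on functions of the centre coordinate alone. It is the mean of popping and of its
adjoint, pushing a uniform digit, and hence symmetric.\<close>

definition center_op :: "nat \<Rightarrow> (real \<Rightarrow> real) \<Rightarrow> real \<Rightarrow> real" where
  "center_op M h c = h (frac (real M * c)) / 2 + (\<Sum>k<M. h ((c + real k) / real M)) / (2 * real M)"

lemma bounded_borel_center_op: assumes "bounded_borel h" shows "bounded_borel (center_op M h)"
  unfolding center_op_def
  by (intro bounded_borel_add bounded_borel_divide bounded_borel_sum; rule bounded_borel_compose[OF assms]; measurable)

lemma integral_center_op_half:
  assumes g: "bounded_borel g" and h: "bounded_borel h" and M: "M > 0"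
  shows "(\<integral>c. g c * h (frac (real M * c)) \<partial>unif) = (\<Sum>k<M. \<integral>c. g ((c + real k) / real M) * h c \<partial>unif) / real M"
proof -
  have hf: "bounded_borel (\<lambda>c. h (frac (real M * c)))" by (rule bounded_borel_compose[OF h]) measurable
  have gk: "bounded_borel (\<lambda>c. g ((c + real k) / real M))" for k by (rule bounded_borel_compose[OF g]) measurable
  have hk: "bounded_borel (\<lambda>c. h (frac (real M * ((c + real k) / real M))))" for k by (rule bounded_borel_compose[OF h]) measurable
  have "(\<integral>c. g c * h (frac (real M * c)) \<partial>unif) =
     (\<Sum>k<M. \<integral>c. g ((c + real k) / real M) * h (frac (real M * ((c + real k) / real M))) \<partial>unif) / real M"
    by (rule integral_unif_split[OF bounded_borel_mult[OF g hf] M])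
  also have "\<dots> = (\<Sum>k<M. \<integral>c. g ((c + real k) / real M) * h c \<partial>unif) / real M"
    by (intro arg_cong2[where f="(/)"] sum.cong refl integral_unif_cong bounded_borel_mult gk h hk) (simp only: digit_append[OF M])
  finally show ?thesis .
qed

lemma center_op_symmetric:
  assumes g: "bounded_borel g" and h: "bounded_borel h" and M: "M > 0"
  shows "(\<integral>c. g c * center_op M h c \<partial>unif) = (\<integral>c. center_op M g c * h c \<partial>unif)"
proof -
  have expand: "(\<integral>c. g c * center_op M h c \<partial>unif) = (\<integral>c. g c * h (frac (real M * c)) \<partial>unif) / 2
      + (\<Sum>k<M. \<integral>c. g c * h ((c + real k) / real M) \<partial>unif) / (2 * real M)"
    if g: "bounded_borel g" and h: "bounded_borel h" for g h
  proof -
    have 1: "integrable unif (\<lambda>c. g c * h (frac (real M * c)))"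
      by (intro integrable_unif bounded_borel_mult g bounded_borel_compose[OF h]) measurable
    have 2: "integrable unif (\<lambda>c. g c * h ((c + real k) / real M))" for k
      by (intro integrable_unif bounded_borel_mult g bounded_borel_compose[OF h]) measurable
    have "g c * center_op M h c = g c * h (frac (real M * c)) / 2 + (\<Sum>k<M. g c * h ((c + real k) / real M)) / (2 * real M)" for c
      by (simp add: center_op_def distrib_left sum_distrib_left)
    then show ?thesis using 1 2 by simp
  qed
  have "(\<integral>c. g c * center_op M h c \<partial>unif) =
     (\<Sum>k<M. \<integral>c. h c * g ((c + real k) / real M) \<partial>unif) / (2 * real M) + (\<integral>c. h c * g (frac (real M * c)) \<partial>unif) / 2"
    unfolding expand[OF g h] integral_center_op_half[OF g h M] integral_center_op_half[OF h g M]
    by (simp add: mult.commute)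
  also have "\<dots> = (\<integral>c. h c * center_op M g c \<partial>unif)"
    unfolding expand[OF h g] by simp
  finally show ?thesis by (simp add: mult.commute)
qed

lemma center_op_saw_Suc:
  assumes "M > 0" shows "center_op M (saw M (Suc i)) c = (saw M i c + saw M (Suc (Suc i)) c) / 2"
  unfolding center_op_def saw_frac saw_append[OF assms] using assms by (simp add: field_simps)

text \<open>A digit pushed onto the full stack averages out and shrinks the old content by the factor \<open>M\<close>; this
holding weight \<open>1 / (2 M)\<close> at the boundary is what makes correlations at odd times positive.\<close>

lemma center_op_saw_0:
  assumes M: "M > 0" and c: "c \<in> {0..<1}"
  shows "center_op M (saw M 0) c = (saw M 0 c / real M + saw M 1 c) / 2"
proof -
  have "(\<Sum>k<M. saw M 0 ((c + real k) / real M)) = (\<Sum>k<M. c / real M - 1/2 + real k / real M)"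
    using saw_0_append[OF M c] by (intro sum.cong) (auto simp: add_divide_distrib)
  also have "\<dots> = c - real M / 2 + (\<Sum>k<M. real k) / real M"
    using M by (simp add: sum.distrib sum_divide_distrib right_diff_distrib)
  also have "(\<Sum>k<M. real k) = real M * (real M - 1) / 2"
    by (induction M) (simp_all add: field_simps)
  also have "c - real M / 2 + real M * (real M - 1) / 2 / real M = saw M 0 c"
    using M c by (simp add: saw_def frac_unit field_simps)
  finally show ?thesis
    unfolding center_op_def saw_frac by (simp add: add_divide_distrib mult.commute)
qed

definition saw_corr :: "nat \<Rightarrow> nat \<Rightarrow> nat \<Rightarrow> real" where
  "saw_corr M n i = (\<integral>c. saw M i c * (center_op M ^^ n) frac c \<partial>unif)"

lemma bounded_borel_center_op_iter: "bounded_borel ((center_op M ^^ n) frac)"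
  by (induction n) (auto intro: bounded_borel_frac bounded_borel_center_op)

lemma saw_corr_Suc_Suc:
  assumes M: "M > 0"
  shows "saw_corr M (Suc n) (Suc i) = (saw_corr M n i + saw_corr M n (Suc (Suc i))) / 2"
proof -
  have int: "integrable unif (\<lambda>c. saw M i c * (center_op M ^^ n) frac c)" for i
    by (intro integrable_unif bounded_borel_mult bounded_borel_saw bounded_borel_center_op_iter)
  have "saw_corr M (Suc n) (Suc i) = (\<integral>c. center_op M (saw M (Suc i)) c * (center_op M ^^ n) frac c \<partial>unif)"
    unfolding saw_corr_def funpow.simps o_apply
    by (rule center_op_symmetric[OF bounded_borel_saw bounded_borel_center_op_iter M])
  also have "\<dots> = (\<integral>c. (saw M i c * (center_op M ^^ n) frac c + saw M (Suc (Suc i)) c * (center_op M ^^ n) frac c) / 2 \<partial>unif)"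
    by (simp only: center_op_saw_Suc[OF M]) (simp add: distrib_right)
  also have "\<dots> = (saw_corr M n i + saw_corr M n (Suc (Suc i))) / 2"
    using int by (simp add: saw_corr_def)
  finally show ?thesis .
qed

lemma saw_corr_Suc_0:
  assumes M: "M > 0"
  shows "saw_corr M (Suc n) 0 = (saw_corr M n 0 / real M + saw_corr M n 1) / 2"
proof -
  have b: "bounded_borel (\<lambda>c. saw M i c * (center_op M ^^ n) frac c)" for i
    by (intro bounded_borel_mult bounded_borel_saw bounded_borel_center_op_iter)
  have "saw_corr M (Suc n) 0 = (\<integral>c. center_op M (saw M 0) c * (center_op M ^^ n) frac c \<partial>unif)"
    unfolding saw_corr_def funpow.simps o_apply
    by (rule center_op_symmetric[OF bounded_borel_saw bounded_borel_center_op_iter M])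
  also have "\<dots> = (\<integral>c. (saw M 0 c * (center_op M ^^ n) frac c / real M + saw M 1 c * (center_op M ^^ n) frac c) / 2 \<partial>unif)"
    by (intro integral_unif_cong bounded_borel_mult bounded_borel_center_op bounded_borel_saw bounded_borel_center_op_iter bounded_borel_divide bounded_borel_add)
       (simp add: center_op_saw_0[OF M] distrib_right)
  also have "\<dots> = (saw_corr M n 0 / real M + saw_corr M n 1) / 2"
    using integrable_unif[OF b] by (simp add: saw_corr_def)
  finally show ?thesis .
qed

lemma saw_corr_0:
  assumes M: "M > 0" shows "saw_corr M 0 i = 1 / (12 * real M ^ i)"
proof (induction i)
  case 0
  have "saw_corr M 0 0 = (\<integral>c. frac c * frac c - frac c / 2 \<partial>unif)"
    by (simp add: saw_corr_def saw_def left_diff_distrib)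
  also have "\<dots> = 1/3 - 1/4"
    using integral_frac integral_frac_sq integrable_unif[OF bounded_borel_frac] integrable_unif[OF bounded_borel_mult[OF bounded_borel_frac bounded_borel_frac]]
    by simp
  finally show ?case by simp
next
  case (Suc i)
  have b: "bounded_borel (\<lambda>c. saw M i c * frac c)" by (intro bounded_borel_mult bounded_borel_saw bounded_borel_frac)
  have fk: "bounded_borel (\<lambda>c. frac ((c + real k) / real M))" for k by (rule bounded_borel_compose[OF bounded_borel_frac]) measurable
  have "(\<integral>c. saw M (Suc i) ((c + real k) / real M) * frac ((c + real k) / real M) \<partial>unif) = saw_corr M 0 i / real M" if "k < M" for k
  proof -
    have "(\<integral>c. saw M (Suc i) ((c + real k) / real M) * frac ((c + real k) / real M) \<partial>unif) =
       (\<integral>c. saw M i c * frac c / real M + saw M i c * (real k / real M) \<partial>unif)"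
      unfolding saw_append[OF M]
    proof (intro integral_unif_cong bounded_borel_mult bounded_borel_add bounded_borel_divide bounded_borel_saw bounded_borel_frac bounded_borel_const fk)
      fix c :: real assume c: "c \<in> {0..<1}"
      then show "saw M i c * frac ((c + real k) / real M) = saw M i c * frac c / real M + saw M i c * (real k / real M)"
        using append_cube[OF M c that] by (simp add: frac_unit add_divide_distrib distrib_left)
    qed
    also have "\<dots> = saw_corr M 0 i / real M"
      using integrable_unif[OF b] integrable_unif[OF bounded_borel_saw, of M i] integral_saw[OF M, of i]
      by (simp add: saw_corr_def)
    finally show ?thesis .
  qed
  then have "saw_corr M 0 (Suc i) = saw_corr M 0 i / real M"
    using integral_unif_split[OF bounded_borel_mult[OF bounded_borel_saw bounded_borel_frac] M, of M "Suc i"] M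
    by (simp add: saw_corr_def)
  then show ?case using Suc by simp
qed

lemma saw_corr_nonneg: "M > 0 \<Longrightarrow> saw_corr M n i \<ge> 0"
proof (induction n arbitrary: i)
  case (Suc n) then show ?case by (cases i) (auto simp: saw_corr_Suc_0 saw_corr_Suc_Suc simp del: One_nat_def)
qed (simp add: saw_corr_0)

text \<open>Both sides obey the same recursion in the interior. At the boundary the left side has an additional
nonnegative term, and initially it dominates since \<open>killed 0 1\<close> is the unit mass at 1.\<close>

lemma saw_corr_ge_killed: "M > 0 \<Longrightarrow> saw_corr M n i \<ge> killed n 1 (Suc i) / 12"
proof (induction n arbitrary: i)
  case 0 then show ?case by (simp add: saw_corr_0 killed_0)
next
  case (Suc n)
  show ?case
  proof (cases i)
    case 0
    have "saw_corr M n 0 / real M \<ge> 0" using saw_corr_nonneg Suc.prems by simp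
    then have "saw_corr M (Suc n) 0 \<ge> saw_corr M n 1 / 2"
      unfolding saw_corr_Suc_0[OF Suc.prems] by (intro divide_right_mono) auto
    moreover have "killed (Suc n) 1 (Suc 0) = killed n 1 (Suc 1) / 2"
      by (simp add: killed_Suc)
    ultimately show ?thesis
      using Suc.IH[OF Suc.prems, of 1] unfolding 0 by linarith
  next
    case (Suc j)
    then show ?thesis using Suc.IH[OF Suc.prems, of j] Suc.IH[OF Suc.prems, of "Suc (Suc j)"] Suc.prems
      by (simp add: saw_corr_Suc_Suc killed_Suc)
  qed
qed

lemma saw_corr_lower:
  assumes M: "M > 0" and n: "n \<ge> 1"
  shows "saw_corr M n 0 \<ge> 1 / (96 * real M) * real n powr (- 3 / 2)"
proof -
  have even: "saw_corr M k 0 \<ge> 1 / 48 * real k powr (- 3 / 2)" if "even k" "k \<ge> 2" for k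
  proof -
    have "1 / 48 * real k powr (- 3 / 2) \<le> excursion k / 12" using excursion_ge[OF that] by simp
    also have "\<dots> \<le> saw_corr M k 0" using saw_corr_ge_killed[OF M, of k 0] killed_eq_excursion[OF that(1)] by simp
    finally show ?thesis .
  qed
  have p: "real n powr (- 3 / 2) \<ge> 0" by simp
  show ?thesis
  proof (cases "even n")
    case True
    then have "n \<ge> 2" using n by presburger
    have "1 / (96 * real M) \<le> 1 / 48" using M by (simp add: field_simps)
    then have "1 / (96 * real M) * real n powr (- 3 / 2) \<le> 1 / 48 * real n powr (- 3 / 2)" using p by (rule mult_right_mono)
    then show ?thesis using even[OF True \<open>n \<ge> 2\<close>] by simp
  next
    case False
    then obtain m where m: "n = Suc m" "even m" using n by (cases n) auto
    \<comment> \<open>The case \<open>m = 0\<close> is separate because the even-time bound starts at time 2.\<close>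
    have "saw_corr M m 0 \<ge> 1 / 48 * real n powr (- 3 / 2)"
    proof (cases "m = 0")
      case True
      then show ?thesis using m by (simp add: saw_corr_0[OF M])
    next
      case False
      then have "m \<ge> 2" using m(2) by presburger
      have "real n powr (- 3 / 2) \<le> real m powr (- 3 / 2)" using False m by (intro powr_mono2') auto
      then show ?thesis using even[OF m(2) \<open>m \<ge> 2\<close>] by simp
    qed
    then have "1 / 48 * real n powr (- 3 / 2) / real M / 2 \<le> saw_corr M m 0 / real M / 2"
      using M by (intro divide_right_mono) auto
    moreover have "saw_corr M n 0 \<ge> saw_corr M m 0 / real M / 2"
      using saw_corr_nonneg[OF M, of m 1] by (simp add: m(1) saw_corr_Suc_0[OF M])
    moreover have "1 / 48 * real n powr (- 3 / 2) / real M / 2 = 1 / (96 * real M) * real n powr (- 3 / 2)" by simp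
    ultimately show ?thesis by linarith
  qed
qed

lemma bounded_borel_center: "bounded_borel (\<lambda>p::real \<times> real \<times> real. frac (fst (snd p)))"
proof -
  have "(\<lambda>p::real \<times> real \<times> real. fst (snd p)) \<in> borel_measurable borel"
    unfolding borel_prod[symmetric] by measurable
  then show ?thesis by (rule bounded_borel_compose[OF bounded_borel_frac])
qed

lemma integral_center_iter:
  assumes M: "M > 0"
  shows "(\<integral>u. frac (fst (snd ((fwd M ^^ n) (u, c, s)))) \<partial>unif) = (center_op M ^^ n) frac c"
proof -
  note b = bounded_borel_center
  have "(averaged_step M (1/2) 0 ^^ n) (\<lambda>s c. frac c) = (\<lambda>s. (center_op M ^^ n) frac)"
  proof (induction n)
    case (Suc n)
    show ?case unfolding funpow.simps o_apply Suc
      by (intro ext) (simp only: averaged_step_def center_op_def)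
  qed simp
  then show ?thesis
    using fun_cong[OF fun_cong[OF integral_fwd_iter[OF b M, of n]], of c s] by simp
qed

lemma center_correlation:
  assumes M: "M > 0"
  shows "(\<integral>p. frac (fst (snd p)) * frac (fst (snd ((fwd M ^^ n) p))) \<partial>unif3)
      - (\<integral>p. frac (fst (snd p)) \<partial>unif3) * (\<integral>p. frac (fst (snd p)) \<partial>unif3) = saw_corr M n 0"
proof -
  note b = bounded_borel_center
  have bn: "bounded_borel (\<lambda>p. frac (fst (snd ((fwd M ^^ n) p))))" by (rule bounded_borel_compose[OF b]) measurable
  have i1: "(\<integral>p. frac (fst (snd p)) \<partial>unif3) = 1/2"
    unfolding integral_unif3_iterated[OF b] by (simp add: integral_frac)
  have "(\<integral>c. (center_op M ^^ n) frac c \<partial>unif) = (\<integral>p. frac (fst (snd ((fwd M ^^ n) p))) \<partial>unif3)"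
    unfolding integral_unif3_iterated[OF bn] by (simp add: integral_center_iter[OF M])
  also have "\<dots> = 1/2" using integral_fwd_iter_invariant[OF b M] i1 by simp
  finally have i2: "(\<integral>c. (center_op M ^^ n) frac c \<partial>unif) = 1/2" .
  have "(\<integral>p. frac (fst (snd p)) * frac (fst (snd ((fwd M ^^ n) p))) \<partial>unif3) = (\<integral>c. frac c * (center_op M ^^ n) frac c \<partial>unif)"
    unfolding integral_unif3_iterated[OF bounded_borel_mult[OF b bn]] by (simp add: integral_center_iter[OF M])
  also have "\<dots> = (\<integral>c. saw M 0 c * (center_op M ^^ n) frac c + (center_op M ^^ n) frac c / 2 \<partial>unif)"
    by (simp add: saw_def left_diff_distrib)
  also have "\<dots> = (\<integral>c. saw M 0 c * (center_op M ^^ n) frac c \<partial>unif) + (\<integral>c. (center_op M ^^ n) frac c / 2 \<partial>unif)"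
    by (intro Bochner_Integration.integral_add integrable_unif bounded_borel_mult bounded_borel_saw bounded_borel_divide bounded_borel_center_op_iter)
  also have "\<dots> = saw_corr M n 0 + 1/4"
    using i2 by (simp add: saw_corr_def)
  finally show ?thesis unfolding i1 by simp
qed

lemma center_holder:
  assumes "0 < \<theta>" "\<theta> \<le> 1"
  shows "(\<lambda>p. fst (snd p)) \<in> holder_space \<theta> unit_cube"
proof -
  have "\<bar>fst (snd x) - fst (snd y)\<bar> \<le> 1 * dist x y powr \<theta>" if "x \<in> unit_cube" "y \<in> unit_cube" for x y
  proof -
    define e where "e = \<bar>fst (snd x) - fst (snd y)\<bar>"
    have e: "0 \<le> e" "e \<le> 1" using that by (auto simp: e_def unit_cube_def)
    have "e \<le> dist (snd x) (snd y)"
      using dist_fst_le[of "snd x" "snd y"] by (simp add: e_def dist_real_def)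
    also have "\<dots> \<le> dist x y" by (rule dist_snd_le)
    finally have "e powr \<theta> \<le> dist x y powr \<theta>" using e assms by (intro powr_mono2) auto
    moreover have "e \<le> e powr \<theta>" using powr_mono'[of \<theta> 1 e] e assms by simp
    ultimately show ?thesis by (simp add: e_def)
  qed
  then show ?thesis unfolding holder_space_def by blast
qed

theorem mainTheorem1:
  fixes M :: nat and \<theta> :: real and f :: "real \<times> real \<times> real \<Rightarrow> real \<times> real \<times> real"
  assumes "M \<ge> 2"
    and "f = baker3 M (1 / (2 * real M)) (1 / (2 * real M))"
    and "0 < \<theta>" and "\<theta> \<le> 1"
  shows "(\<exists>C>0. \<forall>\<phi> \<in> holder_space \<theta> unit_cube. \<forall>\<psi> \<in> holder_space \<theta> unit_cube. \<forall>n\<ge>1.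
            Cor \<phi> (\<psi> \<circ> (f ^^ n))
              \<le> C * holder_norm \<theta> unit_cube \<phi> * holder_norm \<theta> unit_cube \<psi> * real n powr (- 3 / 2))
       \<and> (\<exists>\<phi> \<in> holder_space \<theta> unit_cube. \<exists>\<psi> \<in> holder_space \<theta> unit_cube. \<exists>C>0. \<forall>n\<ge>1.
            Cor \<phi> (\<psi> \<circ> (f ^^ n)) \<ge> C * real n powr (- 3 / 2))"
proof
  have M: "M > 0" using assms(1) by simp
  obtain C where C: "C > 0" "\<And>A B F G n. n \<ge> 1 \<Longrightarrow> cube_holder \<theta> A F \<Longrightarrow> cube_holder \<theta> B G \<Longrightarrow>
      \<bar>(\<integral>p. F p * G ((fwd M ^^ n) p) \<partial>unif3) - (\<integral>p. F p \<partial>unif3) * (\<integral>p. G p \<partial>unif3)\<bar>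
        \<le> C * A * B * real n powr (- 3 / 2)"
    using correlation_decay[OF assms(1,3,4)] by blast
  show "\<exists>C>0. \<forall>\<phi> \<in> holder_space \<theta> unit_cube. \<forall>\<psi> \<in> holder_space \<theta> unit_cube. \<forall>n\<ge>1.
            Cor \<phi> (\<psi> \<circ> (f ^^ n))
              \<le> C * holder_norm \<theta> unit_cube \<phi> * holder_norm \<theta> unit_cube \<psi> * real n powr (- 3 / 2)"
  proof (intro exI[of _ C] conjI ballI allI impI C(1))
    fix \<phi> \<psi> and n :: nat
    assume h: "\<phi> \<in> holder_space \<theta> unit_cube" "\<psi> \<in> holder_space \<theta> unit_cube" "n \<ge> 1"
    show "Cor \<phi> (\<psi> \<circ> (f ^^ n))
              \<le> C * holder_norm \<theta> unit_cube \<phi> * holder_norm \<theta> unit_cube \<psi> * real n powr (- 3 / 2)"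
      unfolding assms(2) Cor_baker3_eq[OF M assms(3) h(1,2)]
      by (rule C(2)[OF h(3) cube_holder_on_cube[OF assms(3) h(1)] cube_holder_on_cube[OF assms(3) h(2)]])
  qed
next
  have M: "M > 0" using assms(1) by simp
  define \<phi> :: "real \<times> real \<times> real \<Rightarrow> real" where "\<phi> p = fst (snd p)" for p
  have \<phi>: "\<phi> \<in> holder_space \<theta> unit_cube"
    using center_holder[OF assms(3,4)] by (simp add: \<phi>_def[abs_def])
  have on: "on_cube \<phi> p = frac (fst (snd p))" if "p \<in> cube" for p
    using that by (auto simp: on_cube_def \<phi>_def cube_def frac_unit)
  have lower: "1 / (96 * real M) * real n powr (- 3 / 2) \<le> Cor \<phi> (\<phi> \<circ> (f ^^ n))" if n: "n \<ge> 1" for n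
  proof -
    note b = bounded_borel_center
    have bn: "bounded_borel (\<lambda>p. frac (fst (snd ((fwd M ^^ n) p))))" by (rule bounded_borel_compose[OF b]) measurable
    have bc: "bounded_borel (on_cube \<phi>)" by (rule bounded_borel_on_cube[OF assms(3) \<phi>])
    have bcn: "bounded_borel (\<lambda>p. on_cube \<phi> ((fwd M ^^ n) p))" by (rule bounded_borel_compose[OF bc]) measurable
    have 1: "(\<integral>p. on_cube \<phi> p \<partial>unif3) = (\<integral>p. frac (fst (snd p)) \<partial>unif3)"
      by (rule integral_unif3_cong[OF bc b on])
    have 2: "(\<integral>p. on_cube \<phi> p * on_cube \<phi> ((fwd M ^^ n) p) \<partial>unif3) =
        (\<integral>p. frac (fst (snd p)) * frac (fst (snd ((fwd M ^^ n) p))) \<partial>unif3)"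
      by (rule integral_unif3_cong[OF bounded_borel_mult[OF bc bcn] bounded_borel_mult[OF b bn]])
         (simp add: on fwd_iter_cube[OF M])
    show ?thesis
      unfolding assms(2) Cor_baker3_eq[OF M assms(3) \<phi> \<phi>] 1 2 center_correlation[OF M]
      using saw_corr_lower[OF M n] by simp
  qed
  have "1 / (96 * real M) > 0" using M by simp
  with lower \<phi> show "\<exists>\<phi> \<in> holder_space \<theta> unit_cube. \<exists>\<psi> \<in> holder_space \<theta> unit_cube. \<exists>C>0. \<forall>n\<ge>1.
            Cor \<phi> (\<psi> \<circ> (f ^^ n)) \<ge> C * real n powr (- 3 / 2)"
    by blast
qed

end
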